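(* Let $\mathcal Z$ be a Polish space equipped with a fixed compatible complete bounded metric $\rho_{\mathcal Z}$, and let $N \ge 2$ be an integer. A set $K \subseteq \mathscr P(\mathcal Z^N)$ is relatively compact in the information topology on $\mathscr P(\mathcal Z^N)$ if and only if both of the following hold: (1) $K$ is relatively compact in the weak topology on $\mathscr P(\mathcal Z^N)$; and (2) $\displaystyle \lim_{\delta \searrow 0} \sup_{\mu \in K} \omega_{\mathcal I_t(\mu)}(\delta) = 0$ for all $t \in \{1, \dots, N-1\}$.
   Context: For a Polish space $\mathcal X$, $\mathscr P(\mathcal X)$ denotes the set of Borel probability measures on $\mathcal X$, equipped with the weak topology (convergence against bounded continuous functions) unless another topology is named, and $\mathscr P^{\le}(\mathcal X)$ denotes the set of Borel subprobability measures (total mass at most $1$) on $\mathcal X$. A subset of a topological space is relatively compact if it is contained in a compact subset of that space. Let $Z_t : \mathcal Z^N \to \mathcal Z$ be the projection on the $t$-th coordinate. For $1 \le t < N$ the map $\mathcal I_t : \mathscr P(\mathcal Z^N) \to \mathscr P(\mathcal Z^t \times \mathscr P(\mathcal Z^{N-t}))$ sends $\mu$ to the joint law under $\mu$ of $$\big(Z_1, \dots, Z_t, \mathcal L^\mu(Z_{t+1}, \dots, Z_N \mid Z_1, \dots, Z_t)\big),$$ where $\mathcal L^\mu(Z_{t+1}, \dots, Z_N \mid Z_1, \dots, Z_t)$ is the (regular) conditional law of $(Z_{t+1}, \dots, Z_N)$ given $(Z_1, \dots, Z_t)$ under $\mu$. The information topology on $\mathscr P(\mathcal Z^N)$ is the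 initial topology with respect to the maps $\mathcal I_t$, $1 \le t < N$, where each target $\mathscr P(\mathcal Z^t \times \mathscr P(\mathcal Z^{N-t}))$ carries the weak topology. Modulus of continuity: for Polish metric spaces $(\mathcal X, \rho_{\mathcal X})$, $(\mathcal Y, \rho_{\mathcal Y})$ and $\mu \in \mathscr P(\mathcal X \times \mathcal Y)$, for a measure $\gamma$ on $\mathcal X \times \mathcal Y \times \mathcal X \times \mathcal Y$ put $$\rho^{\mathcal X}(\gamma) := \int \rho_{\mathcal X}(x_1,x_2)\, d\gamma(x_1,y_1,x_2,y_2), \qquad \rho^{\mathcal Y}(\gamma) := \int \rho_{\mathcal Y}(y_1,y_2)\, d\gamma(x_1,y_1,x_2,y_2).$$ Let $\mathrm{Per}(\mu,\delta)$ be the set of $\gamma \in \mathscr P^{\le}(\mathcal X \times \mathcal Y \times \mathcal X \times \mathcal Y)$ such that both $\mathcal X \times \mathcal Y$-marginals of $\gamma$ (the images under $(x_1,y_1,x_2,y_2)\mapsto(x_1,y_1)$ and $\mapsto (x_2,y_2)$) are $\le \mu$ and $\rho^{\mathcal X}(\gamma) \le \delta$. Then $\omega_\mu(\delta) := \sup_{\gamma \in \mathrm{Per}(\mu,\delta)} \rho^{\mathcal Y}(\gamma)$ for $\delta \ge 0$. In $\omega_{\mathcal I_t(\mu)}$ one takes $\mathcal X := \mathcal Z^t$ with the metric $\rho_{\mathcal X}((z_i)_i,(z_i')_i) := \sum_{i=1}^t \rho_{\mathcal Z}(z_i,z_i')$, and $\mathcal Y := \mathscr P(\mathcal Z^{N-t})$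 with the $1$-Wasserstein metric built from the sum metric $\sum_i \rho_{\mathcal Z}(z_i, z'_i)$ on $\mathcal Z^{N-t}$. *)

theory Defs
  imports "HOL-Probability.Probability"
begin

definition relatively_compact_in :: "'a topology \<Rightarrow> 'a set \<Rightarrow> bool" where
  "relatively_compact_in X K \<longleftrightarrow> (\<exists>C. compactin X C \<and> K \<subseteq> C)"

text \<open>The carrier is \<open>A\<close> provided that \<open>I\<close> is nonempty and every \<open>f i\<close> maps \<open>A\<close> into the
  carrier of \<open>T i\<close>, as is the case in both uses below (for the information topology if
  \<open>N \<ge> 2\<close>).\<close>

definition initial_topology ::
    "'a set \<Rightarrow> 'i set \<Rightarrow> ('i \<Rightarrow> 'b topology) \<Rightarrow> ('i \<Rightarrow> 'a \<Rightarrow> 'b) \<Rightarrow> 'a topology" where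
  "initial_topology A I T f =
     topology_generated_by {f i -` U \<inter> A | i U. i \<in> I \<and> openin (T i) U}"

definition borel_of :: "'a topology \<Rightarrow> 'a measure" where
  "borel_of X = sigma (topspace X) {U. openin X U}"

abbreviation prob_measures :: "'a topology \<Rightarrow> 'a measure set" where
  "prob_measures X \<equiv> space (prob_algebra (borel_of X))"

abbreviation subprob_measures :: "'a topology \<Rightarrow> 'a measure set" where
  "subprob_measures X \<equiv> space (subprob_algebra (borel_of X))"

definition weak_topology :: "'a topology \<Rightarrow> 'a measure topology" where
  "weak_topology X =
     initial_topology (prob_measures X)
       {f. continuous_map X euclideanreal f \<and> bounded (f ` topspace X)}
       (\<lambda>_. euclideanreal) (\<lambda>f \<mu>. \<integral>x. f x \<partial>\<mu>)"

text \<open>The \<open>n\<close>-fold power of a space consists of the extensional functions on \<open>{1..n}\<close>, so that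
  the exponent can vary inside a statement.\<close>

definition power_topology :: "nat \<Rightarrow> (nat \<Rightarrow> 'z::topological_space) topology" where
  "power_topology n = product_topology (\<lambda>_. euclidean) {1..n}"

definition sum_dist :: "nat \<Rightarrow> (nat \<Rightarrow> 'z::metric_space) \<Rightarrow> (nat \<Rightarrow> 'z) \<Rightarrow> real" where
  "sum_dist n x y = (\<Sum>i=1..n. dist (x i) (y i))"

definition first_coords :: "nat \<Rightarrow> (nat \<Rightarrow> 'z) \<Rightarrow> nat \<Rightarrow> 'z" where
  "first_coords t z = (\<lambda>i\<in>{1..t}. z i)"

definition last_coords :: "nat \<Rightarrow> nat \<Rightarrow> (nat \<Rightarrow> 'z) \<Rightarrow> nat \<Rightarrow> 'z" where
  "last_coords N t z = (\<lambda>i\<in>{1..N - t}. z (t + i))"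

text \<open>\<open>\<kappa>\<close> is a regular conditional law of the \<open>B\<close>-valued random variable \<open>Y\<close> given the
  \<open>A\<close>-valued random variable \<open>X\<close> under \<open>\<mu>\<close>.\<close>

definition regular_conditional_law ::
    "'w measure \<Rightarrow> 'a measure \<Rightarrow> ('w \<Rightarrow> 'a) \<Rightarrow> 'b measure \<Rightarrow> ('w \<Rightarrow> 'b) \<Rightarrow> ('a \<Rightarrow> 'b measure) \<Rightarrow> bool"
  where
  "regular_conditional_law \<mu> A X B Y \<kappa> \<longleftrightarrow>
     \<kappa> \<in> A \<rightarrow>\<^sub>M prob_algebra B \<and>
     (\<forall>S\<in>sets A. \<forall>T\<in>sets B.
        emeasure \<mu> {w \<in> space \<mu>. X w \<in> S \<and> Y w \<in> T} =
        (\<integral>\<^sup>+x\<in>S. emeasure (\<kappa> x) T \<partial>distr \<mu> A X))"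

text \<open>On a Polish space a regular conditional law exists and is unique up to null sets of the law
  of the conditioning variable, so the joint law below does not depend on the chosen version.\<close>

definition conditional_law ::
    "nat \<Rightarrow> nat \<Rightarrow> (nat \<Rightarrow> 'z::topological_space) measure \<Rightarrow> (nat \<Rightarrow> 'z) \<Rightarrow> (nat \<Rightarrow> 'z) measure" where
  "conditional_law N t \<mu> =
     (SOME \<kappa>. regular_conditional_law \<mu> (borel_of (power_topology t)) (first_coords t)
                (borel_of (power_topology (N - t))) (last_coords N t) \<kappa>)"

definition information_map ::
    "nat \<Rightarrow> nat \<Rightarrow> (nat \<Rightarrow> 'z::topological_space) measure \<Rightarrow>
       ((nat \<Rightarrow> 'z) \<times> (nat \<Rightarrow> 'z) measure) measure" where
  "information_map N t \<mu> =
     distr \<mu> (borel_of (prod_topology (power_topology t) (weak_topology (power_topology (N - t)))))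
       (\<lambda>z. (first_coords t z, conditional_law N t \<mu> (first_coords t z)))"

definition information_topology :: "nat \<Rightarrow> (nat \<Rightarrow> 'z::topological_space) measure topology" where
  "information_topology N =
     initial_topology (prob_measures (power_topology N)) {1..<N}
       (\<lambda>t. weak_topology
              (prod_topology (power_topology t) (weak_topology (power_topology (N - t)))))
       (information_map N)"

definition couplings :: "'a topology \<Rightarrow> 'a measure \<Rightarrow> 'a measure \<Rightarrow> ('a \<times> 'a) measure set" where
  "couplings X \<mu> \<nu> =
     {\<pi> \<in> prob_measures (prod_topology X X).
        distr \<pi> (borel_of X) fst = \<mu> \<and> distr \<pi> (borel_of X) snd = \<nu>}"

text \<open>The infimum is finite for every bounded \<open>d\<close>, so converting it to a real number is harmless
  there.\<close>

definition wasserstein1 ::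
    "'a topology \<Rightarrow> ('a \<Rightarrow> 'a \<Rightarrow> real) \<Rightarrow> 'a measure \<Rightarrow> 'a measure \<Rightarrow> real" where
  "wasserstein1 X d \<mu> \<nu> =
     enn2real (INF \<pi>\<in>couplings X \<mu> \<nu>. \<integral>\<^sup>+(x, y). ennreal (d x y) \<partial>\<pi>)"

text \<open>A Polish metric space enters the modulus of continuity as a topology together with a
  compatible metric. The push-forwards below are taken on the \<open>\<sigma>\<close>-algebra of \<open>\<mu>\<close>, so the order
  on measures is the setwise one.\<close>

definition perturbations ::
    "'x topology \<Rightarrow> 'y topology \<Rightarrow> ('x \<Rightarrow> 'x \<Rightarrow> real) \<Rightarrow> ('x \<times> 'y) measure \<Rightarrow> real \<Rightarrow>
       ('x \<times> 'y \<times> 'x \<times> 'y) measure set" where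
  "perturbations X Y dX \<mu> \<delta> =
     {\<gamma> \<in> subprob_measures (prod_topology X (prod_topology Y (prod_topology X Y))).
        distr \<gamma> \<mu> (\<lambda>(x1, y1, x2, y2). (x1, y1)) \<le> \<mu> \<and>
        distr \<gamma> \<mu> (\<lambda>(x1, y1, x2, y2). (x2, y2)) \<le> \<mu> \<and>
        (\<integral>\<^sup>+(x1, y1, x2, y2). ennreal (dX x1 x2) \<partial>\<gamma>) \<le> ennreal \<delta>}"

definition modulus_of_continuity ::
    "'x topology \<Rightarrow> 'y topology \<Rightarrow> ('x \<Rightarrow> 'x \<Rightarrow> real) \<Rightarrow> ('y \<Rightarrow> 'y \<Rightarrow> real) \<Rightarrow>
       ('x \<times> 'y) measure \<Rightarrow> real \<Rightarrow> ennreal" where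
  "modulus_of_continuity X Y dX dY \<mu> \<delta> =
     (SUP \<gamma>\<in>perturbations X Y dX \<mu> \<delta>. \<integral>\<^sup>+(x1, y1, x2, y2). ennreal (dY y1 y2) \<partial>\<gamma>)"

definition information_modulus ::
    "nat \<Rightarrow> nat \<Rightarrow> (nat \<Rightarrow> 'z::metric_space) measure \<Rightarrow> real \<Rightarrow> ennreal" where
  "information_modulus N t \<mu> \<delta> =
     modulus_of_continuity
       (power_topology t) (weak_topology (power_topology (N - t)))
       (sum_dist t) (wasserstein1 (power_topology (N - t)) (sum_dist (N - t)))
       (information_map N t \<mu>) \<delta>"

end

theory Submission
  imports Defs
begin

text \<open>
Write \<open>X = Z\<^sup>t\<close>, \<open>Y = Z\<^bsup>N-t\<^esup>\<close>, \<open>\<kappa>\<close> for the conditional law of the last \<open>N - t\<close> coordinates given the first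
\<open>t\<close>, and \<open>I\<^sub>t \<mu>\<close> for the law of \<open>(x, \<kappa> x)\<close>. The proof works with explicit test functions,
neighbourhoods and couplings throughout.

\<^bold>\<open>A compact set has small moduli.\<close> Near each \<open>\<mu>\<close> an open set of the information topology forces a bound on
the modulus. Cut \<open>Y\<close> into finitely many small pieces by continuous functions \<open>\<psi>\<^sub>i\<close> that miss little mass of
\<open>\<mu>\<close>. Coupling two laws on \<open>Y\<close> piece by piece gives \<open>W\<^sub>1(y\<^sub>1, y\<^sub>2)\<close> at most a constant times
\<open>\<epsilon> + (mass missed) + \<Sum>\<^sub>i |\<integral>\<psi>\<^sub>i dy\<^sub>1 - \<integral>\<psi>\<^sub>i dy\<^sub>2|\<close> (\<open>W1_le\<close>). The functions \<open>x \<mapsto> \<integral>\<psi>\<^sub>i d\<kappa>(x)\<close> are close in mean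
to Lipschitz functions \<open>g\<^sub>i\<close> (\<open>lipschitz_dense_L1\<close>), so for a perturbation \<open>\<gamma>\<close> of the law of \<open>(x, \<kappa> x)\<close> the cost
\<open>\<integral>W\<^sub>1 d\<gamma>\<close> is at most a small number, plus the integral over both marginals of the bounded continuous function
\<open>|\<integral>\<psi>\<^sub>i dy - g\<^sub>i(x)|\<close>, plus a Lipschitz constant times \<open>\<delta>\<close>. The middle term is small on an open set
around \<open>\<mu>\<close> (\<open>W1_le_continuous_cost\<close>), and finitely many such open sets cover a compact set
(\<open>compactin_information_modulus\<close>). Weak compactness follows because the information topology is finer than the
weak one (\<open>information_finer_than_weak\<close>).

\<^bold>\<open>Small moduli upgrade weak to information compactness.\<close> Let \<open>C\<close> be the part of a weakly compact superset of \<open>K\<close>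
that lies in the weak closure of \<open>K\<close>. It suffices that every \<open>\<mu> \<mapsto> \<integral>G dI\<^sub>t \<mu>\<close> is weakly continuous on \<open>C\<close>, for
then the identity maps the weakly compact \<open>C\<close> continuously into the information topology. By density of \<open>K\<close> in
\<open>C\<close> it is enough to let \<open>\<nu> \<in> K\<close> approach \<open>\<mu> \<in> C\<close> (\<open>continuous_map_real_on_closure\<close>). For Lipschitz \<open>f\<close> compare
\<open>p(x) = \<integral>f d\<kappa>(x)\<close> with its average over a \<open>\<delta>\<close>-neighbourhood of \<open>x\<close>, formed with a partition of unity. Drawing
\<open>x'\<close> from that neighbourhood yields a perturbation of the law of \<open>(x, \<kappa> x)\<close>, and since \<open>|p(x) - p(x')|\<close> is at most
\<open>W\<^sub>1(\<kappa> x, \<kappa> x')\<close>, the averaging error is bounded by the modulus (\<open>local_average_deviation_le_modulus\<close>). The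
averages are quotients of weakly continuous functionals, hence close to a fixed continuous function \<open>g(x)\<close> as
soon as \<open>\<nu>\<close> is weakly close to \<open>\<mu>\<close>. So \<open>\<integral>f dy\<close> may be replaced by \<open>g(x)\<close> with a small error in mean, uniformly in
\<open>\<nu>\<close> (\<open>locally_approximable_kernel_integral\<close>); the same then holds for lattice combinations, and these
approximate every nonnegative bounded continuous \<open>G\<close> from below (\<open>information_integral_near\<close>). The
modulus of the limit point \<open>\<mu>\<close> itself tends to \<open>0\<close> by the first half, applied to the compact set \<open>{\<mu>}\<close>.

\<^bold>\<open>Foundations.\<close> The spaces of measures involved are handled through countable families of \<open>[0,1]\<close>-valued
continuous functions that separate points from closed sets (\<open>separating\<close>). Such families pass to products and
to weak topologies, and they reduce Borel measurability and weak convergence to countably many functions.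
Conditional laws are constructed from distribution functions, the Polish space of values being a measurable retract
of the real line (\<open>conditional_law\<close>).
\<close>

section \<open>Borel sets and bounded continuous functions\<close>

lemma space_borel_of [simp]: "space (borel_of X) = topspace X"
  unfolding borel_of_def by (rule space_measure_of) (auto dest: openin_subset)

lemma sets_borel_of: "sets (borel_of X) = sigma_sets (topspace X) {U. openin X U}"
  unfolding borel_of_def by (rule sets_measure_of) (auto dest: openin_subset)

lemma openin_sets_borel_of: "openin X U \<Longrightarrow> U \<in> sets (borel_of X)"
  unfolding sets_borel_of by (rule sigma_sets.Basic) simp

lemma measurable_into_borel_of:
  assumes "\<And>x. x \<in> space M \<Longrightarrow> f x \<in> topspace X"
    and "\<And>U. openin X U \<Longrightarrow> f -` U \<inter> space M \<in> sets M"
  shows "f \<in> M \<rightarrow>\<^sub>M borel_of X"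
  unfolding borel_of_def
  by (rule measurable_measure_of) (use assms in \<open>auto dest: openin_subset\<close>)

lemma continuous_map_measurable:
  assumes "continuous_map X Y f"
  shows "f \<in> borel_of X \<rightarrow>\<^sub>M borel_of Y"
proof (rule measurable_into_borel_of)
  show "f x \<in> topspace Y" if "x \<in> space (borel_of X)" for x
    using that assms by (auto simp: continuous_map_def)
  show "f -` U \<inter> space (borel_of X) \<in> sets (borel_of X)" if "openin Y U" for U
    using openin_continuous_map_preimage[OF assms that]
    by (intro openin_sets_borel_of) (simp add: vimage_def Int_def conj_commute)
qed

lemma borel_of_euclidean: "borel_of euclidean = borel"
  by (simp add: borel_of_def borel_def)

lemma continuous_map_borel_measurable:
  fixes f :: "'a \<Rightarrow> real"
  shows "continuous_map X euclideanreal f \<Longrightarrow> f \<in> borel_measurable (borel_of X)"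
  using continuous_map_measurable[of X euclideanreal f] by (simp add: borel_of_euclidean)

text \<open>The abstract counterpart of continuity by a modulus: a continuous majorant that vanishes at the point
replaces the metric.\<close>

lemma continuous_map_real_local_bound:
  assumes "\<And>p. p \<in> topspace S \<Longrightarrow> \<exists>h. continuous_map S euclideanreal h \<and> h p = 0 \<and> (\<forall>q\<in>topspace S. \<bar>F q - F p\<bar> \<le> h q)"
  shows "continuous_map S euclideanreal F"
  unfolding continuous_map_def
proof (intro conjI allI impI)
  fix U :: "real set" assume "openin euclidean U"
  then have U: "open U" by simp
  show "openin S {p \<in> topspace S. F p \<in> U}"
  proof (subst openin_subopen, intro ballI)
    fix p assume p: "p \<in> {p \<in> topspace S. F p \<in> U}"
    then obtain h where h: "continuous_map S euclideanreal h" "h p = 0" "\<And>q. q \<in> topspace S \<Longrightarrow> \<bar>F q - F p\<bar> \<le> h q"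
      using assms by blast
    obtain e where e: "e > 0" "\<And>y. \<bar>y - F p\<bar> < e \<Longrightarrow> y \<in> U"
      using U p unfolding open_dist by (auto simp: dist_real_def)
    have "openin S {q \<in> topspace S. h q \<in> {..<e}}" by (rule openin_continuous_map_preimage[OF h(1)]) auto
    moreover have "{q \<in> topspace S. h q \<in> {..<e}} \<subseteq> {p \<in> topspace S. F p \<in> U}"
    proof clarify
      fix q assume q: "q \<in> topspace S" "h q < e"
      show "F q \<in> U" by (rule e(2)) (use h(3)[OF q(1)] q(2) in simp)
    qed
    ultimately show "\<exists>T. openin S T \<and> p \<in> T \<and> T \<subseteq> {p \<in> topspace S. F p \<in> U}"
      using p h(2) e(1) by (intro exI[of _ "{q \<in> topspace S. h q \<in> {..<e}}"]) auto
  qed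
qed auto

lemma prob_measuresD:
  assumes "\<mu> \<in> prob_measures X"
  shows "prob_space \<mu>" "sets \<mu> = sets (borel_of X)" "space \<mu> = topspace X"
  using assms sets_eq_imp_space_eq[of \<mu> "borel_of X"] by (auto simp: space_prob_algebra)

lemma prob_measuresI:
  "prob_space \<mu> \<Longrightarrow> sets \<mu> = sets (borel_of X) \<Longrightarrow> \<mu> \<in> prob_measures X"
  by (simp add: space_prob_algebra)

text \<open>The test functions of \<^const>\<open>weak_topology\<close>. Boundedness refers to the carrier only, because values elsewhere
are irrelevant to integrals.\<close>

definition Cb :: "'a topology \<Rightarrow> ('a \<Rightarrow> real) set" where
  "Cb X = {f. continuous_map X euclideanreal f \<and> bounded (f ` topspace X)}"

lemma CbI:
  "continuous_map X euclideanreal f \<Longrightarrow> (\<And>x. x \<in> topspace X \<Longrightarrow> \<bar>f x\<bar> \<le> B) \<Longrightarrow> f \<in> Cb X"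
  unfolding Cb_def bounded_iff by auto

lemma CbE:
  assumes "f \<in> Cb X"
  obtains B where "B \<ge> 0" "\<And>x. x \<in> topspace X \<Longrightarrow> \<bar>f x\<bar> \<le> B"
proof -
  from assms obtain B where "\<forall>y\<in>f ` topspace X. norm y \<le> B"
    unfolding Cb_def bounded_iff by auto
  then show ?thesis by (intro that[of "max 0 B"]) force+
qed

lemma Cb_continuous: "f \<in> Cb X \<Longrightarrow> continuous_map X euclideanreal f"
  by (simp add: Cb_def)

lemma Cb_measurable: "f \<in> Cb X \<Longrightarrow> f \<in> borel_measurable (borel_of X)"
  by (intro continuous_map_borel_measurable Cb_continuous)

lemma Cb_const [simp, intro]: "(\<lambda>_. c) \<in> Cb X"
  by (rule CbI[of _ _ "\<bar>c\<bar>"]) auto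

lemma Cb_add [intro]:
  assumes "f \<in> Cb X" "g \<in> Cb X" shows "(\<lambda>x. f x + g x) \<in> Cb X"
proof -
  obtain A B where A: "\<And>x. x \<in> topspace X \<Longrightarrow> \<bar>f x\<bar> \<le> A"
    and B: "\<And>x. x \<in> topspace X \<Longrightarrow> \<bar>g x\<bar> \<le> B"
    using assms by (metis CbE)
  have "\<bar>f x + g x\<bar> \<le> A + B" if "x \<in> topspace X" for x
    using A[OF that] B[OF that] by linarith
  then show ?thesis
    by (rule CbI[OF continuous_map_add[OF assms[THEN Cb_continuous]]])
qed

lemma Cb_mult [intro]:
  assumes "f \<in> Cb X" "g \<in> Cb X" shows "(\<lambda>x. f x * g x) \<in> Cb X"
proof -
  obtain A B where "A \<ge> 0" and A: "\<And>x. x \<in> topspace X \<Longrightarrow> \<bar>f x\<bar> \<le> A"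
    and "B \<ge> 0" and B: "\<And>x. x \<in> topspace X \<Longrightarrow> \<bar>g x\<bar> \<le> B"
    using assms by (metis CbE)
  have "\<bar>f x * g x\<bar> \<le> A * B" if "x \<in> topspace X" for x
    using A[OF that] B[OF that] \<open>A \<ge> 0\<close> by (simp add: abs_mult mult_mono)
  then show ?thesis
    by (rule CbI[OF continuous_map_real_mult[OF assms[THEN Cb_continuous]]])
qed

lemma Cb_cmult [intro]: "f \<in> Cb X \<Longrightarrow> (\<lambda>x. c * f x) \<in> Cb X"
  by (rule Cb_mult) auto

lemma Cb_minus [intro]: "f \<in> Cb X \<Longrightarrow> (\<lambda>x. - f x) \<in> Cb X"
  using Cb_cmult[of f X "-1"] by simp

lemma Cb_diff [intro]: "f \<in> Cb X \<Longrightarrow> g \<in> Cb X \<Longrightarrow> (\<lambda>x. f x - g x) \<in> Cb X"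
  using Cb_add[of f X "\<lambda>x. - g x"] by (auto intro: Cb_minus)

lemma Cb_max [intro]: "f \<in> Cb X \<Longrightarrow> g \<in> Cb X \<Longrightarrow> (\<lambda>x. max (f x) (g x)) \<in> Cb X"
  and Cb_min [intro]: "f \<in> Cb X \<Longrightarrow> g \<in> Cb X \<Longrightarrow> (\<lambda>x. min (f x) (g x)) \<in> Cb X"
proof -
  assume *: "f \<in> Cb X" "g \<in> Cb X"
  obtain A B where A: "\<And>x. x \<in> topspace X \<Longrightarrow> \<bar>f x\<bar> \<le> A"
    and B: "\<And>x. x \<in> topspace X \<Longrightarrow> \<bar>g x\<bar> \<le> B"
    using * by (metis CbE)
  have bds: "\<bar>max (f x) (g x)\<bar> \<le> max A B" "\<bar>min (f x) (g x)\<bar> \<le> max A B"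
    if "x \<in> topspace X" for x
    using A[OF that] B[OF that] by linarith+
  then show "(\<lambda>x. max (f x) (g x)) \<in> Cb X" "(\<lambda>x. min (f x) (g x)) \<in> Cb X"
    using CbI[OF continuous_map_real_max[OF *[THEN Cb_continuous]] bds(1)]
      CbI[OF continuous_map_real_min[OF *[THEN Cb_continuous]] bds(2)] by auto
qed

lemma Cb_abs [intro]:
  assumes "f \<in> Cb X" shows "(\<lambda>x. \<bar>f x\<bar>) \<in> Cb X"
proof -
  have "(\<lambda>x. \<bar>f x\<bar>) = (\<lambda>x. max (f x) (- f x))" by auto
  then show ?thesis using Cb_max[OF assms Cb_minus[OF assms]] by simp
qed

lemma Cb_sum [intro]:
  "(\<And>i. i \<in> I \<Longrightarrow> f i \<in> Cb X) \<Longrightarrow> (\<lambda>x. \<Sum>i\<in>I. f i x) \<in> Cb X"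
  by (induction I rule: infinite_finite_induct) auto

lemma Cb_compose: "continuous_map X Y h \<Longrightarrow> f \<in> Cb Y \<Longrightarrow> (\<lambda>x. f (h x)) \<in> Cb X"
  using continuous_map_compose[of X Y h euclideanreal f] continuous_map_image_subset_topspace[of X Y h]
  unfolding Cb_def by (auto simp: o_def image_image[symmetric] intro: bounded_subset)

lemma Cb_integrable:
  assumes "f \<in> Cb X" "\<mu> \<in> prob_measures X"
  shows "integrable \<mu> f"
proof -
  interpret prob_space \<mu> using assms by (simp add: prob_measuresD)
  obtain B where "\<And>x. x \<in> topspace X \<Longrightarrow> \<bar>f x\<bar> \<le> B" using assms by (metis CbE)
  moreover have "f \<in> borel_measurable \<mu>"
    using Cb_measurable[OF assms(1)] prob_measuresD(2)[OF assms(2)]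
    by (simp cong: measurable_cong_sets)
  ultimately show ?thesis
    by (intro integrable_const_bound[of _ B]) (auto simp: prob_measuresD[OF assms(2)])
qed

section \<open>Initial topologies and the weak topology\<close>

lemma topspace_initial_topology:
  assumes "I \<noteq> {}" "\<And>i. i \<in> I \<Longrightarrow> f i \<in> A \<rightarrow> topspace (T i)"
  shows "topspace (initial_topology A I T f) = A"
proof -
  have "f i -` topspace (T i) \<inter> A = A" if "i \<in> I" for i using assms(2)[OF that] by auto
  moreover obtain i where "i \<in> I" using assms(1) by auto
  ultimately have "A \<in> {f i -` U \<inter> A |i U. i \<in> I \<and> openin (T i) U}"
    by (smt (verit) mem_Collect_eq openin_topspace)
  then show ?thesis unfolding initial_topology_def topology_generated_by_topspace by blast
qed

lemma continuous_map_from_initial_topology: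
  assumes "i \<in> I" "\<And>i. i \<in> I \<Longrightarrow> f i \<in> A \<rightarrow> topspace (T i)"
  shows "continuous_map (initial_topology A I T f) (T i) (f i)"
proof -
  have ts: "topspace (initial_topology A I T f) = A"
    using assms by (intro topspace_initial_topology) auto
  show ?thesis unfolding continuous_map_def
  proof (intro conjI allI impI)
    show "f i \<in> topspace (initial_topology A I T f) \<rightarrow> topspace (T i)"
      using assms ts by auto
    fix U assume "openin (T i) U"
    then have "openin (initial_topology A I T f) (f i -` U \<inter> A)"
      unfolding initial_topology_def using assms(1) by (intro topology_generated_by_Basis) blast
    then show "openin (initial_topology A I T f) {x \<in> topspace (initial_topology A I T f). f i x \<in> U}"
      by (simp add: ts vimage_def Int_def conj_commute)
  qed
qed

lemma continuous_map_into_initial_topology: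
  assumes "g \<in> topspace S \<rightarrow> A" "I \<noteq> {}"
    and "\<And>i. i \<in> I \<Longrightarrow> f i \<in> A \<rightarrow> topspace (T i)"
    and "\<And>i. i \<in> I \<Longrightarrow> continuous_map S (T i) (\<lambda>s. f i (g s))"
  shows "continuous_map S (initial_topology A I T f) g"
  unfolding initial_topology_def
proof (rule continuous_on_generated_topo)
  fix W assume "W \<in> {f i -` U \<inter> A |i U. i \<in> I \<and> openin (T i) U}"
  then obtain i U where "i \<in> I" "openin (T i) U" and W: "W = f i -` U \<inter> A" by auto
  then have "openin S {s \<in> topspace S. f i (g s) \<in> U}"
    using openin_continuous_map_preimage[OF assms(4)] by auto
  moreover have "g -` W \<inter> topspace S = {s \<in> topspace S. f i (g s) \<in> U}"
    using assms(1) W by auto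
  ultimately show "openin S (g -` W \<inter> topspace S)" by simp
next
  show "g ` topspace S \<subseteq> \<Union> {f i -` U \<inter> A |i U. i \<in> I \<and> openin (T i) U}"
    using topspace_initial_topology[OF assms(2,3)] assms(1)
    unfolding initial_topology_def topology_generated_by_topspace by auto
qed

lemma topspace_weak_topology [simp]: "topspace (weak_topology X) = prob_measures X"
  unfolding weak_topology_def
proof (rule topspace_initial_topology)
  have "(\<lambda>_. 0) \<in> Cb X" by simp
  then show "{f. continuous_map X euclideanreal f \<and> bounded (f ` topspace X)} \<noteq> {}"
    unfolding Cb_def by blast
qed auto

lemma continuous_map_weak_integral:
  assumes "f \<in> Cb X"
  shows "continuous_map (weak_topology X) euclideanreal (\<lambda>\<mu>. \<integral>x. f x \<partial>\<mu>)"
  using assms unfolding weak_topology_def Cb_def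
  by (intro continuous_map_from_initial_topology) auto

lemma continuous_map_into_weak_topology:
  assumes "g \<in> topspace S \<rightarrow> prob_measures X"
    and "\<And>f. f \<in> Cb X \<Longrightarrow> continuous_map S euclideanreal (\<lambda>s. \<integral>x. f x \<partial>(g s))"
  shows "continuous_map S (weak_topology X) g"
  unfolding weak_topology_def
proof (rule continuous_map_into_initial_topology)
  have "(\<lambda>_. 0) \<in> Cb X" by simp
  then show "{f. continuous_map X euclideanreal f \<and> bounded (f ` topspace X)} \<noteq> {}"
    unfolding Cb_def by blast
qed (use assms in \<open>auto simp: Cb_def\<close>)

lemma Cb_weak_integral:
  assumes "f \<in> Cb X"
  shows "(\<lambda>\<mu>. \<integral>x. f x \<partial>\<mu>) \<in> Cb (weak_topology X)"
proof -
  obtain B where B: "\<And>x. x \<in> topspace X \<Longrightarrow> \<bar>f x\<bar> \<le> B" using assms by (metis CbE)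
  have "\<bar>\<integral>x. f x \<partial>\<mu>\<bar> \<le> B" if "\<mu> \<in> prob_measures X" for \<mu>
  proof -
    interpret prob_space \<mu> using that by (simp add: prob_measuresD)
    have "\<bar>\<integral>x. f x \<partial>\<mu>\<bar> \<le> (\<integral>x. \<bar>f x\<bar> \<partial>\<mu>)" by (rule integral_abs_bound)
    also have "\<dots> \<le> (\<integral>x. B \<partial>\<mu>)"
      using B Cb_integrable[OF assms that] prob_measuresD(3)[OF that]
      by (intro integral_mono) auto
    finally show ?thesis by (simp add: prob_space)
  qed
  then show ?thesis by (intro CbI[of _ _ B] continuous_map_weak_integral assms) auto
qed

section \<open>Separating families\<close>

text \<open>Such a family makes the space second countable, as the sets where a member is positive form a base. It
stands in for a metric: unlike a metric it passes explicitly to products (minima) and to spaces of measures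
(truncated integrals).\<close>

definition separating :: "'a topology \<Rightarrow> ('a \<Rightarrow> real) set \<Rightarrow> bool" where
  "separating X C \<longleftrightarrow> countable C \<and> C \<subseteq> Cb X \<and>
     (\<forall>c\<in>C. \<forall>x\<in>topspace X. 0 \<le> c x \<and> c x \<le> 1) \<and>
     (\<forall>U x. openin X U \<longrightarrow> x \<in> U \<longrightarrow> (\<exists>c\<in>C. c x = 1 \<and> (\<forall>y\<in>topspace X - U. c y = 0)))"

lemma separatingD:
  assumes "separating X C"
  shows "countable C" "\<And>c. c \<in> C \<Longrightarrow> c \<in> Cb X"
    "\<And>c x. c \<in> C \<Longrightarrow> x \<in> topspace X \<Longrightarrow> 0 \<le> c x \<and> c x \<le> 1"
  using assms by (auto simp: separating_def)

lemma separatingE: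
  assumes "separating X C" "openin X U" "x \<in> U"
  obtains c where "c \<in> C" "c x = 1" "\<And>y. y \<in> topspace X \<Longrightarrow> y \<notin> U \<Longrightarrow> c y = 0"
  using assms unfolding separating_def by (metis DiffI)

text \<open>Every open set is a countable union of sets \<open>{c > 0}\<close> with \<open>c\<close> in the family. In this way maps into spaces of
measures are shown to be Borel without a description of the Borel sets there.\<close>

lemma measurable_into_separated:
  assumes sep: "separating X C"
    and sp: "\<And>x. x \<in> space M \<Longrightarrow> f x \<in> topspace X"
    and meas: "\<And>c. c \<in> C \<Longrightarrow> (\<lambda>x. c (f x)) \<in> borel_measurable M"
  shows "f \<in> M \<rightarrow>\<^sub>M borel_of X"
proof (rule measurable_into_borel_of)
  fix U assume U: "openin X U"
  let ?D = "{c \<in> C. \<forall>y\<in>topspace X - U. c y = 0}"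
  have "f -` U \<inter> space M = (\<Union>c\<in>?D. {x \<in> space M. c (f x) > 0})" (is "?L = ?R")
  proof
    show "?L \<subseteq> ?R"
    proof
      fix x assume "x \<in> ?L"
      then obtain c where "c \<in> C" "c (f x) = 1" "\<And>y. y \<in> topspace X \<Longrightarrow> y \<notin> U \<Longrightarrow> c y = 0"
        using separatingE[OF sep U] by (metis IntD1 vimageD)
      then show "x \<in> ?R" using \<open>x \<in> ?L\<close> by (auto intro!: bexI[of _ c])
    qed
    show "?R \<subseteq> ?L" using sp by force
  qed
  moreover have "countable ?D" using separatingD(1)[OF sep] by auto
  ultimately show "f -` U \<inter> space M \<in> sets M"
    using meas by (auto intro!: sets.countable_UN'')
qed (rule sp)

primrec list_max :: "(real \<times> ('a \<Rightarrow> real)) list \<Rightarrow> 'a \<Rightarrow> real" where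
  "list_max [] x = 0"
| "list_max (p # ps) x = max (fst p * snd p x) (list_max ps x)"

text \<open>The approximants from below: lists of weighted members keep the class countable and give an induction
principle.\<close>

definition max_hull :: "('a \<Rightarrow> real) set \<Rightarrow> ('a \<Rightarrow> real) set" where
  "max_hull C = list_max ` lists ((\<rat> \<inter> {0..}) \<times> C)"

lemma list_max_nonneg: "list_max ps x \<ge> 0"
  by (induction ps) auto

lemma countable_max_hull: "countable C \<Longrightarrow> countable (max_hull C)"
  unfolding max_hull_def
  by (intro countable_image countable_lists countable_SIGMA) (auto intro: countable_Int1 countable_rat)

lemma max_hull_induct [consumes 1, case_names zero max]:
  assumes "f \<in> max_hull C" "P (\<lambda>_. 0)"
    and "\<And>q c g. q \<ge> 0 \<Longrightarrow> c \<in> C \<Longrightarrow> g \<in> max_hull C \<Longrightarrow> P g \<Longrightarrow> P (\<lambda>x. max (q * c x) (g x))"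
  shows "P f"
proof -
  obtain ps where "ps \<in> lists ((\<rat> \<inter> {0..}) \<times> C)" "f = list_max ps"
    using assms(1) by (auto simp: max_hull_def)
  moreover have "P (list_max ps)" if "ps \<in> lists ((\<rat> \<inter> {0..}) \<times> C)"
    using that
  proof (induction ps)
    case Nil
    have "list_max [] = (\<lambda>_. 0)" by (simp add: fun_eq_iff)
    then show ?case using assms(2) by simp
  next
    case (Cons p ps)
    have "P (\<lambda>x. max (fst p * snd p x) (list_max ps x))"
      by (rule assms(3)) (use Cons in \<open>auto simp: max_hull_def\<close>)
    moreover have "list_max (p # ps) = (\<lambda>x. max (fst p * snd p x) (list_max ps x))"
      by (simp add: fun_eq_iff)
    ultimately show ?case by simp
  qed
  ultimately show ?thesis by simp
qed

lemma Cb_max_hull: "f \<in> max_hull C \<Longrightarrow> C \<subseteq> Cb X \<Longrightarrow> f \<in> Cb X"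
  by (induction rule: max_hull_induct) (auto intro!: Cb_max Cb_cmult)

text \<open>At a point with \<open>h x > q \<ge> 0\<close> some member \<open>c\<close> has \<open>c x = 1\<close> and lives on the open set \<open>{h > q}\<close>, so \<open>q c \<le> h\<close>.
Hence \<open>h\<close> is the supremum of the countably many functions \<open>q c\<close> below it, and running maxima of an
enumeration make the limit monotone.\<close>

lemma max_hull_increasing_limit_lsc:
  assumes sep: "separating X C" and h: "\<And>q. openin X {x \<in> topspace X. q < h x}"
    and nn: "\<And>x. x \<in> topspace X \<Longrightarrow> h x \<ge> 0"
  obtains s where "\<And>n. s n \<in> max_hull C" "\<And>n x. x \<in> topspace X \<Longrightarrow> 0 \<le> s n x \<and> s n x \<le> h x"
    "\<And>x. incseq (\<lambda>n. s n x)" "\<And>x. x \<in> topspace X \<Longrightarrow> (\<lambda>n. s n x) \<longlonglongrightarrow> h x"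
proof -
  define D where "D = insert (0, \<lambda>_. 0) {p \<in> (\<rat> \<inter> {0..}) \<times> C. \<forall>x\<in>topspace X. fst p * snd p x \<le> h x}"
  have "countable D" unfolding D_def
    by (intro countable_insert countable_subset[OF Collect_subset] countable_SIGMA)
       (auto intro: countable_Int1 countable_rat separatingD[OF sep])
  define e where "e = from_nat_into D"
  have e: "e n \<in> D" for n unfolding e_def by (rule from_nat_into) (auto simp: D_def)
  define ps where "ps n = filter (\<lambda>p. snd p \<in> C \<and> fst p \<in> \<rat> \<inter> {0..}) (map e (rev [0..<n]))" for n
  define s where "s n = list_max (ps n)" for n
  have ps: "ps n \<in> lists ((\<rat> \<inter> {0..}) \<times> C)" for n
    unfolding ps_def by (auto simp: mem_Times_iff)
  have "s n \<in> max_hull C" for n unfolding s_def max_hull_def using ps by blast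
  moreover have "0 \<le> s n x \<and> s n x \<le> h x" if x: "x \<in> topspace X" for n x
  proof
    show "0 \<le> s n x" unfolding s_def by (rule list_max_nonneg)
    have *: "fst (e i) * snd (e i) x \<le> h x" for i using e[of i] x nn[OF x] by (auto simp: D_def)
    show "s n x \<le> h x" unfolding s_def ps_def by (induction n) (auto simp: * nn[OF x])
  qed
  note bds = this
  moreover have inc: "incseq (\<lambda>n. s n x)" for x
    by (rule incseq_SucI) (simp add: s_def ps_def)
  moreover have "(\<lambda>n. s n x) \<longlonglongrightarrow> h x" if x: "x \<in> topspace X" for x
  proof (rule increasing_tendsto)
    show "\<forall>\<^sub>F n in sequentially. s n x \<le> h x" using bds[OF x] by simp
    fix a assume a: "a < h x"
    show "\<forall>\<^sub>F n in sequentially. a < s n x"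
    proof (cases "a < 0")
      case True then show ?thesis using bds[OF x] by (intro always_eventually allI) (meson order_less_le_trans)
    next
      case False
      obtain q where q: "a < q" "q < h x" "q \<in> \<rat>" using Rats_dense_in_real[OF a] by auto
      have xq: "x \<in> {y \<in> topspace X. q < h y}" using q x by simp
      obtain c where c: "c \<in> C" "c x = 1" "\<And>y. y \<in> topspace X \<Longrightarrow> y \<notin> {y \<in> topspace X. q < h y} \<Longrightarrow> c y = 0"
        by (rule separatingE[OF sep h xq]) (rule that)
      have "q * c y \<le> h y" if y: "y \<in> topspace X" for y
      proof (cases "h y > q")
        case True
        have "q * c y \<le> q" using separatingD(3)[OF sep c(1) y] False q by (intro mult_left_le) auto
        then show ?thesis using True by simp
      next
        case F: False then show ?thesis using c(3)[OF y] nn[OF y] by auto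
      qed
      then have "(q, c) \<in> D" unfolding D_def using q c False by auto
      then obtain i where i: "e i = (q, c)"
        unfolding e_def using from_nat_into_surj[OF \<open>countable D\<close>] by metis
      have "s (Suc i) x \<ge> q" unfolding s_def ps_def using i c q False by simp
      then have "s n x \<ge> q" if "n \<ge> Suc i" for n using incseqD[OF inc that, of x] by auto
      then show ?thesis using q unfolding eventually_sequentially by (meson order_less_le_trans)
    qed
  qed
  ultimately show ?thesis using that by blast
qed

lemma max_hull_increasing_limit:
  assumes sep: "separating X C" and h: "continuous_map X euclideanreal h"
    and nn: "\<And>x. x \<in> topspace X \<Longrightarrow> h x \<ge> 0"
  obtains s where "\<And>n. s n \<in> max_hull C" "\<And>n x. x \<in> topspace X \<Longrightarrow> 0 \<le> s n x \<and> s n x \<le> h x"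
    "\<And>x. incseq (\<lambda>n. s n x)" "\<And>x. x \<in> topspace X \<Longrightarrow> (\<lambda>n. s n x) \<longlonglongrightarrow> h x"
proof -
  have "openin X {x \<in> topspace X. q < h x}" for q
    using openin_continuous_map_preimage[OF h, of "{q<..}"] by simp
  from max_hull_increasing_limit_lsc[OF sep this nn] show ?thesis using that by blast
qed

text \<open>Open boxes form a base, and the minimum of two members is \<open>1\<close> at a point exactly when both are and vanishes
off the box.\<close>

lemma separating_prod:
  assumes C: "separating X C" and D: "separating Y D"
  shows "separating (prod_topology X Y) ((\<lambda>(c, d) p. min (c (fst p)) (d (snd p))) ` (C \<times> D))"
    (is "separating ?P ?E")
  unfolding separating_def
proof (intro conjI ballI allI impI)
  show "countable ?E" using separatingD(1)[OF C] separatingD(1)[OF D] by auto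
  show "?E \<subseteq> Cb ?P"
  proof clarify
    fix c d assume "c \<in> C" "d \<in> D"
    then have "(\<lambda>p. c (fst p)) \<in> Cb ?P" "(\<lambda>p. d (snd p)) \<in> Cb ?P"
      using separatingD(2)[OF C] separatingD(2)[OF D]
      by (auto intro: Cb_compose[OF continuous_map_fst] Cb_compose[OF continuous_map_snd])
    then show "(\<lambda>p. min (c (fst p)) (d (snd p))) \<in> Cb ?P" by (rule Cb_min)
  qed
next
  fix e p assume "e \<in> ?E" "p \<in> topspace ?P"
  then show "0 \<le> e p" "e p \<le> 1"
    using separatingD(3)[OF C, of _ "fst p"] separatingD(3)[OF D, of _ "snd p"]
    by (auto simp: min_le_iff_disj)
next
  fix U p assume U: "openin ?P U" and p: "p \<in> U"
  then obtain V W where V: "openin X V" "fst p \<in> V" and W: "openin Y W" "snd p \<in> W"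
    and VW: "V \<times> W \<subseteq> U"
    unfolding openin_prod_topology_alt by (metis prod.collapse)
  obtain c where c: "c \<in> C" "c (fst p) = 1" "\<And>y. y \<in> topspace X \<Longrightarrow> y \<notin> V \<Longrightarrow> c y = 0"
    using separatingE[OF C V] by metis
  obtain d where d: "d \<in> D" "d (snd p) = 1" "\<And>y. y \<in> topspace Y \<Longrightarrow> y \<notin> W \<Longrightarrow> d y = 0"
    using separatingE[OF D W] by metis
  have "min (c (fst q)) (d (snd q)) = 0" if q: "q \<in> topspace ?P - U" for q
  proof -
    have "fst q \<in> topspace X" "snd q \<in> topspace Y" using q by auto
    moreover have "fst q \<notin> V \<or> snd q \<notin> W" using VW q by (cases q) auto
    ultimately show ?thesis using c(1,3) d(1,3) separatingD(3)[OF C, of c] separatingD(3)[OF D, of d]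
      by (metis min_absorb1 min_absorb2)
  qed
  then show "\<exists>e\<in>?E. e p = 1 \<and> (\<forall>q\<in>topspace ?P - U. e q = 0)"
    using c d by (intro bexI[of _ "\<lambda>p. min (c (fst p)) (d (snd p))"]) auto
qed

lemma measurable_Pair_borel_of:
  assumes C: "separating X C" and D: "separating Y D"
    and f: "f \<in> M \<rightarrow>\<^sub>M borel_of X" and g: "g \<in> M \<rightarrow>\<^sub>M borel_of Y"
  shows "(\<lambda>x. (f x, g x)) \<in> M \<rightarrow>\<^sub>M borel_of (prod_topology X Y)"
proof (rule measurable_into_separated[OF separating_prod[OF C D]])
  show "(f x, g x) \<in> topspace (prod_topology X Y)" if "x \<in> space M" for x
    using measurable_space[OF f that] measurable_space[OF g that] by simp
  fix e assume "e \<in> (\<lambda>(c, d) p. min (c (fst p)) (d (snd p))) ` (C \<times> D)"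
  then obtain c d where e: "e = (\<lambda>p. min (c (fst p)) (d (snd p)))" and "c \<in> C" "d \<in> D" by auto
  then have [measurable]: "c \<in> borel_measurable (borel_of X)" "d \<in> borel_measurable (borel_of Y)"
    using separatingD(2)[OF C] separatingD(2)[OF D] by (auto intro: Cb_measurable)
  note f[measurable] g[measurable]
  show "(\<lambda>x. e (f x, g x)) \<in> borel_measurable M" unfolding e by simp
qed

text \<open>In general the product of Borel \<open>\<sigma>\<close>-algebras may be smaller than the Borel \<open>\<sigma>\<close>-algebra of the product; countable separating families rule this out, since the
identity is then measurable in both directions.\<close>

lemma sets_borel_of_prod:
  assumes C: "separating X C" and D: "separating Y D"
  shows "sets (borel_of (prod_topology X Y)) = sets (borel_of X \<Otimes>\<^sub>M borel_of Y)"
proof (intro subset_antisym subsetI)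
  have sp: "space (borel_of X \<Otimes>\<^sub>M borel_of Y) = topspace X \<times> topspace Y" by (simp add: space_pair_measure)
  fix A
  {
    assume A: "A \<in> sets (borel_of (prod_topology X Y))"
    have m: "(\<lambda>p. (fst p, snd p)) \<in> (borel_of X \<Otimes>\<^sub>M borel_of Y) \<rightarrow>\<^sub>M borel_of (prod_topology X Y)"
      by (rule measurable_Pair_borel_of[OF C D]) auto
    have "(\<lambda>p. (fst p, snd p)) -` A \<inter> (topspace X \<times> topspace Y) = A"
      using sets.sets_into_space[OF A] by auto
    then show "A \<in> sets (borel_of X \<Otimes>\<^sub>M borel_of Y)"
      using measurable_sets[OF m A] sp by simp
  next
    assume A: "A \<in> sets (borel_of X \<Otimes>\<^sub>M borel_of Y)"
    have m: "(\<lambda>p. (fst p, snd p)) \<in> borel_of (prod_topology X Y) \<rightarrow>\<^sub>M (borel_of X \<Otimes>\<^sub>M borel_of Y)"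
      by (intro measurable_Pair continuous_map_measurable continuous_map_fst continuous_map_snd)
    have "(\<lambda>p. (fst p, snd p)) -` A \<inter> (topspace X \<times> topspace Y) = A"
      using sets.sets_into_space[OF A] sp by auto
    then show "A \<in> sets (borel_of (prod_topology X Y))"
      using measurable_sets[OF m A] by simp
  }
qed

section \<open>Separating families for weak topologies\<close>

lemma integral_increasing_limit:
  assumes \<mu>: "\<mu> \<in> prob_measures X" and f: "f \<in> Cb X" and s: "\<And>n. s n \<in> Cb X"
    and bd: "\<And>n x. x \<in> topspace X \<Longrightarrow> 0 \<le> s n x \<and> s n x \<le> f x"
    and lim: "\<And>x. x \<in> topspace X \<Longrightarrow> (\<lambda>n. s n x) \<longlonglongrightarrow> f x"
  shows "(\<lambda>n. \<integral>x. s n x \<partial>\<mu>) \<longlonglongrightarrow> (\<integral>x. f x \<partial>\<mu>)"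
proof (rule integral_dominated_convergence[where w=f])
  show "f \<in> borel_measurable \<mu>" "\<And>n. s n \<in> borel_measurable \<mu>" "integrable \<mu> f"
    using Cb_integrable[OF f \<mu>] Cb_integrable[OF s \<mu>] by auto
  show "AE x in \<mu>. (\<lambda>n. s n x) \<longlonglongrightarrow> f x" "\<And>n. AE x in \<mu>. norm (s n x) \<le> f x"
    using lim bd prob_measuresD(3)[OF \<mu>] by (auto intro!: AE_I2)
qed

text \<open>A continuous version of the indicator of \<open>{\<mu>. \<integral>g d\<mu> > q}\<close>, which the functions increase to as \<open>k \<rightarrow> \<infinity>\<close>.\<close>

definition weak_bump :: "('a \<Rightarrow> real) \<Rightarrow> nat \<Rightarrow> real \<Rightarrow> 'a measure \<Rightarrow> real" where
  "weak_bump g k q \<mu> = max 0 (min 1 (real k * ((\<integral>x. g x \<partial>\<mu>) - q)))"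

primrec list_min :: "('a \<Rightarrow> real) list \<Rightarrow> 'a \<Rightarrow> real" where
  "list_min [] x = 1"
| "list_min (c # cs) x = min (c x) (list_min cs x)"

definition weak_bumps :: "('a \<Rightarrow> real) set \<Rightarrow> ('a measure \<Rightarrow> real) set" where
  "weak_bumps C = (\<lambda>(g, k, q). weak_bump g k q) ` (max_hull C \<times> UNIV \<times> \<rat>)"

definition weak_family :: "('a \<Rightarrow> real) set \<Rightarrow> ('a measure \<Rightarrow> real) set" where
  "weak_family C = list_min ` lists (weak_bumps C)"

lemma countable_weak_bumps: "countable C \<Longrightarrow> countable (weak_bumps C)"
  unfolding weak_bumps_def
  by (intro countable_image countable_SIGMA countable_max_hull) (auto simp: countable_rat)

lemma weak_bumps_range: "b \<in> weak_bumps C \<Longrightarrow> 0 \<le> b \<mu> \<and> b \<mu> \<le> 1"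
  by (auto simp: weak_bumps_def weak_bump_def)

lemma Cb_weak_bumps:
  assumes "b \<in> weak_bumps C" "C \<subseteq> Cb X"
  shows "b \<in> Cb (weak_topology X)"
proof -
  obtain g k q where b: "b = weak_bump g k q" and g: "g \<in> max_hull C"
    using assms by (auto simp: weak_bumps_def)
  have "(\<lambda>\<mu>. \<integral>x. g x \<partial>\<mu>) \<in> Cb (weak_topology X)"
    by (intro Cb_weak_integral Cb_max_hull[OF g assms(2)])
  then have "(\<lambda>\<mu>. max 0 (min 1 (real k * ((\<integral>x. g x \<partial>\<mu>) - q)))) \<in> Cb (weak_topology X)"
    by (intro Cb_max Cb_min Cb_cmult Cb_diff Cb_const)
  then show ?thesis unfolding b weak_bump_def by (simp add: weak_bump_def[abs_def])
qed

lemma list_min_range: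
  "(\<And>c. c \<in> set cs \<Longrightarrow> 0 \<le> c x \<and> c x \<le> 1) \<Longrightarrow> 0 \<le> list_min cs x \<and> list_min cs x \<le> 1"
  by (induction cs) (auto simp: min_le_iff_disj)

lemma Cb_list_min: "set cs \<subseteq> Cb X \<Longrightarrow> list_min cs \<in> Cb X"
proof (induction cs)
  case Nil
  have "list_min [] = (\<lambda>_. 1)" by (simp add: fun_eq_iff)
  then show ?case by simp
next
  case (Cons c cs)
  have "list_min (c # cs) = (\<lambda>x. min (c x) (list_min cs x))" by (simp add: fun_eq_iff)
  then show ?case using Cons by (simp add: Cb_min)
qed

lemma list_min_append: "list_min (cs @ ds) x = min (list_min cs x) (list_min ds x)"
  if "list_min ds x \<le> 1"
  using that by (induction cs) (auto simp: min.assoc)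

text \<open>Integrals of approximants from below converge by monotone convergence, so a strict lower bound on \<open>\<integral>f d\<mu>\<close> is already
certified by one member of the countable hull, with a rational threshold.\<close>

lemma weak_bump_below:
  assumes sep: "separating X C" and f: "f \<in> Cb X" and nn: "\<And>x. x \<in> topspace X \<Longrightarrow> 0 \<le> f x"
    and \<mu>: "\<mu> \<in> prob_measures X" and a: "a < (\<integral>x. f x \<partial>\<mu>)"
  obtains b where "b \<in> weak_bumps C" "b \<mu> = 1" "\<And>\<nu>. \<nu> \<in> prob_measures X \<Longrightarrow> b \<nu> \<noteq> 0 \<Longrightarrow> a < (\<integral>x. f x \<partial>\<nu>)"
proof -
  obtain s where s: "\<And>n. s n \<in> max_hull C"
    "\<And>n x. x \<in> topspace X \<Longrightarrow> 0 \<le> s n x \<and> s n x \<le> f x"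
    "\<And>x. x \<in> topspace X \<Longrightarrow> (\<lambda>n. s n x) \<longlonglongrightarrow> f x"
    using max_hull_increasing_limit[OF sep Cb_continuous[OF f] nn] by metis
  have sC: "s n \<in> Cb X" for n using Cb_max_hull[OF s(1)] separatingD(2)[OF sep] by auto
  have "(\<lambda>n. \<integral>x. s n x \<partial>\<mu>) \<longlonglongrightarrow> (\<integral>x. f x \<partial>\<mu>)"
    by (rule integral_increasing_limit[OF \<mu> f sC s(2,3)])
  then obtain n where n: "a < (\<integral>x. s n x \<partial>\<mu>)"
    using order_tendstoD(1)[OF _ a] by (metis eventually_sequentially order_refl)
  obtain q where q: "a < q" "q < (\<integral>x. s n x \<partial>\<mu>)" "q \<in> \<rat>" using Rats_dense_in_real[OF n] by auto
  obtain k :: nat where k: "1 < real k * ((\<integral>x. s n x \<partial>\<mu>) - q)"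
    using reals_Archimedean3[of "(\<integral>x. s n x \<partial>\<mu>) - q"] q by auto
  show ?thesis
  proof (rule that[of "weak_bump (s n) k q"])
    show "weak_bump (s n) k q \<in> weak_bumps C" using s(1) q by (force simp: weak_bumps_def)
    show "weak_bump (s n) k q \<mu> = 1" using k by (simp add: weak_bump_def)
    fix \<nu> assume \<nu>: "\<nu> \<in> prob_measures X" and "weak_bump (s n) k q \<nu> \<noteq> 0"
    then have "real k * ((\<integral>x. s n x \<partial>\<nu>) - q) > 0" by (auto simp: weak_bump_def max_def split: if_splits)
    then have "(\<integral>x. s n x \<partial>\<nu>) > q" by (simp add: zero_less_mult_iff)
    also have "(\<integral>x. s n x \<partial>\<nu>) \<le> (\<integral>x. f x \<partial>\<nu>)"
      using s(2) prob_measuresD(3)[OF \<nu>] by (intro integral_mono Cb_integrable[OF sC \<nu>] Cb_integrable[OF f \<nu>]) auto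
    finally show "a < (\<integral>x. f x \<partial>\<nu>)" using q by simp
  qed
qed

lemma integral_add_const_prob:
  assumes "\<mu> \<in> prob_measures X" "f \<in> Cb X"
  shows "(\<integral>x. c + f x \<partial>\<mu>) = c + (\<integral>x. f x \<partial>\<mu>)" "(\<integral>x. c - f x \<partial>\<mu>) = c - (\<integral>x. f x \<partial>\<mu>)"
proof -
  interpret prob_space \<mu> using assms by (simp add: prob_measuresD)
  show "(\<integral>x. c + f x \<partial>\<mu>) = c + (\<integral>x. f x \<partial>\<mu>)" "(\<integral>x. c - f x \<partial>\<mu>) = c - (\<integral>x. f x \<partial>\<mu>)"
    using Cb_integrable[OF assms(2,1)] by (simp_all add: prob_space)
qed

text \<open>A subbasic open set prescribes \<open>\<integral>f d\<mu>\<close> up to an error. With \<open>|f| \<le> M\<close> this is a lower bound on \<open>\<integral>(M + f) d\<mu>\<close> together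
with one on \<open>\<integral>(M - f) d\<mu>\<close>, and each is certified by a truncated integral; finite intersections become minima.\<close>

lemma separating_weak_topology:
  assumes sep: "separating X C"
  shows "separating (weak_topology X) (weak_family C)"
  unfolding separating_def
proof (intro conjI ballI allI impI)
  show "countable (weak_family C)"
    unfolding weak_family_def
    by (intro countable_image countable_lists countable_weak_bumps separatingD(1)[OF sep])
  have sub: "weak_bumps C \<subseteq> Cb (weak_topology X)" using Cb_weak_bumps[of _ C X] separatingD(2)[OF sep] by auto
  then show "weak_family C \<subseteq> Cb (weak_topology X)"
    by (auto simp: weak_family_def intro!: Cb_list_min)
next
  fix c \<mu> assume "c \<in> weak_family C"
  then obtain cs where "c = list_min cs" "\<And>b. b \<in> set cs \<Longrightarrow> b \<in> weak_bumps C"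
    by (auto simp: weak_family_def)
  then show "0 \<le> c \<mu>" "c \<mu> \<le> 1"
    using list_min_range[of cs \<mu>] weak_bumps_range[of _ C \<mu>] by simp_all
next
  fix U \<mu> assume U: "openin (weak_topology X) U" and "\<mu> \<in> U"
  let ?P = "\<lambda>U \<mu>. \<exists>c\<in>weak_family C. c \<mu> = 1 \<and> (\<forall>\<nu>\<in>topspace (weak_topology X) - U. c \<nu> = 0)"
  have "generate_topology_on {(\<lambda>\<mu>. \<integral>x. f x \<partial>\<mu>) -` V \<inter> prob_measures X | f V. f \<in> Cb X \<and> open V} U"
    using U unfolding weak_topology_def initial_topology_def Cb_def
    by (auto dest: openin_topology_generated_by)
  then have "\<forall>\<mu>\<in>U. ?P U \<mu>"
  proof induction
    case Empty then show ?case by simp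
  next
    case (Int a b)
    show ?case
    proof
      fix \<mu> assume "\<mu> \<in> a \<inter> b"
      then have "?P a \<mu>" "?P b \<mu>" using Int.IH by blast+
      then obtain c d where c: "c \<in> weak_family C" "c \<mu> = 1"
          "\<forall>\<nu>\<in>topspace (weak_topology X) - a. c \<nu> = 0"
        and d: "d \<in> weak_family C" "d \<mu> = 1"
          "\<forall>\<nu>\<in>topspace (weak_topology X) - b. d \<nu> = 0"
        by meson
      obtain cs where cs': "c = list_min cs" "cs \<in> lists (weak_bumps C)" using c(1) unfolding weak_family_def by blast
      obtain ds where ds': "d = list_min ds" "ds \<in> lists (weak_bumps C)" using d(1) unfolding weak_family_def by blast
      note cs = cs'(2) c(2,3)[unfolded cs'(1)] and ds = ds'(2) d(2,3)[unfolded ds'(1)]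
      have cb: "b \<in> weak_bumps C" if "b \<in> set cs \<or> b \<in> set ds" for b using cs(1) ds(1) that by auto
      have r: "0 \<le> list_min cs \<nu>" "0 \<le> list_min ds \<nu>" "list_min ds \<nu> \<le> 1" for \<nu>
        using list_min_range[of cs \<nu>] list_min_range[of ds \<nu>] weak_bumps_range[OF cb, of _ \<nu>] by simp_all
      have "list_min (cs @ ds) \<in> weak_family C"
        unfolding weak_family_def using cs ds by (intro imageI) auto
      moreover have "list_min (cs @ ds) \<mu> = 1" using cs ds by (simp add: list_min_append)
      moreover have "list_min (cs @ ds) \<nu> = 0" if "\<nu> \<in> topspace (weak_topology X) - (a \<inter> b)" for \<nu>
      proof -
        have "list_min cs \<nu> = 0 \<or> list_min ds \<nu> = 0" using that cs(3) ds(3) by blast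
        then show ?thesis using r[of \<nu>] by (auto simp: list_min_append)
      qed
      ultimately show "?P (a \<inter> b) \<mu>" by blast
    qed
  next
    case (UN K)
    show ?case
    proof
      fix \<mu> assume "\<mu> \<in> \<Union>K"
      then obtain k where "k \<in> K" "\<mu> \<in> k" by auto
      then have "?P k \<mu>" using UN.IH by blast
      then show "?P (\<Union>K) \<mu>" using \<open>k \<in> K\<close> by blast
    qed
  next
    case (Basis s)
    then obtain f V where s: "s = (\<lambda>\<mu>. \<integral>x. f x \<partial>\<mu>) -` V \<inter> prob_measures X" and f: "f \<in> Cb X" and V: "open V"
      by auto
    show ?case
    proof
      fix \<mu> assume "\<mu> \<in> s"
      then have \<mu>: "\<mu> \<in> prob_measures X" and "(\<integral>x. f x \<partial>\<mu>) \<in> V" using s by auto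
      then obtain e where e: "e > 0" "\<And>y. \<bar>y - (\<integral>x. f x \<partial>\<mu>)\<bar> < e \<Longrightarrow> y \<in> V"
        using V unfolding open_dist by (metis dist_real_def)
      obtain M where M: "\<And>x. x \<in> topspace X \<Longrightarrow> \<bar>f x\<bar> \<le> M" using f by (metis CbE)
      have nn: "0 \<le> M + f x" "0 \<le> M - f x" if "x \<in> topspace X" for x using M[OF that] by auto
      have Cbs: "(\<lambda>x. M + f x) \<in> Cb X" "(\<lambda>x. M - f x) \<in> Cb X" using f by auto
      have a1: "M + (\<integral>x. f x \<partial>\<mu>) - e < (\<integral>x. M + f x \<partial>\<mu>)"
        and a2: "M - (\<integral>x. f x \<partial>\<mu>) - e < (\<integral>x. M - f x \<partial>\<mu>)"
        using integral_add_const_prob[OF \<mu> f, of M] e by auto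
      obtain b1 where b1: "b1 \<in> weak_bumps C" "b1 \<mu> = 1"
        "\<And>\<nu>. \<nu> \<in> prob_measures X \<Longrightarrow> b1 \<nu> \<noteq> 0 \<Longrightarrow> M + (\<integral>x. f x \<partial>\<mu>) - e < (\<integral>x. M + f x \<partial>\<nu>)"
        using weak_bump_below[OF sep Cbs(1) nn(1) \<mu> a1] by metis
      obtain b2 where b2: "b2 \<in> weak_bumps C" "b2 \<mu> = 1"
        "\<And>\<nu>. \<nu> \<in> prob_measures X \<Longrightarrow> b2 \<nu> \<noteq> 0 \<Longrightarrow> M - (\<integral>x. f x \<partial>\<mu>) - e < (\<integral>x. M - f x \<partial>\<nu>)"
        using weak_bump_below[OF sep Cbs(2) nn(2) \<mu> a2] by metis
      have "list_min [b1, b2] \<in> weak_family C"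
        unfolding weak_family_def using b1 b2 by (intro imageI) auto
      moreover have "list_min [b1, b2] \<mu> = 1" using b1 b2 by simp
      moreover have "list_min [b1, b2] \<nu> = 0" if \<nu>: "\<nu> \<in> topspace (weak_topology X) - s" for \<nu>
      proof (rule ccontr)
        have \<nu>': "\<nu> \<in> prob_measures X" using \<nu> by simp
        assume "list_min [b1, b2] \<nu> \<noteq> 0"
        then have "b1 \<nu> \<noteq> 0" "b2 \<nu> \<noteq> 0"
          using weak_bumps_range[OF b1(1), of \<nu>] weak_bumps_range[OF b2(1), of \<nu>] by (auto simp: min_def split: if_splits)
        then have "\<bar>(\<integral>x. f x \<partial>\<nu>) - (\<integral>x. f x \<partial>\<mu>)\<bar> < e"
          using b1(3)[OF \<nu>'] b2(3)[OF \<nu>'] integral_add_const_prob[OF \<nu>' f, of M] by auto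
        then show False using e(2) \<nu>' \<nu> s by auto
      qed
      ultimately show "?P s \<mu>" by blast
    qed
  qed
  then show "?P U \<mu>" using \<open>\<mu> \<in> U\<close> by blast
qed

section \<open>Finite powers of a Polish space\<close>

lemma topspace_power [simp]: "topspace (power_topology n :: (nat \<Rightarrow> 'z::topological_space) topology) = extensional {1..n}"
  by (simp add: power_topology_def PiE_UNIV_domain PiE_def)

lemma continuous_map_coord:
  "i \<in> {1..n} \<Longrightarrow> continuous_map (power_topology n) euclidean (\<lambda>z. z i)"
  unfolding power_topology_def by (rule continuous_map_product_projection)

lemma continuous_map_into_power:
  "continuous_map S (power_topology n) g \<longleftrightarrow>
     g \<in> topspace S \<rightarrow> extensional {1..n} \<and> (\<forall>i\<in>{1..n}. continuous_map S euclidean (\<lambda>s. g s i))"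
  unfolding power_topology_def continuous_map_componentwise by (simp add: image_subset_iff_funcset)

lemma continuous_map_dist:
  fixes f g :: "'a \<Rightarrow> 'b::metric_space"
  assumes "continuous_map S euclidean f" "continuous_map S euclidean g"
  shows "continuous_map S euclideanreal (\<lambda>s. dist (f s) (g s))"
proof -
  have "continuous_map S euclidean (\<lambda>s. (f s, g s))"
    using continuous_map_pairedI[OF assms] by simp
  moreover have "continuous_map euclidean euclideanreal (\<lambda>p::'b \<times> 'b. dist (fst p) (snd p))"
    by (auto intro!: continuous_intros)
  ultimately show ?thesis
    using continuous_map_compose[of S euclidean "\<lambda>s. (f s, g s)" euclideanreal "\<lambda>p. dist (fst p) (snd p)"]
    by (simp add: o_def)
qed

lemma continuous_map_sum_dist:
  assumes "continuous_map S (power_topology n) f" "continuous_map S (power_topology n) g"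
  shows "continuous_map S euclideanreal (\<lambda>s. sum_dist n (f s) (g s))"
  unfolding sum_dist_def
  by (intro continuous_map_sum continuous_map_dist) (use assms in \<open>auto simp: continuous_map_into_power\<close>)

lemma sum_dist_nonneg [simp]: "0 \<le> sum_dist n x y"
  by (simp add: sum_dist_def sum_nonneg)

lemma sum_dist_commute: "sum_dist n x y = sum_dist n y x"
  by (simp add: sum_dist_def dist_commute)

lemma sum_dist_triangle: "sum_dist n x z \<le> sum_dist n x y + sum_dist n y z"
  unfolding sum_dist_def sum.distrib[symmetric] by (intro sum_mono dist_triangle)

lemma sum_dist_self [simp]: "sum_dist n x x = 0"
  by (simp add: sum_dist_def)

lemma sum_dist_le:
  assumes "\<And>x y :: 'z::metric_space. dist x y \<le> D"
  shows "sum_dist n (x :: nat \<Rightarrow> 'z) y \<le> real n * D"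
  unfolding sum_dist_def using sum_mono[of "{1..n}" "\<lambda>i. dist (x i) (y i)" "\<lambda>_. D"] assms by simp

lemma bounded_dist_bound:
  assumes "bounded (UNIV :: 'z::metric_space set)"
  obtains D where "D > 0" "\<And>x y :: 'z. dist x y \<le> D"
proof -
  obtain D where "\<And>x y :: 'z. dist x y \<le> D" using assms unfolding bounded_two_points by auto
  then show ?thesis by (intro that[of "max 1 D"]) (auto simp: le_max_iff_disj)
qed

text \<open>The powers are sets of extensional functions, not types, so the Lipschitz condition is relative to the carrier.\<close>

definition sd_lipschitz :: "nat \<Rightarrow> real \<Rightarrow> ((nat \<Rightarrow> 'z::metric_space) \<Rightarrow> real) \<Rightarrow> bool" where
  "sd_lipschitz n L f \<longleftrightarrow> L \<ge> 0 \<and>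
     (\<forall>x\<in>extensional {1..n}. \<forall>y\<in>extensional {1..n}. \<bar>f x - f y\<bar> \<le> L * sum_dist n x y)"

lemma sd_lipschitzD:
  "sd_lipschitz n L f \<Longrightarrow> x \<in> extensional {1..n} \<Longrightarrow> y \<in> extensional {1..n} \<Longrightarrow> \<bar>f x - f y\<bar> \<le> L * sum_dist n x y"
  "sd_lipschitz n L f \<Longrightarrow> L \<ge> 0"
  by (auto simp: sd_lipschitz_def)

lemma sd_lipschitz_mono:
  assumes "sd_lipschitz n L f" "L \<le> M"
  shows "sd_lipschitz n M f"
  using assms mult_right_mono[OF assms(2) sum_dist_nonneg] unfolding sd_lipschitz_def by (meson order_trans)

lemma sd_lipschitz_const [simp]: "sd_lipschitz n 0 (\<lambda>_. c)"
  by (simp add: sd_lipschitz_def)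

lemma sd_lipschitz_add:
  assumes "sd_lipschitz n L f" "sd_lipschitz n M g"
  shows "sd_lipschitz n (L + M) (\<lambda>x. f x + g x)"
  unfolding sd_lipschitz_def
proof (intro conjI ballI)
  fix x y :: "nat \<Rightarrow> 'a" assume "x \<in> extensional {1..n}" "y \<in> extensional {1..n}"
  from sd_lipschitzD(1)[OF assms(1) this] sd_lipschitzD(1)[OF assms(2) this]
  show "\<bar>f x + g x - (f y + g y)\<bar> \<le> (L + M) * sum_dist n x y" by (simp add: distrib_right)
qed (use assms[THEN sd_lipschitzD(2)] in simp)

lemma sd_lipschitz_cmult:
  assumes "sd_lipschitz n L f"
  shows "sd_lipschitz n (\<bar>c\<bar> * L) (\<lambda>x. c * f x)"
  unfolding sd_lipschitz_def
proof (intro conjI ballI)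
  fix x y :: "nat \<Rightarrow> 'a" assume "x \<in> extensional {1..n}" "y \<in> extensional {1..n}"
  from sd_lipschitzD(1)[OF assms(1) this]
  show "\<bar>c * f x - c * f y\<bar> \<le> \<bar>c\<bar> * L * sum_dist n x y"
    by (simp add: right_diff_distrib[symmetric] abs_mult mult.assoc mult_left_mono)
qed (use assms[THEN sd_lipschitzD(2)] in simp)

lemma sd_lipschitz_diff:
  assumes "sd_lipschitz n L f" "sd_lipschitz n M g"
  shows "sd_lipschitz n (L + M) (\<lambda>x. f x - g x)"
  using sd_lipschitz_add[OF assms(1) sd_lipschitz_cmult[OF assms(2), of "-1"]] by simp

lemma sd_lipschitz_max:
  assumes "sd_lipschitz n L f" "sd_lipschitz n M g"
  shows "sd_lipschitz n (L + M) (\<lambda>x. max (f x) (g x))"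
  unfolding sd_lipschitz_def
proof (intro conjI ballI)
  fix x y :: "nat \<Rightarrow> 'a" assume "x \<in> extensional {1..n}" "y \<in> extensional {1..n}"
  from sd_lipschitzD(1)[OF assms(1) this] sd_lipschitzD(1)[OF assms(2) this]
  have "\<bar>f x - f y\<bar> \<le> L * sum_dist n x y" "\<bar>g x - g y\<bar> \<le> M * sum_dist n x y" .
  moreover have "\<bar>max (f x) (g x) - max (f y) (g y)\<bar> \<le> max \<bar>f x - f y\<bar> \<bar>g x - g y\<bar>" by linarith
  moreover have "0 \<le> L * sum_dist n x y" "0 \<le> M * sum_dist n x y"
    using assms[THEN sd_lipschitzD(2)] by auto
  ultimately show "\<bar>max (f x) (g x) - max (f y) (g y)\<bar> \<le> (L + M) * sum_dist n x y"
    unfolding distrib_right by linarith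
qed (use assms[THEN sd_lipschitzD(2)] in simp)

lemma sd_lipschitz_min:
  assumes "sd_lipschitz n L f" "sd_lipschitz n M g"
  shows "sd_lipschitz n (L + M) (\<lambda>x. min (f x) (g x))"
proof -
  have "sd_lipschitz n (L + M) (\<lambda>x. - 1 * max (- 1 * f x) (- 1 * g x))"
    using sd_lipschitz_cmult[OF sd_lipschitz_max[OF sd_lipschitz_cmult[OF assms(1)] sd_lipschitz_cmult[OF assms(2)]],
        of "-1" "-1" "-1"] by simp
  moreover have "- 1 * max (- 1 * f x) (- 1 * g x) = min (f x) (g x)" for x by linarith
  ultimately show ?thesis by simp
qed

lemma sd_lipschitz_dist: "p \<in> extensional {1..n} \<Longrightarrow> sd_lipschitz n 1 (\<lambda>x. sum_dist n x p)"
  unfolding sd_lipschitz_def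
proof (intro conjI ballI)
  fix x y :: "nat \<Rightarrow> 'a"
  show "\<bar>sum_dist n x p - sum_dist n y p\<bar> \<le> 1 * sum_dist n x y"
    using sum_dist_triangle[of n x p y] sum_dist_triangle[of n y p x] sum_dist_commute[of n x y] by simp
qed simp

lemma continuous_map_sd_lipschitz:
  assumes f: "sd_lipschitz n L f"
  shows "continuous_map (power_topology n) euclideanreal f"
proof (rule continuous_map_real_local_bound)
  let ?X = "power_topology n :: (nat \<Rightarrow> 'a) topology"
  fix x assume x: "x \<in> topspace ?X"
  have "continuous_map ?X euclideanreal (\<lambda>y. L * sum_dist n y x)"
    using x by (intro continuous_map_real_mult continuous_map_sum_dist) auto
  then show "\<exists>h. continuous_map ?X euclideanreal h \<and> h x = 0 \<and> (\<forall>y\<in>topspace ?X. \<bar>f y - f x\<bar> \<le> h y)"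
    using sd_lipschitzD(1)[OF f] x by (intro exI[of _ "\<lambda>y. L * sum_dist n y x"]) auto
qed

lemma Cb_sd_lipschitz:
  fixes f :: "(nat \<Rightarrow> 'z::metric_space) \<Rightarrow> real"
  assumes "bounded (UNIV :: 'z set)" "sd_lipschitz n L f"
  shows "f \<in> Cb (power_topology n)"
proof -
  obtain D where D: "D > 0" "\<And>x y :: 'z. dist x y \<le> D" using bounded_dist_bound[OF assms(1)] by metis
  define u :: "nat \<Rightarrow> 'z" where "u = (\<lambda>i\<in>{1..n}. undefined)"
  have u: "u \<in> extensional {1..n}" by (simp add: u_def)
  show ?thesis
  proof (rule CbI)
    show "continuous_map (power_topology n) euclideanreal f" by (rule continuous_map_sd_lipschitz[OF assms(2)])
    fix x :: "nat \<Rightarrow> 'z" assume "x \<in> topspace (power_topology n)"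
    then have "\<bar>f x - f u\<bar> \<le> L * sum_dist n x u" using sd_lipschitzD(1)[OF assms(2), of x u] u by auto
    also have "\<dots> \<le> L * (real n * D)"
      by (intro mult_left_mono sum_dist_le D sd_lipschitzD(2)[OF assms(2)])
    finally show "\<bar>f x\<bar> \<le> \<bar>f u\<bar> + L * (real n * D)" by linarith
  qed
qed

text \<open>A Lipschitz plateau around \<open>p\<close>: equal to \<open>1\<close> within distance \<open>1/k\<close> and to \<open>0\<close> beyond \<open>2/k\<close>.\<close>

definition bump :: "nat \<Rightarrow> nat \<Rightarrow> (nat \<Rightarrow> 'z::metric_space) \<Rightarrow> (nat \<Rightarrow> 'z) \<Rightarrow> real" where
  "bump n k p z = max 0 (min 1 (2 - real k * sum_dist n z p))"

lemma bump_range: "0 \<le> bump n k p z" "bump n k p z \<le> 1"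
  by (auto simp: bump_def)

lemma bump_eq_1: "real k * sum_dist n z p \<le> 1 \<Longrightarrow> bump n k p z = 1"
  by (simp add: bump_def)

lemma bump_nonzero: "bump n k p z \<noteq> 0 \<Longrightarrow> real k * sum_dist n z p < 2"
  by (auto simp: bump_def max_def split: if_splits)

lemma sd_lipschitz_bump:
  assumes "p \<in> extensional {1..n}"
  shows "sd_lipschitz n (real k) (bump n k p)"
proof -
  have "sd_lipschitz n (0 + (0 + (0 + \<bar>real k\<bar> * 1))) (\<lambda>z. max 0 (min 1 (2 - real k * sum_dist n z p)))"
    by (intro sd_lipschitz_max sd_lipschitz_min sd_lipschitz_diff sd_lipschitz_cmult sd_lipschitz_dist
        sd_lipschitz_const assms)
  then show ?thesis by (simp add: bump_def[abs_def])
qed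

definition dense_points :: "nat \<Rightarrow> (nat \<Rightarrow> 'z::second_countable_topology) set" where
  "dense_points n = {1..n} \<rightarrow>\<^sub>E (SOME D. countable D \<and> (\<forall>X. open X \<longrightarrow> X \<noteq> {} \<longrightarrow> (\<exists>d\<in>D. d \<in> X)))"

lemma dense_points:
  fixes n :: nat
  shows "countable (dense_points n :: (nat \<Rightarrow> 'z::{second_countable_topology, metric_space}) set)"
    and "(dense_points n :: (nat \<Rightarrow> 'z) set) \<subseteq> extensional {1..n}"
    and "\<And>x :: nat \<Rightarrow> 'z. e > 0 \<Longrightarrow> \<exists>p\<in>dense_points n. sum_dist n x p < e"
proof -
  define D :: "'z set" where "D = (SOME D. countable D \<and> (\<forall>X. open X \<longrightarrow> X \<noteq> {} \<longrightarrow> (\<exists>d\<in>D. d \<in> X)))"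
  have "countable D \<and> (\<forall>X. open X \<longrightarrow> X \<noteq> {} \<longrightarrow> (\<exists>d\<in>D. d \<in> X))"
    unfolding D_def by (rule someI_ex) (rule countable_dense_exists)
  then have D: "countable D" "\<And>X. open X \<Longrightarrow> X \<noteq> {} \<Longrightarrow> \<exists>d\<in>D. d \<in> X" by auto
  have eq: "dense_points n = {1..n} \<rightarrow>\<^sub>E D" by (simp add: dense_points_def D_def)
  show "countable (dense_points n :: (nat \<Rightarrow> 'z) set)"
    unfolding eq by (rule countable_PiE) (use D in auto)
  show "(dense_points n :: (nat \<Rightarrow> 'z) set) \<subseteq> extensional {1..n}" by (auto simp: eq PiE_def)
  fix x :: "nat \<Rightarrow> 'z" assume "e > 0"
  define r where "r = e / (real n + 1)"
  have "r > 0" using \<open>e > 0\<close> by (simp add: r_def)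
  have "\<exists>d\<in>D. dist (x i) d < r" for i using D(2)[of "ball (x i) r"] \<open>r > 0\<close> by auto
  then obtain d where d: "\<And>i. d i \<in> D" "\<And>i. dist (x i) (d i) < r" by metis
  define p where "p = (\<lambda>i\<in>{1..n}. d i)"
  have "p \<in> dense_points n" using d by (auto simp: eq p_def)
  moreover have "sum_dist n x p < e"
  proof -
    have "sum_dist n x p \<le> (\<Sum>i=1..n. r)"
      unfolding sum_dist_def p_def by (intro sum_mono) (use d(2) in \<open>auto simp: less_imp_le\<close>)
    also have "\<dots> = real n * r" by simp
    also have "\<dots> < (real n + 1) * r" using \<open>r > 0\<close> by simp
    also have "\<dots> = e" by (simp add: r_def)
    finally show ?thesis .
  qed
  ultimately show "\<exists>p\<in>dense_points n. sum_dist n x p < e" by blast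
qed

text \<open>A box around \<open>x\<close> restricts finitely many coordinates only, so the least of the radii works.\<close>

lemma openin_power_ball:
  fixes U :: "(nat \<Rightarrow> 'z::metric_space) set"
  assumes "openin (power_topology n) U" "x \<in> U"
  obtains r where "r > 0" "\<And>y. y \<in> extensional {1..n} \<Longrightarrow> sum_dist n x y < r \<Longrightarrow> y \<in> U"
proof -
  obtain W where W: "\<And>i. i \<in> {1..n} \<Longrightarrow> open (W i)" "x \<in> Pi\<^sub>E {1..n} W" "Pi\<^sub>E {1..n} W \<subseteq> U"
    using assms unfolding power_topology_def openin_product_topology_alt by (metis open_openin)
  have "\<exists>r>0. \<forall>y. dist y (x i) < r \<longrightarrow> y \<in> W i" if "i \<in> {1..n}" for i
    using W(1)[OF that] W(2) that unfolding open_dist by (auto simp: PiE_iff)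
  then obtain r where r: "\<And>i. i \<in> {1..n} \<Longrightarrow> r i > 0" "\<And>i y. i \<in> {1..n} \<Longrightarrow> dist y (x i) < r i \<Longrightarrow> y \<in> W i"
    by metis
  define R where "R = Min (insert 1 (r ` {1..n}))"
  have "R > 0" using r(1) by (auto simp: R_def)
  show ?thesis
  proof (rule that[OF \<open>R > 0\<close>])
    fix y :: "nat \<Rightarrow> 'z" assume y: "y \<in> extensional {1..n}" "sum_dist n x y < R"
    have "y i \<in> W i" if i: "i \<in> {1..n}" for i
    proof (rule r(2)[OF i])
      have "dist (y i) (x i) \<le> sum_dist n x y"
        unfolding sum_dist_def dist_commute[of "y i"] using i by (intro member_le_sum) auto
      also have "\<dots> < R" by (rule y)
      also have "R \<le> r i" unfolding R_def by (rule Min_le) (use i in auto)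
      finally show "dist (y i) (x i) < r i" .
    qed
    then have "y \<in> Pi\<^sub>E {1..n} W" using y(1) by (simp add: PiE_iff)
    then show "y \<in> U" using W(3) by blast
  qed
qed

definition power_family :: "nat \<Rightarrow> ((nat \<Rightarrow> 'z::polish_space) \<Rightarrow> real) set" where
  "power_family n = (\<lambda>(k, p). bump n k p) ` (UNIV \<times> dense_points n)"

lemma power_family_lipschitz: "c \<in> power_family n \<Longrightarrow> \<exists>L. sd_lipschitz n L c"
  using subsetD[OF dense_points(2)] sd_lipschitz_bump by (fastforce simp: power_family_def)

text \<open>The centre of the bump has to come from a countable dense set: it is chosen within \<open>1/k\<close> of \<open>x\<close>, where \<open>k\<close> is so
large that the support, of radius \<open>2/k\<close>, still lies in the ball of radius \<open>3/k\<close> around \<open>x\<close> inside the open set.\<close>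

lemma separating_power:
  "separating (power_topology n) (power_family n :: ((nat \<Rightarrow> 'z::polish_space) \<Rightarrow> real) set)"
  unfolding separating_def
proof (intro conjI ballI allI impI)
  show "countable (power_family n :: ((nat \<Rightarrow> 'z::polish_space) \<Rightarrow> real) set)"
    unfolding power_family_def using dense_points(1) by (intro countable_image countable_SIGMA) auto
  show "(power_family n :: ((nat \<Rightarrow> 'z) \<Rightarrow> real) set) \<subseteq> Cb (power_topology n)"
  proof
    fix c :: "(nat \<Rightarrow> 'z) \<Rightarrow> real" assume c: "c \<in> power_family n"
    then obtain L where "sd_lipschitz n L c" using power_family_lipschitz by blast
    moreover have "\<bar>c x\<bar> \<le> 1" for x using c by (auto simp: power_family_def bump_range)
    ultimately show "c \<in> Cb (power_topology n)" by (intro CbI[of _ _ 1] continuous_map_sd_lipschitz)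
  qed
next
  fix c :: "(nat \<Rightarrow> 'z) \<Rightarrow> real" and x assume "c \<in> power_family n"
  then show "0 \<le> c x" "c x \<le> 1" by (auto simp: power_family_def bump_range)
next
  fix U :: "(nat \<Rightarrow> 'z) set" and x assume U: "openin (power_topology n) U" "x \<in> U"
  then obtain r where r: "r > 0" "\<And>y. y \<in> extensional {1..n} \<Longrightarrow> sum_dist n x y < r \<Longrightarrow> y \<in> U"
    using openin_power_ball by metis
  obtain k :: nat where k: "3 < real k * r" using reals_Archimedean3[OF r(1)] by metis
  then have k0: "real k > 0" using r(1) by (cases "k = 0") auto
  obtain p where p: "p \<in> dense_points n" "sum_dist n x p < 1 / real k"
    using dense_points(3)[of "1 / real k" n x] k0 by auto
  have "bump n k p y = 0" if y: "y \<in> topspace (power_topology n) - U" for y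
  proof (rule ccontr)
    assume "bump n k p y \<noteq> 0"
    then have "real k * sum_dist n y p < 2" by (rule bump_nonzero)
    moreover have "real k * sum_dist n x p < 1" using p(2) k0 by (simp add: field_simps)
    moreover have "real k * sum_dist n x y \<le> real k * (sum_dist n x p + sum_dist n y p)"
      using sum_dist_triangle[of n x y p] sum_dist_commute[of n p y] k0 by (intro mult_left_mono) auto
    ultimately have "real k * sum_dist n x y < real k * r" using k by (simp add: distrib_left)
    then have "sum_dist n x y < r" using k0 by simp
    then show False using r(2)[of y] y by auto
  qed
  moreover have "bump n k p x = 1" using p(2) k0 by (intro bump_eq_1) (simp add: field_simps)
  moreover have "bump n k p \<in> power_family n" using p by (auto simp: power_family_def)
  ultimately show "\<exists>c\<in>power_family n. c x = 1 \<and> (\<forall>y\<in>topspace (power_topology n) - U. c y = 0)" by blast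
qed

lemma max_hull_power_lipschitz:
  "f \<in> max_hull (power_family n) \<Longrightarrow> \<exists>L. sd_lipschitz n L f"
proof (induction rule: max_hull_induct)
  case zero then show ?case using sd_lipschitz_const by blast
next
  case (max q c g)
  obtain L M where "sd_lipschitz n L c" "sd_lipschitz n M g"
    using power_family_lipschitz[OF max(2)] max(4) by blast
  then show ?case using sd_lipschitz_max[OF sd_lipschitz_cmult] by blast
qed

text \<open>A partition of unity into small pieces, except that finitely many pieces cannot exhaust a noncompact space: the sum
may fall short of \<open>1\<close>.\<close>

definition subpartition :: "nat \<Rightarrow> real \<Rightarrow> nat \<Rightarrow> (nat \<Rightarrow> (nat \<Rightarrow> 'z::metric_space) \<Rightarrow> real) \<Rightarrow> bool" where
  "subpartition n \<delta> m \<phi> \<longleftrightarrow>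
     (\<forall>i. \<phi> i \<in> Cb (power_topology n)) \<and> (\<forall>i z. 0 \<le> \<phi> i z) \<and> (\<forall>z. (\<Sum>i<m. \<phi> i z) \<le> 1) \<and>
     (\<forall>i x y. \<phi> i x \<noteq> 0 \<longrightarrow> \<phi> i y \<noteq> 0 \<longrightarrow> sum_dist n x y \<le> \<delta>)"

lemma subpartitionD:
  assumes "subpartition n \<delta> m \<phi>"
  shows "\<And>i. \<phi> i \<in> Cb (power_topology n)" "\<And>i z. 0 \<le> \<phi> i z" "\<And>z. (\<Sum>i<m. \<phi> i z) \<le> 1"
    "\<And>i x y. \<phi> i x \<noteq> 0 \<Longrightarrow> \<phi> i y \<noteq> 0 \<Longrightarrow> sum_dist n x y \<le> \<delta>"
  using assms by (auto simp: subpartition_def)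

text \<open>Running maxima of bumps around an enumerated dense set increase to \<open>1\<close> pointwise, so the mass that they miss
tends to \<open>0\<close> by dominated convergence. Their increments are the pieces: each increment is bounded by the bump
that causes it and thus has small support.\<close>

lemma subpartition_of_unity:
  fixes \<mu> :: "(nat \<Rightarrow> 'z::polish_space) measure"
  assumes \<mu>: "\<mu> \<in> prob_measures (power_topology n)" and "\<delta> > 0" "\<epsilon> > 0"
  obtains m :: nat and \<phi> where "subpartition n \<delta> m \<phi>" "(\<integral>z. 1 - (\<Sum>i<m. \<phi> i z) \<partial>\<mu>) < \<epsilon>"
proof -
  interpret prob_space \<mu> using \<mu> by (simp add: prob_measuresD)
  obtain k :: nat where k: "4 < real k * \<delta>" using reals_Archimedean3[OF \<open>\<delta> > 0\<close>] by metis
  then have k0: "real k > 0" using \<open>\<delta> > 0\<close> by (cases "k = 0") auto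
  let ?D = "dense_points n :: (nat \<Rightarrow> 'z) set"
  have ne: "?D \<noteq> {}" using dense_points(3)[of 1 n "undefined :: nat \<Rightarrow> 'z"] by auto
  define p where "p = from_nat_into ?D"
  have p: "p i \<in> ?D" for i unfolding p_def by (rule from_nat_into[OF ne])
  have p': "p i \<in> extensional {1..n}" for i by (rule subsetD[OF dense_points(2) p])
  define b where "b i = bump n k (p i)" for i
  define M where "M = rec_nat (\<lambda>_. 0) (\<lambda>i f z. max (f z) (b i z))"
  have M0: "M 0 z = 0" and MS: "M (Suc i) z = max (M i z) (b i z)" for i z by (simp_all add: M_def)
  have Mr: "0 \<le> M i z \<and> M i z \<le> 1" for i z by (induction i) (auto simp: M0 MS b_def bump_range le_max_iff_disj)
  define \<phi> where "\<phi> i z = M (Suc i) z - M i z" for i z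
  have sum: "(\<Sum>i<m. \<phi> i z) = M m z" for m z
    unfolding \<phi>_def by (subst sum_lessThan_telescope) (simp add: M0)
  have MLip: "\<exists>L. sd_lipschitz n L (M i)" for i
  proof (induction i)
    case 0
    have "M 0 = (\<lambda>_. 0)" by (simp add: M_def)
    then show ?case using sd_lipschitz_const by metis
  next
    case (Suc i)
    have "M (Suc i) = (\<lambda>z. max (M i z) (b i z))" by (simp add: M_def)
    moreover obtain L where "sd_lipschitz n L (M i)" using Suc by blast
    ultimately show ?case using sd_lipschitz_max[OF _ sd_lipschitz_bump[OF p'[of i]]] unfolding b_def by metis
  qed
  have MC: "M i \<in> Cb (power_topology n)" for i
  proof -
    obtain L where "sd_lipschitz n L (M i)" using MLip by blast
    then show ?thesis using Mr[of i] by (intro CbI[of _ _ 1] continuous_map_sd_lipschitz) auto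
  qed
  have lim: "(\<lambda>m. M m z) \<longlonglongrightarrow> 1" for z
  proof -
    obtain q where q: "q \<in> ?D" "sum_dist n z q < 1 / real k" using dense_points(3)[of "1 / real k" n z] k0 by auto
    then obtain i where i: "p i = q" unfolding p_def using from_nat_into_surj[OF dense_points(1)] by metis
    have "b i z = 1" unfolding b_def i using q(2) k0 by (intro bump_eq_1) (simp add: field_simps)
    then have "M (Suc i) z = 1" using Mr[of "Suc i" z] by (auto simp: MS)
    moreover have "incseq (\<lambda>m. M m z)" by (rule incseq_SucI) (simp add: MS)
    ultimately have "M m z = 1" if "m \<ge> Suc i" for m using Mr[of m z] incseqD[of "\<lambda>m. M m z", OF _ that] by auto
    then have "\<forall>\<^sub>F m in sequentially. M m z = 1" unfolding eventually_sequentially by blast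
    then show ?thesis by (rule tendsto_eventually)
  qed
  have "(\<lambda>m. \<integral>z. 1 - M m z \<partial>\<mu>) \<longlonglongrightarrow> (\<integral>z. 1 - 1 \<partial>\<mu>)"
  proof (rule integral_dominated_convergence[where w="\<lambda>_. 1"])
    show "(\<lambda>z. 1 - M m z) \<in> borel_measurable \<mu>" for m
      using Cb_integrable[OF Cb_diff[OF Cb_const MC] \<mu>] by auto
    show "AE z in \<mu>. (\<lambda>m. 1 - M m z) \<longlonglongrightarrow> 1 - 1" by (intro AE_I2 tendsto_diff tendsto_const lim)
    show "AE z in \<mu>. norm (1 - M m z) \<le> 1" for m using Mr[of m] by (auto intro!: AE_I2)
  qed auto
  then obtain m where m: "(\<integral>z. 1 - M m z \<partial>\<mu>) < \<epsilon>"
    using order_tendstoD(2)[of _ _ sequentially \<epsilon>] \<open>\<epsilon> > 0\<close> by (force simp: eventually_sequentially)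
  have C\<phi>: "\<phi> i \<in> Cb (power_topology n)" for i unfolding \<phi>_def[abs_def] by (intro Cb_diff MC)
  have nn: "0 \<le> \<phi> i z" for i z by (simp add: \<phi>_def MS)
  have diam: "sum_dist n x y \<le> \<delta>" if "\<phi> i x \<noteq> 0" "\<phi> i y \<noteq> 0" for i x y
  proof -
    have "\<phi> i z \<le> b i z" for z
      using Mr[of i z] bump_range(1)[of n k "p i" z] unfolding \<phi>_def MS b_def by linarith
    then have "b i x \<noteq> 0" "b i y \<noteq> 0" using nn[of i x] nn[of i y] that by (metis order_antisym)+
    then have "real k * sum_dist n x (p i) < 2" "real k * sum_dist n y (p i) < 2"
      unfolding b_def by (auto dest: bump_nonzero)
    moreover have "real k * sum_dist n x y \<le> real k * (sum_dist n x (p i) + sum_dist n y (p i))"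
      using sum_dist_triangle[of n x y "p i"] sum_dist_commute[of n "p i" y] k0 by (intro mult_left_mono) auto
    ultimately have "real k * sum_dist n x y \<le> real k * \<delta>" using k by (simp add: distrib_left)
    then show "sum_dist n x y \<le> \<delta>" using k0 by simp
  qed
  have "subpartition n \<delta> m \<phi>"
    unfolding subpartition_def using C\<phi> nn diam Mr by (auto simp: sum)
  moreover have "(\<integral>z. 1 - (\<Sum>i<m. \<phi> i z) \<partial>\<mu>) < \<epsilon>" using m by (simp add: sum)
  ultimately show ?thesis by (rule that)
qed

section \<open>Regular conditional laws\<close>

text \<open>On \<open>{g < f}\<close> the integral of \<open>f - g\<close> is both nonnegative and, by assumption, at most \<open>0\<close>.\<close>

lemma AE_le_from_set_integrals:
  assumes [measurable]: "f \<in> borel_measurable M" "g \<in> borel_measurable M"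
    and le: "\<And>S. S \<in> sets M \<Longrightarrow> (\<integral>\<^sup>+x\<in>S. f x \<partial>M) \<le> (\<integral>\<^sup>+x\<in>S. g x \<partial>M)"
    and fin: "(\<integral>\<^sup>+x. f x \<partial>M) < \<infinity>"
  shows "AE x in M. f x \<le> (g x :: ennreal)"
proof -
  let ?S = "{x \<in> space M. g x < f x}"
  have S[measurable]: "?S \<in> sets M" by measurable
  have "(\<integral>\<^sup>+x\<in>?S. f x \<partial>M) \<le> (\<integral>\<^sup>+x. f x \<partial>M)" by (intro nn_integral_mono) (auto split: split_indicator)
  then have f_fin: "(\<integral>\<^sup>+x\<in>?S. f x \<partial>M) < \<infinity>" using fin by (simp add: order_le_less_trans)
  have gf: "(\<integral>\<^sup>+x\<in>?S. g x \<partial>M) \<le> (\<integral>\<^sup>+x\<in>?S. f x \<partial>M)"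
    by (intro nn_integral_mono) (auto split: split_indicator)
  have "(\<integral>\<^sup>+x. f x * indicator ?S x - g x * indicator ?S x \<partial>M) =
      (\<integral>\<^sup>+x\<in>?S. f x \<partial>M) - (\<integral>\<^sup>+x\<in>?S. g x \<partial>M)"
    using gf f_fin by (intro nn_integral_diff) (auto split: split_indicator intro!: AE_I2)
  also have "\<dots> = 0" using le[OF S] gf f_fin by (simp add: diff_eq_0_iff_ennreal less_top[symmetric])
  finally have "AE x in M. f x * indicator ?S x - g x * indicator ?S x = 0"
    by (subst (asm) nn_integral_0_iff_AE) auto
  with AE_space show ?thesis
  proof eventually_elim
    case (elim x)
    show ?case
    proof (rule ccontr)
      assume "\<not> f x \<le> g x"
      then have "g x < f x" by simp
      then have "f x - g x = 0" using elim by simp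
      then show False using \<open>g x < f x\<close> by (metis diff_eq_0_iff_ennreal leD)
    qed
  qed
qed

text \<open>The conditional probability of an event as a function of the value of \<open>X\<close>: the Radon-Nikodym density of
\<open>S \<mapsto> \<mu>(X \<in> S, E)\<close> with respect to the law of \<open>X\<close>. It is at most \<open>1\<close> almost everywhere and is truncated to be so
everywhere.\<close>

lemma conditional_density:
  assumes \<mu>: "prob_space \<mu>" and X[measurable]: "X \<in> \<mu> \<rightarrow>\<^sub>M A" and E[measurable]: "E \<in> sets \<mu>"
  obtains c :: "'a \<Rightarrow> real" where "c \<in> borel_measurable A" "\<And>x. 0 \<le> c x" "\<And>x. c x \<le> 1"
    "\<And>S. S \<in> sets A \<Longrightarrow> emeasure \<mu> {w \<in> space \<mu>. X w \<in> S \<and> w \<in> E} = (\<integral>\<^sup>+x\<in>S. ennreal (c x) \<partial>distr \<mu> A X)"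
proof -
  interpret prob_space \<mu> by (rule \<mu>)
  let ?P = "distr \<mu> A X"
  interpret P: prob_space ?P by (rule prob_space_distr[OF X])
  define N where "N = distr (density \<mu> (indicator E)) A X"
  have N: "emeasure N S = emeasure \<mu> {w \<in> space \<mu>. X w \<in> S \<and> w \<in> E}" if [measurable]: "S \<in> sets A" for S
  proof -
    have "emeasure N S = emeasure (density \<mu> (indicator E)) (X -` S \<inter> space \<mu>)"
      unfolding N_def by (subst emeasure_distr) auto
    also have "\<dots> = (\<integral>\<^sup>+w. indicator E w * indicator (X -` S \<inter> space \<mu>) w \<partial>\<mu>)"
      by (subst emeasure_density) auto
    also have "\<dots> = (\<integral>\<^sup>+w. indicator {w \<in> space \<mu>. X w \<in> S \<and> w \<in> E} w \<partial>\<mu>)"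
      by (intro nn_integral_cong) (auto split: split_indicator)
    also have "\<dots> = emeasure \<mu> {w \<in> space \<mu>. X w \<in> S \<and> w \<in> E}" by (intro nn_integral_indicator) measurable
    finally show ?thesis .
  qed
  have P: "emeasure ?P S = emeasure \<mu> (X -` S \<inter> space \<mu>)" if "S \<in> sets A" for S
    using that by (simp add: emeasure_distr)
  have NP: "emeasure N S \<le> emeasure ?P S" if [measurable]: "S \<in> sets A" for S
    unfolding N[OF that] P[OF that] by (intro emeasure_mono) auto
  have ac: "absolutely_continuous ?P N"
    unfolding absolutely_continuous_def null_sets_def using NP by (auto simp: N_def)
      (metis le_zero_eq N_def)
  then obtain h where h[measurable]: "h \<in> borel_measurable ?P" and "density ?P h = N"
    using P.Radon_Nikodym[of N] by (auto simp: N_def)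
  have hN: "emeasure N S = (\<integral>\<^sup>+x\<in>S. h x \<partial>?P)" if "S \<in> sets A" for S
    using that unfolding \<open>density ?P h = N\<close>[symmetric] by (subst emeasure_density) auto
  have h1: "AE x in ?P. h x \<le> 1"
  proof (rule AE_le_from_set_integrals)
    show "(\<integral>\<^sup>+x\<in>S. h x \<partial>?P) \<le> (\<integral>\<^sup>+x\<in>S. 1 \<partial>?P)" if "S \<in> sets ?P" for S
      using hN[of S] NP[of S] that by simp
    have "(\<integral>\<^sup>+x. h x \<partial>?P) = (\<integral>\<^sup>+x\<in>space A. h x \<partial>?P)" by (intro nn_integral_cong) auto
    also have "\<dots> = emeasure N (space A)" using hN[of "space A"] by simp
    also have "\<dots> \<le> emeasure ?P (space A)" by (rule NP) auto
    also have "\<dots> < \<infinity>" using P.emeasure_space_1 by simp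
    finally show "(\<integral>\<^sup>+x. h x \<partial>?P) < \<infinity>" .
  qed auto
  define c where "c x = enn2real (min 1 (h x))" for x
  have c: "ennreal (c x) = min 1 (h x)" for x
    unfolding c_def by (simp add: min_def less_top[symmetric] ennreal_enn2real_if)
  show ?thesis
  proof (rule that[of c])
    show "c \<in> borel_measurable A" unfolding c_def using h by measurable
    show "0 \<le> c x" "c x \<le> 1" for x
      unfolding c_def by (auto intro!: enn2real_leI)
    fix S assume S: "S \<in> sets A"
    have "(\<integral>\<^sup>+x\<in>S. h x \<partial>?P) = (\<integral>\<^sup>+x\<in>S. ennreal (c x) \<partial>?P)"
      using h1 by (intro nn_integral_cong_AE) (auto simp: c min_def)
    then show "emeasure \<mu> {w \<in> space \<mu>. X w \<in> S \<and> w \<in> E} = (\<integral>\<^sup>+x\<in>S. ennreal (c x) \<partial>?P)"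
      using N[OF S] hN[OF S] by simp
  qed
qed

text \<open>Choose versions \<open>c q\<close> of the conditional probability of \<open>Y \<le> q\<close>. The infimum of \<open>c q\<close> over the rationals \<open>q > r\<close> is
monotone and right-continuous in \<open>r\<close> for any choice of versions, so it defines a distribution function for every value
of \<open>X\<close>, without exceptional null sets. A bounded range of \<open>Y\<close> settles the behaviour at infinity. That the infimum is
still a version of the conditional probability follows from almost sure monotonicity of the versions and continuity
from above.\<close>

lemma conditional_kernel_real:
  fixes Y :: "'w \<Rightarrow> real"
  assumes \<mu>: "prob_space \<mu>" and X[measurable]: "X \<in> \<mu> \<rightarrow>\<^sub>M A" and Y[measurable]: "Y \<in> borel_measurable \<mu>"
    and Y0: "\<And>w. w \<in> space \<mu> \<Longrightarrow> 0 \<le> Y w" and Y2: "\<And>w. w \<in> space \<mu> \<Longrightarrow> Y w \<le> 2"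
  obtains \<kappa> where "regular_conditional_law \<mu> A X borel Y \<kappa>"
proof -
  interpret prob_space \<mu> by (rule \<mu>)
  let ?P = "distr \<mu> A X"
  interpret P: prob_space ?P by (rule prob_space_distr[OF X])
  \<comment> \<open>Outside the range of \<open>Y\<close> the versions are fixed to be \<open>0\<close> and \<open>1\<close>, which yields the limits of the distribution function at infinity.\<close>
  define version where "version q c \<longleftrightarrow> c \<in> borel_measurable A \<and> (\<forall>x. 0 \<le> c x) \<and> (\<forall>x. c x \<le> 1) \<and>
     (q < 0 \<longrightarrow> (\<forall>x. c x = 0)) \<and> (q \<ge> 2 \<longrightarrow> (\<forall>x. c x = 1)) \<and>
     (\<forall>S\<in>sets A. emeasure \<mu> {w \<in> space \<mu>. X w \<in> S \<and> Y w \<le> q} = (\<integral>\<^sup>+x\<in>S. ennreal (c x) \<partial>?P))" for q c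
  have "\<exists>c. version q c" for q
  proof -
    consider "q < 0" | "q \<ge> 2" | "0 \<le> q" "q < 2" by linarith
    then show ?thesis
    proof cases
      case 1
      have e: "{w \<in> space \<mu>. X w \<in> S \<and> Y w \<le> q} = {}" for S using Y0 1 by force
      show ?thesis unfolding version_def e using 1 by (intro exI[of _ "\<lambda>_. 0"]) simp
    next
      case 2
      have e: "{w \<in> space \<mu>. X w \<in> S \<and> Y w \<le> q} = X -` S \<inter> space \<mu>" for S using Y2 2 by force
      show ?thesis unfolding version_def e using 2 by (intro exI[of _ "\<lambda>_. 1"]) (simp add: emeasure_distr)
    next
      case 3
      have E: "{w \<in> space \<mu>. Y w \<le> q} \<in> sets \<mu>" by measurable
      obtain c where "c \<in> borel_measurable A" "\<And>x. 0 \<le> c x" "\<And>x. c x \<le> 1"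
        "\<And>S. S \<in> sets A \<Longrightarrow> emeasure \<mu> {w \<in> space \<mu>. X w \<in> S \<and> w \<in> {w \<in> space \<mu>. Y w \<le> q}} = (\<integral>\<^sup>+x\<in>S. ennreal (c x) \<partial>?P)"
        by (rule conditional_density[OF \<mu> X E]) (rule that)
      moreover have "{w \<in> space \<mu>. X w \<in> S \<and> w \<in> {w \<in> space \<mu>. Y w \<le> q}} = {w \<in> space \<mu>. X w \<in> S \<and> Y w \<le> q}" for S by auto
      ultimately show ?thesis unfolding version_def using 3 by (intro exI[of _ c]) auto
    qed
  qed
  then obtain c where ver: "\<And>q. version q (c q)" by metis
  have c[measurable]: "\<And>q. c q \<in> borel_measurable A" and c0: "\<And>q x. 0 \<le> c q x" and c1: "\<And>q x. c q x \<le> 1"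
    and cneg: "\<And>q x. q < 0 \<Longrightarrow> c q x = 0" and cpos: "\<And>q x. q \<ge> 2 \<Longrightarrow> c q x = 1"
    and cint: "\<And>q S. S \<in> sets A \<Longrightarrow> emeasure \<mu> {w \<in> space \<mu>. X w \<in> S \<and> Y w \<le> q} = (\<integral>\<^sup>+x\<in>S. ennreal (c q x) \<partial>?P)"
    using ver unfolding version_def by simp_all
  define Q where "Q r = {q \<in> \<rat>. r < q}" for r :: real
  have Qne: "Q r \<noteq> {}" for r using Rats_dense_in_real[of r "r + 1"] by (auto simp: Q_def)
  have Qc: "countable (Q r)" for r unfolding Q_def by (rule countable_subset[OF _ countable_rat]) auto
  \<comment> \<open>Strict inequality \<open>r < q\<close> in \<open>Q r\<close> is what makes the infimum right-continuous.\<close>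
  define F where "F x r = (INF q\<in>Q r. c q x)" for x r
  have bdd: "bdd_below ((\<lambda>q. c q x) ` Q r)" for x r using c0 by (auto intro!: bdd_belowI[of _ 0])
  have Fm[measurable]: "(\<lambda>x. F x r) \<in> borel_measurable A" for r
    unfolding F_def using Qc by (intro borel_measurable_cINF_real) auto
  have F0: "0 \<le> F x r" for x r unfolding F_def by (intro cINF_greatest Qne c0)
  have Fle: "F x r \<le> c q x" if "q \<in> Q r" for x r q unfolding F_def by (intro cINF_lower bdd that)
  have Fmono: "F x r \<le> F x s" if "r \<le> s" for x r s
    unfolding F_def by (intro cINF_superset_mono Qne bdd) (use that in \<open>auto simp: Q_def\<close>)
  have Fneg: "F x r = 0" if "r < 0" for x r
  proof -
    obtain q where "r < q" "q < 0" "q \<in> \<rat>" using Rats_dense_in_real[OF \<open>r < 0\<close>] by auto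
    then show ?thesis using Fle[of q r x] cneg[of q x] F0[of x r] by (auto simp: Q_def)
  qed
  have Fpos: "F x r = 1" if "r \<ge> 2" for x r
    unfolding F_def using that Qne[of r] cpos by (subst INF_cong[of "Q r" "Q r" _ "\<lambda>_. 1"]) (auto simp: Q_def)
  have right_cont: "continuous (at_right a) (F x)" for a x
    unfolding continuous_within
  proof (rule decreasing_tendsto)
    show "\<forall>\<^sub>F r in at_right a. F x a \<le> F x r"
      by (auto simp: eventually_at_filter intro!: always_eventually Fmono)
    fix b assume "F x a < b"
    then obtain q where q: "q \<in> Q a" "c q x < b" unfolding F_def using cINF_less_iff[OF Qne bdd] by auto
    then have "\<forall>\<^sub>F r in at_right a. r < q" by (intro eventually_at_rightI[of a q]) (auto simp: Q_def)
    then show "\<forall>\<^sub>F r in at_right a. F x r < b"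
      by eventually_elim (use q Fle[of q _ x] in \<open>auto simp: Q_def intro: order_le_less_trans\<close>)
  qed
  have bot: "(F x \<longlongrightarrow> 0) at_bot" for x
    by (intro tendsto_eventually) (auto simp: eventually_at_bot_linorder Fneg intro!: exI[of _ "-1"])
  have top: "(F x \<longlongrightarrow> 1) at_top" for x
    by (intro tendsto_eventually) (auto simp: eventually_at_top_linorder Fpos intro!: exI[of _ 2])
  define \<kappa> where "\<kappa> x = interval_measure (F x)" for x
  have rd: "real_distribution (\<kappa> x)" for x
    unfolding \<kappa>_def by (intro real_distribution_interval_measure Fmono right_cont bot top)
  have Iic: "emeasure (\<kappa> x) {..r} = ennreal (F x r)" for x r
    unfolding \<kappa>_def by (intro emeasure_interval_measure_Iic Fmono right_cont bot)
  have \<kappa>[measurable]: "\<kappa> \<in> A \<rightarrow>\<^sub>M prob_algebra borel"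
  proof (rule measurable_prob_algebra_generated[where \<Omega>=UNIV and G="range atMost"])
    show "sets borel = sigma_sets UNIV (range (atMost :: real \<Rightarrow> _))"
      by (simp add: borel_eq_atMost)
    show "Int_stable (range (atMost :: real \<Rightarrow> _))" by (auto simp: Int_stable_def)
    show "prob_space (\<kappa> a)" for a using rd[of a] by (simp add: real_distribution_def)
    show "sets (\<kappa> a) = sets borel" for a by (simp add: \<kappa>_def)
    show "(\<lambda>a. emeasure (\<kappa> a) T) \<in> borel_measurable A" if "T \<in> range atMost" for T
      using that by (auto simp: Iic)
  qed auto
  have Fint: "(\<integral>\<^sup>+x\<in>S. ennreal (F x r) \<partial>?P) = emeasure \<mu> {w \<in> space \<mu>. X w \<in> S \<and> Y w \<le> r}"
    if S[measurable]: "S \<in> sets A" for S r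
  proof (rule antisym)
    have dec: "r + 1 / Suc n \<le> r + 1 / Suc m" if "m \<le> n" for m n
      using that by (simp add: frac_le)
    have "(\<lambda>n. emeasure \<mu> {w \<in> space \<mu>. X w \<in> S \<and> Y w \<le> r + 1 / Suc n}) \<longlonglongrightarrow>
        emeasure \<mu> (\<Inter>n. {w \<in> space \<mu>. X w \<in> S \<and> Y w \<le> r + 1 / Suc n})"
    proof (rule Lim_emeasure_decseq)
      show "decseq (\<lambda>n. {w \<in> space \<mu>. X w \<in> S \<and> Y w \<le> r + 1 / Suc n})"
        unfolding decseq_def using dec by (blast intro: order_trans)
    qed (auto simp: emeasure_eq_measure)
    moreover have "(\<Inter>n. {w \<in> space \<mu>. X w \<in> S \<and> Y w \<le> r + 1 / Suc n}) = {w \<in> space \<mu>. X w \<in> S \<and> Y w \<le> r}"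
    proof (intro set_eqI iffI)
      fix w assume w: "w \<in> (\<Inter>n. {w \<in> space \<mu>. X w \<in> S \<and> Y w \<le> r + 1 / Suc n})"
      have "Y w \<le> r"
      proof (rule field_le_epsilon)
        fix e :: real assume "0 < e"
        then obtain n where "1 / Suc n < e" using nat_approx_posE by auto
        then show "Y w \<le> r + e" using w by (auto dest!: spec[of _ n])
      qed
      then show "w \<in> {w \<in> space \<mu>. X w \<in> S \<and> Y w \<le> r}" using w by auto
    qed (auto intro: add_increasing2)
    ultimately have lim: "(\<lambda>n. emeasure \<mu> {w \<in> space \<mu>. X w \<in> S \<and> Y w \<le> r + 1 / Suc n}) \<longlonglongrightarrow>
        emeasure \<mu> {w \<in> space \<mu>. X w \<in> S \<and> Y w \<le> r}" by simp
    show "(\<integral>\<^sup>+x\<in>S. ennreal (F x r) \<partial>?P) \<le> emeasure \<mu> {w \<in> space \<mu>. X w \<in> S \<and> Y w \<le> r}"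
    proof (rule LIMSEQ_le_const[OF lim], intro exI allI impI)
      fix n
      obtain q where q: "q \<in> \<rat>" "r < q" "q < r + 1 / Suc n" using Rats_dense_in_real[of r "r + 1 / Suc n"] by auto
      have "(\<integral>\<^sup>+x\<in>S. ennreal (F x r) \<partial>?P) \<le> (\<integral>\<^sup>+x\<in>S. ennreal (c q x) \<partial>?P)"
        by (intro nn_integral_mono mult_right_mono ennreal_leI Fle) (use q in \<open>auto simp: Q_def\<close>)
      also have "\<dots> = emeasure \<mu> {w \<in> space \<mu>. X w \<in> S \<and> Y w \<le> q}" by (rule cint[OF S, symmetric])
      also have "\<dots> \<le> emeasure \<mu> {w \<in> space \<mu>. X w \<in> S \<and> Y w \<le> r + 1 / Suc n}"
        by (intro emeasure_mono) (use q in auto)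
      finally show "(\<integral>\<^sup>+x\<in>S. ennreal (F x r) \<partial>?P) \<le> emeasure \<mu> {w \<in> space \<mu>. X w \<in> S \<and> Y w \<le> r + 1 / Suc n}" .
    qed
    have "AE x in ?P. ennreal (c r x) \<le> ennreal (c q x)" if q: "q \<in> Q r" for q
    proof (rule AE_le_from_set_integrals)
      fix S assume "S \<in> sets ?P"
      then have [measurable]: "S \<in> sets A" by simp
      show "(\<integral>\<^sup>+x\<in>S. ennreal (c r x) \<partial>?P) \<le> (\<integral>\<^sup>+x\<in>S. ennreal (c q x) \<partial>?P)"
        unfolding cint[OF \<open>S \<in> sets A\<close>, symmetric] using q by (intro emeasure_mono) (auto simp: Q_def)
    next
      have "(\<integral>\<^sup>+x. ennreal (c r x) \<partial>?P) \<le> (\<integral>\<^sup>+x. 1 \<partial>?P)" by (intro nn_integral_mono) (simp add: c1)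
      also have "\<dots> < \<infinity>" using P.emeasure_space_1 by simp
      finally show "(\<integral>\<^sup>+x. ennreal (c r x) \<partial>?P) < \<infinity>" .
    qed auto
    then have "AE x in ?P. \<forall>q\<in>Q r. ennreal (c r x) \<le> ennreal (c q x)" by (simp add: AE_ball_countable[OF Qc])
    then have "AE x in ?P. ennreal (c r x) \<le> ennreal (F x r)"
      by eventually_elim (auto intro!: ennreal_leI cINF_greatest Qne simp: F_def c0)
    then have "(\<integral>\<^sup>+x\<in>S. ennreal (c r x) \<partial>?P) \<le> (\<integral>\<^sup>+x\<in>S. ennreal (F x r) \<partial>?P)"
      by (intro nn_integral_mono_AE) (auto elim!: eventually_mono split: split_indicator)
    then show "emeasure \<mu> {w \<in> space \<mu>. X w \<in> S \<and> Y w \<le> r} \<le> (\<integral>\<^sup>+x\<in>S. ennreal (F x r) \<partial>?P)"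
      by (simp add: cint[OF S])
  qed
  have "regular_conditional_law \<mu> A X borel Y \<kappa>"
    unfolding regular_conditional_law_def
  proof (intro conjI ballI \<kappa>)
    fix S T assume S[measurable]: "S \<in> sets A" and T: "T \<in> sets (borel :: real measure)"
    define E where "E = {w \<in> space \<mu>. X w \<in> S}"
    have E[measurable]: "E \<in> sets \<mu>" unfolding E_def by measurable
    \<comment> \<open>Both sides of the defining identity are finite measures in \<open>T\<close>, so half-lines suffice.\<close>
    define N1 where "N1 = distr (density \<mu> (indicator E)) borel Y"
    define N2 where "N2 = density ?P (indicator S) \<bind> \<kappa>"
    have N1: "emeasure N1 T = emeasure \<mu> {w \<in> space \<mu>. X w \<in> S \<and> Y w \<in> T}" if [measurable]: "T \<in> sets borel" for T
    proof -
      have "emeasure N1 T = emeasure (density \<mu> (indicator E)) (Y -` T \<inter> space \<mu>)"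
        unfolding N1_def by (subst emeasure_distr) auto
      also have "\<dots> = (\<integral>\<^sup>+w. indicator E w * indicator (Y -` T \<inter> space \<mu>) w \<partial>\<mu>)"
        by (subst emeasure_density) auto
      also have "\<dots> = (\<integral>\<^sup>+w. indicator {w \<in> space \<mu>. X w \<in> S \<and> Y w \<in> T} w \<partial>\<mu>)"
        by (intro nn_integral_cong) (auto split: split_indicator simp: E_def)
      also have "\<dots> = emeasure \<mu> {w \<in> space \<mu>. X w \<in> S \<and> Y w \<in> T}" by (intro nn_integral_indicator) measurable
      finally show ?thesis .
    qed
    have neA: "space A \<noteq> {}" using P.not_empty by simp
    have \<kappa>': "\<kappa> \<in> density ?P (indicator S) \<rightarrow>\<^sub>M subprob_algebra borel"
      using measurable_prob_algebraD[OF \<kappa>] by (simp cong: measurable_cong_sets)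
    have N2: "emeasure N2 T = (\<integral>\<^sup>+x\<in>S. emeasure (\<kappa> x) T \<partial>?P)" if [measurable]: "T \<in> sets borel" for T
    proof -
      have m: "(\<lambda>x. emeasure (\<kappa> x) T) \<in> borel_measurable A"
        by (rule measurable_compose[OF measurable_prob_algebraD[OF \<kappa>] measurable_emeasure_subprob_algebra[OF that]])
      have "emeasure N2 T = (\<integral>\<^sup>+x. emeasure (\<kappa> x) T \<partial>density ?P (indicator S))"
        unfolding N2_def by (rule emeasure_bind[OF _ \<kappa>']) (use neA in auto)
      also have "\<dots> = (\<integral>\<^sup>+x. indicator S x * emeasure (\<kappa> x) T \<partial>?P)"
        using m by (intro nn_integral_density) auto
      finally show ?thesis by (simp add: mult.commute)
    qed
    have s2: "sets N2 = sets borel" unfolding N2_def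
      using sets_bind[of "density ?P (indicator S)" \<kappa> borel] neA subprob_measurableD(2)[OF \<kappa>'] by simp
    have eqs: "emeasure N1 {..r} = emeasure N2 {..r}" for r
      using Fint[OF S, of r] by (simp add: N1 N2 Iic)
    have e1: "emeasure N1 T \<le> 1" if "T \<in> sets borel" for T unfolding N1[OF that] by (rule measure_le_1) 
    have s1: "sets N1 = sets borel" by (simp add: N1_def)
    have sp: "space N1 = UNIV" "space N2 = UNIV" using sets_eq_imp_space_eq[OF s1] sets_eq_imp_space_eq[OF s2] by auto
    have "N1 = N2"
    proof (rule measure_eqI_generator_eq[where \<Omega>=UNIV and E="range atMost" and A="\<lambda>n::nat. {..real n}"])
      show "Int_stable (range (atMost :: real \<Rightarrow> _))" by (auto simp: Int_stable_def)
      show "sets N1 = sigma_sets UNIV (range atMost)" "sets N2 = sigma_sets UNIV (range atMost)"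
        unfolding s1 s2 by (simp_all add: borel_eq_atMost)
      show "(\<Union>n. {..real n}) = UNIV" by (auto simp: real_arch_simple)
      show "emeasure N1 {..real i} \<noteq> \<infinity>" for i using e1[of "{..real i}"] by (auto simp: top_unique)
    qed (auto simp: eqs)
    then show "emeasure \<mu> {w \<in> space \<mu>. X w \<in> S \<and> Y w \<in> T} = (\<integral>\<^sup>+x\<in>S. emeasure (\<kappa> x) T \<partial>?P)"
      using N1[OF T] N2[OF T] by simp
  qed
  then show ?thesis using that by blast
qed


text \<open>With digits \<open>0\<close> and \<open>1\<close> in base \<open>3\<close> the tail of the expansion is at most half a unit of the last digit read, so no carry
interferes and the digits can be recovered by rounding down.\<close>

lemma ternary_digit:
  fixes c :: "nat \<Rightarrow> bool"
  shows "\<lfloor>3 ^ j * (\<Sum>i. of_bool (c i) / 3 ^ i :: real)\<rfloor> mod 3 = of_bool (c j)"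
    and "0 \<le> (\<Sum>i. of_bool (c i) / 3 ^ i :: real)" "(\<Sum>i. of_bool (c i) / 3 ^ i :: real) \<le> 2"
    and "summable (\<lambda>i. of_bool (c i) / 3 ^ i :: real)"
proof -
  let ?f = "\<lambda>i. of_bool (c i) / 3 ^ i :: real"
  have geo: "summable (\<lambda>i. (1/3) ^ i :: real)" by (rule summable_geometric) simp
  have le: "?f i \<le> (1/3) ^ i" for i by (simp add: power_divide)
  show sf: "summable ?f"
    by (rule summable_comparison_test'[OF geo, of 0]) (use le in auto)
  have gs: "(\<Sum>i. (1/3) ^ i :: real) = 3 / 2" by (subst suminf_geometric) auto
  show "0 \<le> suminf ?f" by (intro suminf_nonneg sf) auto
  have "suminf ?f \<le> (\<Sum>i. (1/3) ^ i)" by (intro suminf_le le sf geo)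
  then show "suminf ?f \<le> 2" using gs by simp
  \<comment> \<open>The integer whose ternary digits are the first \<open>k + 1\<close> digits.\<close>
  define I where "I = rec_nat (of_bool (c 0) :: int) (\<lambda>k a. 3 * a + of_bool (c (Suc k)))"
  have I0: "I 0 = of_bool (c 0)" and IS: "I (Suc k) = 3 * I k + of_bool (c (Suc k))" for k
    by (simp_all add: I_def)
  have Imod: "I k mod 3 = of_bool (c k)" for k
    by (cases k) (auto simp: I0 IS)
  have head: "3 ^ k * (\<Sum>i<Suc k. ?f i) = of_int (I k)" for k
  proof (induction k)
    case 0 then show ?case by (simp add: I0)
  next
    case (Suc k)
    have "3 ^ Suc k * (\<Sum>i<Suc (Suc k). ?f i) = 3 * (3 ^ k * (\<Sum>i<Suc k. ?f i)) + of_bool (c (Suc k))"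
      by (simp add: algebra_simps)
    then show ?case unfolding Suc IS by simp
  qed
  define t where "t = 3 ^ j * (\<Sum>i. ?f (i + Suc j))"
  have sft: "summable (\<lambda>i. ?f (i + Suc j))" using sf by (subst summable_iff_shift)
  have "0 \<le> t" unfolding t_def by (intro mult_nonneg_nonneg suminf_nonneg sft) auto
  have "t = (\<Sum>i. 3 ^ j * ?f (i + Suc j))" unfolding t_def by (rule suminf_mult[OF sft, symmetric])
  also have "\<dots> \<le> (\<Sum>i. (1/3) * (1/3) ^ i)"
    by (intro suminf_le summable_mult sft geo) (auto simp: power_add power_divide)
  also have "\<dots> = 1 / 2" by (subst suminf_mult[OF geo]) (simp add: gs)
  finally have "t < 1" by simp
  have "3 ^ j * suminf ?f = of_int (I j) + t"
    unfolding head[symmetric] t_def by (subst suminf_split_initial_segment[OF sf, of "Suc j"]) (simp add: algebra_simps)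
  then have "\<lfloor>3 ^ j * suminf ?f\<rfloor> = I j" using \<open>0 \<le> t\<close> \<open>t < 1\<close> by (simp add: floor_eq_iff)
  then show "\<lfloor>3 ^ j * suminf ?f\<rfloor> mod 3 = of_bool (c j)" by (simp add: Imod)
qed

text \<open>The real number \<open>\<phi> y\<close> records for each \<open>k\<close> and \<open>n\<close> whether \<open>y\<close> is within \<open>2\<^bsup>-k\<^esup>\<close> of the \<open>n\<close>-th point of a dense sequence. To
decode, take for each \<open>k\<close> the first such point and pass to the limit. This makes conditional laws of real random
variables sufficient.\<close>

lemma polish_measurable_retract_of_real:
  obtains \<phi> :: "'a::polish_space \<Rightarrow> real" and \<psi> where
    "\<phi> \<in> borel_measurable borel" "\<psi> \<in> borel \<rightarrow>\<^sub>M borel" "\<And>y. \<psi> (\<phi> y) = y" "\<And>y. 0 \<le> \<phi> y" "\<And>y. \<phi> y \<le> 2"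
proof -
  obtain D :: "'a set" where D: "countable D" "\<And>X. open X \<Longrightarrow> X \<noteq> {} \<Longrightarrow> \<exists>d\<in>D. d \<in> X"
    using countable_dense_setE by blast
  have "D \<noteq> {}" using D(2)[of UNIV] by auto
  define d where "d = from_nat_into D"
  have dense: "\<exists>n. dist y (d n) < e" if e: "e > 0" for y e
  proof -
    obtain z where "z \<in> D" "z \<in> ball y e" using D(2)[of "ball y e"] e by auto
    then show ?thesis unfolding d_def using from_nat_into_surj[OF D(1)] by (metis mem_ball)
  qed
  define c where "c y j = (case prod_decode j of (k, n) \<Rightarrow> dist y (d n) < (1/2) ^ k)" for y j
  define \<phi> where "\<phi> y = (\<Sum>j. of_bool (c y j) / 3 ^ j :: real)" for y
  define digit where "digit j r \<longleftrightarrow> \<lfloor>3 ^ j * r\<rfloor> mod 3 = (1::int)" for j and r :: real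
  have dig: "digit j (\<phi> y) = c y j" for j y
    unfolding digit_def \<phi>_def ternary_digit(1) by simp
  define a where "a k r = d (LEAST n. digit (prod_encode (k, n)) r)" for k r
  \<comment> \<open>Off the image of the encoding the decoded points need not converge; a constant keeps the limit measurable there.\<close>
  define u where "u k r = (if Cauchy (\<lambda>k. a k r) then a k r else d 0)" for k r
  define \<psi> where "\<psi> r = lim (\<lambda>k. u k r)" for r
  have [measurable]: "Measurable.pred borel (digit j)" for j
  proof -
    have "(\<lambda>r::real. \<lfloor>3 ^ j * r\<rfloor> mod 3) \<in> borel \<rightarrow>\<^sub>M count_space UNIV" by measurable
    then show ?thesis unfolding digit_def by measurable
  qed
  have am[measurable]: "a k \<in> borel_measurable borel" for k
    unfolding a_def by measurable
  have um[measurable]: "u k \<in> borel_measurable borel" for k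
    unfolding u_def by measurable
  show ?thesis
  proof (rule that[of \<phi> \<psi>])
    have [measurable]: "Measurable.pred borel (\<lambda>y. c y j)" for j
      unfolding c_def by (cases "prod_decode j") simp
    show "\<phi> \<in> borel_measurable borel" unfolding \<phi>_def by measurable
    show "\<psi> \<in> borel \<rightarrow>\<^sub>M borel"
    proof (rule borel_measurable_LIMSEQ_metric[OF um])
      fix r :: real
      have "convergent (\<lambda>k. u k r)"
      proof (cases "Cauchy (\<lambda>k. a k r)")
        case True
        then have "(\<lambda>k. u k r) = (\<lambda>k. a k r)" by (simp add: u_def)
        then show ?thesis using True by (simp add: Cauchy_convergent)
      next
        case False
        then have "(\<lambda>k. u k r) = (\<lambda>k. d 0)" by (simp add: u_def)
        then show ?thesis by (simp add: convergent_const)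
      qed
      then show "(\<lambda>k. u k r) \<longlonglongrightarrow> \<psi> r" unfolding \<psi>_def by (rule convergent_LIMSEQ_iff[THEN iffD1])
    qed
    show "0 \<le> \<phi> y" "\<phi> y \<le> 2" for y unfolding \<phi>_def by (rule ternary_digit)+
    fix y
    have near: "dist y (a k (\<phi> y)) < (1/2) ^ k" for k
    proof -
      have "\<exists>n. c y (prod_encode (k, n))" using dense[of "(1/2) ^ k" y] by (simp add: c_def)
      then have "c y (prod_encode (k, LEAST n. c y (prod_encode (k, n))))" by (rule LeastI_ex)
      then show ?thesis by (simp add: a_def dig) (simp add: c_def)
    qed
    have lim: "(\<lambda>k. a k (\<phi> y)) \<longlonglongrightarrow> y"
    proof (rule metric_tendsto_imp_tendsto[of "\<lambda>k. (1/2) ^ k :: real" 0])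
      show "(\<lambda>k. (1/2) ^ k :: real) \<longlonglongrightarrow> 0" by (rule LIMSEQ_power_zero) simp
      show "\<forall>\<^sub>F k in sequentially. dist (a k (\<phi> y)) y \<le> dist ((1/2) ^ k :: real) 0"
        using near by (auto intro!: always_eventually simp: dist_commute less_imp_le)
    qed
    then have "Cauchy (\<lambda>k. a k (\<phi> y))" by (rule LIMSEQ_imp_Cauchy)
    then have "(\<lambda>k. u k (\<phi> y)) = (\<lambda>k. a k (\<phi> y))" by (simp add: u_def)
    then show "\<psi> (\<phi> y) = y" unfolding \<psi>_def using limI[OF lim] by simp
  qed
qed

text \<open>Pushing the kernel of the encoded variable forward along the decoding map gives a kernel for the original one.\<close>

lemma regular_conditional_law_retract:
  assumes law: "regular_conditional_law \<mu> A X borel (\<lambda>w. \<phi> (Y w)) \<kappa>"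
    and Y: "Y \<in> \<mu> \<rightarrow>\<^sub>M B" and \<psi>: "\<psi> \<in> borel \<rightarrow>\<^sub>M B" and inv: "\<And>y. y \<in> space B \<Longrightarrow> \<psi> (\<phi> y) = y"
  shows "regular_conditional_law \<mu> A X B Y (\<lambda>x. distr (\<kappa> x) B \<psi>)"
  unfolding regular_conditional_law_def
proof (intro conjI ballI)
  have \<kappa>: "\<kappa> \<in> A \<rightarrow>\<^sub>M prob_algebra borel"
    and eq: "\<And>S T. S \<in> sets A \<Longrightarrow> T \<in> sets borel \<Longrightarrow> emeasure \<mu> {w \<in> space \<mu>. X w \<in> S \<and> \<phi> (Y w) \<in> T} =
        (\<integral>\<^sup>+x\<in>S. emeasure (\<kappa> x) T \<partial>distr \<mu> A X)"
    using law by (auto simp: regular_conditional_law_def)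
  show "(\<lambda>x. distr (\<kappa> x) B \<psi>) \<in> A \<rightarrow>\<^sub>M prob_algebra B"
    by (rule measurable_compose[OF \<kappa> measurable_distr_prob_space[OF \<psi>]])
  fix S T assume S: "S \<in> sets A" and T: "T \<in> sets B"
  have T': "\<psi> -` T \<in> sets borel" using measurable_sets[OF \<psi> T] by simp
  have "{w \<in> space \<mu>. X w \<in> S \<and> Y w \<in> T} = {w \<in> space \<mu>. X w \<in> S \<and> \<phi> (Y w) \<in> \<psi> -` T}"
    using inv measurable_space[OF Y] by auto
  moreover have "emeasure (distr (\<kappa> x) B \<psi>) T = emeasure (\<kappa> x) (\<psi> -` T)" if "x \<in> space A" for x
  proof -
    have s: "sets (\<kappa> x) = sets borel" using measurable_space[OF \<kappa> that] by (simp add: space_prob_algebra)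
    then have "\<psi> \<in> \<kappa> x \<rightarrow>\<^sub>M B" using \<psi> by (simp cong: measurable_cong_sets)
    then show ?thesis using T sets_eq_imp_space_eq[OF s] by (simp add: emeasure_distr)
  qed
  ultimately show "emeasure \<mu> {w \<in> space \<mu>. X w \<in> S \<and> Y w \<in> T} =
      (\<integral>\<^sup>+x\<in>S. emeasure (distr (\<kappa> x) B \<psi>) T \<partial>distr \<mu> A X)"
    using eq[OF S T'] by (auto intro!: nn_integral_cong)
qed

lemma continuous_map_power_inclusion:
  "continuous_map (power_topology n) euclidean (\<lambda>z. z :: nat \<Rightarrow> 'z::topological_space)"
proof -
  have "continuous_map (power_topology n) (product_topology (\<lambda>_. euclidean) UNIV) (\<lambda>z. z :: nat \<Rightarrow> 'z)"
    unfolding continuous_map_componentwise_UNIV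
  proof
    fix k
    show "continuous_map (power_topology n) euclidean (\<lambda>z. z k :: 'z)"
    proof (cases "k \<in> {1..n}")
      case True then show ?thesis by (rule continuous_map_coord)
    next
      case False
      show ?thesis
        by (rule continuous_map_eq[of _ _ "\<lambda>_. undefined"]) (use False in \<open>auto simp: extensional_def\<close>)
    qed
  qed
  then show ?thesis by (simp add: euclidean_product_topology)
qed

lemma continuous_map_restrict_power:
  "continuous_map euclidean (power_topology n) (\<lambda>z. restrict z {1..n} :: nat \<Rightarrow> 'z::topological_space)"
proof -
  have "continuous_map (product_topology (\<lambda>_. euclidean) UNIV) euclidean (\<lambda>z. z k :: 'z)" for k :: nat
    by (rule continuous_map_product_projection) simp
  then show ?thesis
    unfolding continuous_map_into_power euclidean_product_topology by simp
qed

lemma continuous_map_first_coords: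
  assumes "t \<le> N"
  shows "continuous_map (power_topology N) (power_topology t) (first_coords t :: (nat \<Rightarrow> 'z::topological_space) \<Rightarrow> _)"
  unfolding continuous_map_into_power first_coords_def
  using assms by (auto intro!: continuous_map_coord)

lemma continuous_map_last_coords:
  assumes "t \<le> N"
  shows "continuous_map (power_topology N) (power_topology (N - t)) (last_coords N t :: (nat \<Rightarrow> 'z::topological_space) \<Rightarrow> _)"
  unfolding continuous_map_into_power last_coords_def
  using assms by (auto intro!: continuous_map_coord)

text \<open>The choice operator in \<^const>\<open>conditional_law\<close> has something to choose from: the carrier of the power is a continuous
retract of the Polish space of all sequences, which is a measurable retract of the reals.\<close>

lemma conditional_law:
  fixes \<mu> :: "(nat \<Rightarrow> 'z::polish_space) measure"
  assumes \<mu>: "\<mu> \<in> prob_measures (power_topology N)" and t: "t \<le> N"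
  shows "regular_conditional_law \<mu> (borel_of (power_topology t)) (first_coords t)
                (borel_of (power_topology (N - t))) (last_coords N t) (conditional_law N t \<mu>)"
proof -
  note cong = measurable_cong_sets[OF prob_measuresD(2)[OF \<mu>] refl]
  have X: "first_coords t \<in> \<mu> \<rightarrow>\<^sub>M borel_of (power_topology t :: (nat \<Rightarrow> 'z) topology)"
    unfolding cong by (intro continuous_map_measurable continuous_map_first_coords t)
  have Y: "last_coords N t \<in> \<mu> \<rightarrow>\<^sub>M borel_of (power_topology (N - t) :: (nat \<Rightarrow> 'z) topology)"
    unfolding cong by (intro continuous_map_measurable continuous_map_last_coords t)
  obtain \<phi> :: "(nat \<Rightarrow> 'z) \<Rightarrow> real" and \<psi> where \<phi>: "\<phi> \<in> borel_measurable borel" and \<psi>: "\<psi> \<in> borel \<rightarrow>\<^sub>M borel"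
    and inv: "\<And>y. \<psi> (\<phi> y) = y" and r: "\<And>y. 0 \<le> \<phi> y" "\<And>y. \<phi> y \<le> 2"
    by (rule polish_measurable_retract_of_real) (rule that)
  have incl: "(\<lambda>z. z) \<in> borel_of (power_topology (N - t) :: (nat \<Rightarrow> 'z) topology) \<rightarrow>\<^sub>M borel"
    using continuous_map_measurable[OF continuous_map_power_inclusion] by (simp add: borel_of_euclidean)
  have restr: "(\<lambda>z. restrict z {1..N - t}) \<in> borel \<rightarrow>\<^sub>M borel_of (power_topology (N - t) :: (nat \<Rightarrow> 'z) topology)"
    using continuous_map_measurable[OF continuous_map_restrict_power] by (simp add: borel_of_euclidean)
  have m: "(\<lambda>w. \<phi> (last_coords N t w)) \<in> borel_measurable \<mu>"
    using measurable_compose[OF measurable_compose[OF Y incl] \<phi>] .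
  obtain \<kappa> where \<kappa>: "regular_conditional_law \<mu> (borel_of (power_topology t)) (first_coords t) borel
      (\<lambda>w. \<phi> (last_coords N t w)) \<kappa>"
    by (rule conditional_kernel_real[OF prob_measuresD(1)[OF \<mu>] X m r]) (rule that)
  have "regular_conditional_law \<mu> (borel_of (power_topology t)) (first_coords t)
                (borel_of (power_topology (N - t))) (last_coords N t)
     (\<lambda>x. distr (\<kappa> x) (borel_of (power_topology (N - t))) (\<lambda>r. restrict (\<psi> r) {1..N - t}))"
    by (rule regular_conditional_law_retract[OF \<kappa> Y measurable_compose[OF \<psi> restr]])
       (simp add: inv extensional_restrict)
  then show ?thesis unfolding conditional_law_def
    by (rule someI[where P="regular_conditional_law \<mu> (borel_of (power_topology t)) (first_coords t)
                (borel_of (power_topology (N - t))) (last_coords N t)"])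
qed

section \<open>The information map\<close>

lemma measurable_kernel_into_weak:
  assumes sep: "separating X C" and \<kappa>: "\<kappa> \<in> A \<rightarrow>\<^sub>M prob_algebra (borel_of X)"
  shows "\<kappa> \<in> A \<rightarrow>\<^sub>M borel_of (weak_topology X)"
proof (rule measurable_into_separated[OF separating_weak_topology[OF sep]])
  show "\<kappa> x \<in> topspace (weak_topology X)" if "x \<in> space A" for x
    using measurable_space[OF \<kappa> that] by simp
  have bump: "(\<lambda>x. b (\<kappa> x)) \<in> borel_measurable A" if "b \<in> weak_bumps C" for b
  proof -
    obtain g k q where b: "b = weak_bump g k q" and g: "g \<in> max_hull C"
      using \<open>b \<in> weak_bumps C\<close> by (auto simp: weak_bumps_def)
    have "g \<in> borel_measurable (borel_of X)"
      using Cb_max_hull[OF g, of X] separatingD(2)[OF sep] by (intro Cb_measurable) auto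
    from measurable_compose[OF measurable_prob_algebraD[OF \<kappa>] integral_measurable_subprob_algebra[OF this]]
    have [measurable]: "(\<lambda>x. \<integral>y. g y \<partial>\<kappa> x) \<in> borel_measurable A" .
    show ?thesis unfolding b weak_bump_def by measurable
  qed
  fix c assume "c \<in> weak_family C"
  then obtain cs where c: "c = list_min cs" "set cs \<subseteq> weak_bumps C" by (auto simp: weak_family_def)
  have "(\<lambda>x. list_min cs (\<kappa> x)) \<in> borel_measurable A" using c(2)
  proof (induction cs)
    case (Cons b cs)
    have [measurable]: "(\<lambda>x. b (\<kappa> x)) \<in> borel_measurable A" "(\<lambda>x. list_min cs (\<kappa> x)) \<in> borel_measurable A"
      using Cons bump by auto
    show ?case by simp
  qed simp
  then show "(\<lambda>x. c (\<kappa> x)) \<in> borel_measurable A" using c(1) by simp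
qed

abbreviation info_space :: "nat \<Rightarrow> nat \<Rightarrow> ((nat \<Rightarrow> 'z::topological_space) \<times> (nat \<Rightarrow> 'z) measure) topology" where
  "info_space N t \<equiv> prod_topology (power_topology t) (weak_topology (power_topology (N - t)))"

text \<open>The random variable whose law is \<^const>\<open>information_map\<close>.\<close>

definition info_pair :: "nat \<Rightarrow> nat \<Rightarrow> (nat \<Rightarrow> 'z::topological_space) measure \<Rightarrow> (nat \<Rightarrow> 'z) \<Rightarrow> (nat \<Rightarrow> 'z) \<times> (nat \<Rightarrow> 'z) measure" where
  "info_pair N t \<mu> z = (first_coords t z, conditional_law N t \<mu> (first_coords t z))"

lemma info_pair_simps [simp]:
  "fst (info_pair N t \<mu> z) = first_coords t z"
  "snd (info_pair N t \<mu> z) = conditional_law N t \<mu> (first_coords t z)"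
  by (simp_all add: info_pair_def)

lemmas separating_weak_power = separating_weak_topology[OF separating_power]

lemmas separating_info_space = separating_prod[OF separating_power separating_weak_power]

lemma first_coords_ext: "first_coords t z \<in> extensional {1..t}"
  by (simp add: first_coords_def)

lemma last_coords_ext: "last_coords N t z \<in> extensional {1..N - t}"
  by (simp add: last_coords_def)

lemmas [simp] = first_coords_ext[simplified] last_coords_ext[simplified]

context
  fixes N t :: nat and \<mu> :: "(nat \<Rightarrow> 'z::polish_space) measure"
  assumes \<mu>: "\<mu> \<in> prob_measures (power_topology N)" and t: "t \<le> N"
begin

lemma measurable_first_coords: "first_coords t \<in> \<mu> \<rightarrow>\<^sub>M borel_of (power_topology t)"
  unfolding measurable_cong_sets[OF prob_measuresD(2)[OF \<mu>] refl]
  by (intro continuous_map_measurable continuous_map_first_coords t)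

lemma measurable_last_coords: "last_coords N t \<in> \<mu> \<rightarrow>\<^sub>M borel_of (power_topology (N - t))"
  unfolding measurable_cong_sets[OF prob_measuresD(2)[OF \<mu>] refl]
  by (intro continuous_map_measurable continuous_map_last_coords t)

lemma measurable_conditional_law:
  "conditional_law N t \<mu> \<in> borel_of (power_topology t) \<rightarrow>\<^sub>M prob_algebra (borel_of (power_topology (N - t)))"
  using conditional_law[OF \<mu> t] by (simp add: regular_conditional_law_def)

lemma conditional_law_prob:
  "x \<in> extensional {1..t} \<Longrightarrow> conditional_law N t \<mu> x \<in> prob_measures (power_topology (N - t))"
  using measurable_space[OF measurable_conditional_law, of x] by simp

lemma measurable_info_pair: "info_pair N t \<mu> \<in> \<mu> \<rightarrow>\<^sub>M borel_of (info_space N t)"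
  unfolding info_pair_def[abs_def]
  by (intro measurable_Pair_borel_of[OF separating_power separating_weak_power] measurable_first_coords
      measurable_compose[OF measurable_first_coords] measurable_kernel_into_weak[OF separating_power]
      measurable_conditional_law)

lemma information_map_eq: "information_map N t \<mu> = distr \<mu> (borel_of (info_space N t)) (info_pair N t \<mu>)"
  by (simp add: information_map_def info_pair_def[abs_def])

lemma information_map_prob: "information_map N t \<mu> \<in> prob_measures (info_space N t)"
  unfolding information_map_eq
  by (intro prob_measuresI prob_space.prob_space_distr prob_measuresD(1)[OF \<mu>] measurable_info_pair) simp

lemma integral_information_map:
  "G \<in> Cb (info_space N t) \<Longrightarrow> (\<integral>p. G p \<partial>information_map N t \<mu>) = (\<integral>z. G (info_pair N t \<mu> z) \<partial>\<mu>)"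
  unfolding information_map_eq by (intro integral_distr measurable_info_pair Cb_measurable)

lemma Cb_info_pair_integrable:
  assumes "G \<in> Cb (info_space N t)"
  shows "integrable \<mu> (\<lambda>z. G (info_pair N t \<mu> z))"
proof -
  have "integrable (information_map N t \<mu>) G" by (rule Cb_integrable[OF assms information_map_prob])
  then show ?thesis unfolding information_map_eq
    by (subst (asm) integrable_distr_eq) (auto intro: measurable_info_pair Cb_measurable assms)
qed

text \<open>The defining identity of a regular conditional law concerns rectangles; these form a generator that is stable under
intersections.\<close>

lemma joint_law_eq_kernel:
  "distr \<mu> (borel_of (power_topology t) \<Otimes>\<^sub>M borel_of (power_topology (N - t))) (\<lambda>z. (first_coords t z, last_coords N t z)) =
   distr \<mu> (borel_of (power_topology t)) (first_coords t) \<bind>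
     (\<lambda>x. distr (conditional_law N t \<mu> x) (borel_of (power_topology t) \<Otimes>\<^sub>M borel_of (power_topology (N - t))) (Pair x))"
  (is "?Q1 = Giry_Monad.bind ?P ?k")
proof -
  let ?A = "borel_of (power_topology t :: (nat \<Rightarrow> 'z) topology)" and ?B = "borel_of (power_topology (N - t) :: (nat \<Rightarrow> 'z) topology)"
  let ?\<kappa> = "conditional_law N t \<mu>"
  interpret prob_space \<mu> by (rule prob_measuresD(1)[OF \<mu>])
  note [measurable] = measurable_first_coords measurable_last_coords measurable_prob_algebraD[OF measurable_conditional_law]
  interpret Q1: prob_space ?Q1 by (rule prob_space_distr) measurable
  interpret P: prob_space ?P by (rule prob_space_distr) measurable
  have k: "?k \<in> ?A \<rightarrow>\<^sub>M subprob_algebra (?A \<Otimes>\<^sub>M ?B)"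
    by (rule measurable_distr2[where M="?B"]) measurable
  then have k': "?k \<in> ?P \<rightarrow>\<^sub>M subprob_algebra (?A \<Otimes>\<^sub>M ?B)" by simp
  have s2: "sets (?P \<bind> ?k) = sets (?A \<Otimes>\<^sub>M ?B)"
    by (rule sets_bind[OF sets_kernel[OF k'] P.not_empty])
  show ?thesis
  proof (rule measure_eqI_generator_eq[OF Int_stable_pair_measure_generator, where \<Omega>="space ?A \<times> space ?B" and A="\<lambda>_. space ?A \<times> space ?B"])
    show "{a \<times> b |a b. a \<in> sets ?A \<and> b \<in> sets ?B} \<subseteq> Pow (space ?A \<times> space ?B)"
      using sets.sets_into_space by fastforce
    show "sets ?Q1 = sigma_sets (space ?A \<times> space ?B) {a \<times> b |a b. a \<in> sets ?A \<and> b \<in> sets ?B}"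
      "sets (?P \<bind> ?k) = sigma_sets (space ?A \<times> space ?B) {a \<times> b |a b. a \<in> sets ?A \<and> b \<in> sets ?B}"
      unfolding s2 by (simp_all add: sets_pair_measure)
    show "range (\<lambda>_. space ?A \<times> space ?B) \<subseteq> {a \<times> b |a b. a \<in> sets ?A \<and> b \<in> sets ?B}" by blast
    show "\<And>i. emeasure ?Q1 (space ?A \<times> space ?B) \<noteq> \<infinity>" using Q1.emeasure_finite by simp
    fix R assume "R \<in> {a \<times> b |a b. a \<in> sets ?A \<and> b \<in> sets ?B}"
    then obtain S T where R: "R = S \<times> T" and [measurable]: "S \<in> sets ?A" "T \<in> sets ?B" by auto
    have "emeasure ?Q1 R = emeasure \<mu> {z \<in> space \<mu>. first_coords t z \<in> S \<and> last_coords N t z \<in> T}"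
      unfolding R by (subst emeasure_distr) (auto intro!: arg_cong[of _ _ "emeasure \<mu>"])
    also have "\<dots> = (\<integral>\<^sup>+x\<in>S. emeasure (?\<kappa> x) T \<partial>?P)"
      using conditional_law[OF \<mu> t] by (simp add: regular_conditional_law_def)
    also have "\<dots> = (\<integral>\<^sup>+x. emeasure (?k x) R \<partial>?P)"
    proof (intro nn_integral_cong)
      fix x assume "x \<in> space ?P"
      then have x: "x \<in> space ?A" by simp
      have s: "sets (?\<kappa> x) = sets ?B" using measurable_space[OF measurable_conditional_law x] by (simp add: space_prob_algebra)
      have "emeasure (?k x) R = emeasure (?\<kappa> x) (Pair x -` R \<inter> space (?\<kappa> x))"
        unfolding R by (rule emeasure_distr) (use x s in \<open>auto cong: measurable_cong_sets\<close>)
      also have "Pair x -` R \<inter> space (?\<kappa> x) = (if x \<in> S then T else {})"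
        using sets.sets_into_space[OF \<open>T \<in> sets ?B\<close>] sets_eq_imp_space_eq[OF s] by (auto simp: R)
      finally show "emeasure (?\<kappa> x) T * indicator S x = emeasure (?k x) R" by (auto split: split_indicator)
    qed
    also have "\<dots> = emeasure (?P \<bind> ?k) R"
      by (rule emeasure_bind[OF P.not_empty k', symmetric]) (simp add: R)
    finally show "emeasure ?Q1 R = emeasure (?P \<bind> ?k) R" .
  qed auto
qed

lemma nn_integral_conditional_law:
  assumes h: "h \<in> borel_measurable (borel_of (power_topology t) \<Otimes>\<^sub>M borel_of (power_topology (N - t)))"
  shows "(\<integral>\<^sup>+z. \<integral>\<^sup>+y. h (first_coords t z, y) \<partial>conditional_law N t \<mu> (first_coords t z) \<partial>\<mu>) =
         (\<integral>\<^sup>+z. h (first_coords t z, last_coords N t z) \<partial>\<mu>)"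
proof -
  let ?A = "borel_of (power_topology t :: (nat \<Rightarrow> 'z) topology)" and ?B = "borel_of (power_topology (N - t) :: (nat \<Rightarrow> 'z) topology)"
  let ?\<kappa> = "conditional_law N t \<mu>"
  note [measurable] = measurable_first_coords measurable_last_coords measurable_prob_algebraD[OF measurable_conditional_law] h
  let ?P = "distr \<mu> ?A (first_coords t)"
  let ?k = "\<lambda>x. distr (conditional_law N t \<mu> x) (?A \<Otimes>\<^sub>M ?B) (Pair x)"
  have k: "?k \<in> ?A \<rightarrow>\<^sub>M subprob_algebra (?A \<Otimes>\<^sub>M ?B)"
    by (rule measurable_distr2[where M="?B"]) measurable
  then have k': "?k \<in> ?P \<rightarrow>\<^sub>M subprob_algebra (?A \<Otimes>\<^sub>M ?B)" by simp
  have m: "(\<lambda>x. \<integral>\<^sup>+y. h (x, y) \<partial>?\<kappa> x) \<in> borel_measurable ?A"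
    by (rule nn_integral_measurable_subprob_algebra2[where N="?B"]) (auto simp: h intro: measurable_prob_algebraD measurable_conditional_law)
  have "(\<integral>\<^sup>+z. h (first_coords t z, last_coords N t z) \<partial>\<mu>) =
      (\<integral>\<^sup>+p. h p \<partial>distr \<mu> (?A \<Otimes>\<^sub>M ?B) (\<lambda>z. (first_coords t z, last_coords N t z)))"
    by (subst nn_integral_distr) auto
  also have "\<dots> = (\<integral>\<^sup>+x. \<integral>\<^sup>+p. h p \<partial>?k x \<partial>?P)"
    unfolding joint_law_eq_kernel by (rule nn_integral_bind[OF h k'])
  also have "\<dots> = (\<integral>\<^sup>+x. \<integral>\<^sup>+y. h (x, y) \<partial>?\<kappa> x \<partial>?P)"
  proof (intro nn_integral_cong)
    fix x assume "x \<in> space ?P"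
    then have x: "x \<in> space ?A" by simp
    have s: "sets (?\<kappa> x) = sets ?B" using measurable_space[OF measurable_conditional_law x] by (simp add: space_prob_algebra)
    show "(\<integral>\<^sup>+p. h p \<partial>?k x) = (\<integral>\<^sup>+y. h (x, y) \<partial>?\<kappa> x)"
      by (rule nn_integral_distr) (use x s h in \<open>auto cong: measurable_cong_sets\<close>)
  qed
  also have "\<dots> = (\<integral>\<^sup>+z. \<integral>\<^sup>+y. h (first_coords t z, y) \<partial>?\<kappa> (first_coords t z) \<partial>\<mu>)"
    by (rule nn_integral_distr) (use m in auto)
  finally show ?thesis ..
qed

text \<open>The tower property for bounded continuous \<open>h\<close>, reduced to the nonnegative case by adding a bound of \<open>|h|\<close>.\<close>

lemma integral_conditional_law:
  fixes h :: "(nat \<Rightarrow> 'z) \<times> (nat \<Rightarrow> 'z) \<Rightarrow> real"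
  assumes h: "h \<in> Cb (prod_topology (power_topology t) (power_topology (N - t)))"
  shows "(\<integral>z. (\<integral>y. h (first_coords t z, y) \<partial>conditional_law N t \<mu> (first_coords t z)) \<partial>\<mu>) =
         (\<integral>z. h (first_coords t z, last_coords N t z) \<partial>\<mu>)"
    and "integrable \<mu> (\<lambda>z. \<integral>y. h (first_coords t z, y) \<partial>conditional_law N t \<mu> (first_coords t z))"
    and "integrable \<mu> (\<lambda>z. h (first_coords t z, last_coords N t z))"
proof -
  let ?A = "borel_of (power_topology t :: (nat \<Rightarrow> 'z) topology)" and ?B = "borel_of (power_topology (N - t) :: (nat \<Rightarrow> 'z) topology)"
  let ?\<kappa> = "conditional_law N t \<mu>"
  interpret prob_space \<mu> by (rule prob_measuresD(1)[OF \<mu>])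
  note [measurable] = measurable_first_coords measurable_last_coords measurable_prob_algebraD[OF measurable_conditional_law]
  obtain M where M: "M \<ge> 0" "\<And>p. p \<in> extensional {1..t} \<times> extensional {1..N - t} \<Longrightarrow> \<bar>h p\<bar> \<le> M"
    using CbE[OF h] by (metis topspace_prod_topology topspace_power)
  have hm[measurable]: "h \<in> borel_measurable (?A \<Otimes>\<^sub>M ?B)"
    using Cb_measurable[OF h] by (simp cong: measurable_cong_sets add: sets_borel_of_prod[OF separating_power separating_power])
  have km: "(\<lambda>x. \<integral>y. h (x, y) \<partial>?\<kappa> x) \<in> borel_measurable ?A"
  proof -
    let ?k = "\<lambda>x. distr (?\<kappa> x) (?A \<Otimes>\<^sub>M ?B) (Pair x)"
    have k: "?k \<in> ?A \<rightarrow>\<^sub>M subprob_algebra (?A \<Otimes>\<^sub>M ?B)"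
      by (rule measurable_distr2[where M="?B"]) measurable
    have eq: "(\<integral>p. h p \<partial>?k x) = (\<integral>y. h (x, y) \<partial>?\<kappa> x)" if x: "x \<in> space ?A" for x
    proof -
      have s: "sets (?\<kappa> x) = sets ?B" using measurable_space[OF measurable_conditional_law x] by (simp add: space_prob_algebra)
      show ?thesis by (rule integral_distr) (use x s hm in \<open>auto cong: measurable_cong_sets\<close>)
    qed
    show ?thesis
      using measurable_compose[OF k integral_measurable_subprob_algebra[OF hm]]
      by (subst measurable_cong[OF eq[symmetric]])
  qed
  have ky: "integrable (?\<kappa> x) (\<lambda>y. h (x, y))" "\<bar>\<integral>y. h (x, y) \<partial>?\<kappa> x\<bar> \<le> M" if x: "x \<in> extensional {1..t}" for x
  proof -
    have kp: "?\<kappa> x \<in> prob_measures (power_topology (N - t))" by (rule conditional_law_prob[OF x])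
    interpret K: prob_space "?\<kappa> x" by (rule prob_measuresD(1)[OF kp])
    have sp: "space (?\<kappa> x) = extensional {1..N - t}" using prob_measuresD(3)[OF kp] by simp
    have m: "(\<lambda>y. h (x, y)) \<in> borel_measurable (?\<kappa> x)"
      using hm x prob_measuresD(2)[OF kp] by (auto cong: measurable_cong_sets)
    show i: "integrable (?\<kappa> x) (\<lambda>y. h (x, y))"
      by (rule K.integrable_const_bound[of _ M]) (use m M(2) x sp in auto)
    have "\<bar>\<integral>y. h (x, y) \<partial>?\<kappa> x\<bar> \<le> (\<integral>y. \<bar>h (x, y)\<bar> \<partial>?\<kappa> x)" by (rule integral_abs_bound)
    also have "\<dots> \<le> (\<integral>y. M \<partial>?\<kappa> x)" using i M(2) x sp by (intro integral_mono) auto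
    finally show "\<bar>\<integral>y. h (x, y) \<partial>?\<kappa> x\<bar> \<le> M" by (simp add: K.prob_space)
  qed
  show i1: "integrable \<mu> (\<lambda>z. \<integral>y. h (first_coords t z, y) \<partial>?\<kappa> (first_coords t z))"
    by (rule integrable_const_bound[of _ M]) (use ky(2) measurable_compose[OF measurable_first_coords km] in auto)
  show i2: "integrable \<mu> (\<lambda>z. h (first_coords t z, last_coords N t z))"
    by (rule integrable_const_bound[of _ M]) (use M(2) in auto)
  let ?h = "\<lambda>p. ennreal (M + h p)"
  have nn: "0 \<le> M + h (x, y)" if "x \<in> extensional {1..t}" "y \<in> extensional {1..N - t}" for x y
    using M(2)[of "(x, y)"] that by simp
  have nnk: "0 \<le> M + (\<integral>y. h (first_coords t z, y) \<partial>?\<kappa> (first_coords t z))" for z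
    using ky(2)[OF first_coords_ext, of z] by linarith
  have "ennreal (\<integral>z. M + (\<integral>y. h (first_coords t z, y) \<partial>?\<kappa> (first_coords t z)) \<partial>\<mu>) =
      (\<integral>\<^sup>+z. ennreal (M + (\<integral>y. h (first_coords t z, y) \<partial>?\<kappa> (first_coords t z))) \<partial>\<mu>)"
    using i1 by (intro nn_integral_eq_integral[symmetric] AE_I2 nnk) auto
  also have "\<dots> = (\<integral>\<^sup>+z. \<integral>\<^sup>+y. ?h (first_coords t z, y) \<partial>?\<kappa> (first_coords t z) \<partial>\<mu>)"
  proof (intro nn_integral_cong)
    fix z :: "nat \<Rightarrow> 'z"
    let ?x = "first_coords t z"
    have kp: "?\<kappa> ?x \<in> prob_measures (power_topology (N - t))" by (rule conditional_law_prob[OF first_coords_ext])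
    interpret K: prob_space "?\<kappa> ?x" by (rule prob_measuresD(1)[OF kp])
    have "(\<integral>\<^sup>+y. ?h (?x, y) \<partial>?\<kappa> ?x) = ennreal (\<integral>y. M + h (?x, y) \<partial>?\<kappa> ?x)"
      using ky(1)[OF first_coords_ext, of z] prob_measuresD(3)[OF kp]
      by (intro nn_integral_eq_integral AE_I2 nn) auto
    also have "(\<integral>y. M + h (?x, y) \<partial>?\<kappa> ?x) = M + (\<integral>y. h (?x, y) \<partial>?\<kappa> ?x)"
      using ky(1)[OF first_coords_ext, of z] by (simp add: K.prob_space)
    finally show "ennreal (M + (\<integral>y. h (?x, y) \<partial>?\<kappa> ?x)) = (\<integral>\<^sup>+y. ?h (?x, y) \<partial>?\<kappa> ?x)" ..
  qed
  also have "\<dots> = (\<integral>\<^sup>+z. ?h (first_coords t z, last_coords N t z) \<partial>\<mu>)"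
    by (rule nn_integral_conditional_law) measurable
  also have "\<dots> = ennreal (\<integral>z. M + h (first_coords t z, last_coords N t z) \<partial>\<mu>)"
    using i2 by (intro nn_integral_eq_integral AE_I2 nn first_coords_ext last_coords_ext) auto
  finally have "ennreal (\<integral>z. M + (\<integral>y. h (first_coords t z, y) \<partial>?\<kappa> (first_coords t z)) \<partial>\<mu>) =
    ennreal (\<integral>z. M + h (first_coords t z, last_coords N t z) \<partial>\<mu>)" .
  moreover have "0 \<le> (\<integral>z. M + (\<integral>y. h (first_coords t z, y) \<partial>?\<kappa> (first_coords t z)) \<partial>\<mu>)"
    by (intro integral_nonneg_AE AE_I2 nnk)
  moreover have "0 \<le> (\<integral>z. M + h (first_coords t z, last_coords N t z) \<partial>\<mu>)"
    by (intro integral_nonneg_AE AE_I2 nn first_coords_ext last_coords_ext)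
  ultimately show "(\<integral>z. (\<integral>y. h (first_coords t z, y) \<partial>?\<kappa> (first_coords t z)) \<partial>\<mu>) =
      (\<integral>z. h (first_coords t z, last_coords N t z) \<partial>\<mu>)"
    using i1 i2 by (simp add: prob_space)
qed

end

section \<open>Density of Lipschitz functions\<close>

text \<open>Indicators of open sets are increasing limits of Lipschitz functions. The sets with approximable indicator are
closed under complements and countable unions, hence include all Borel sets, and approximability extends to
linear combinations and limits in mean.\<close>

lemma lipschitz_dense_L1:
  fixes \<mu> :: "(nat \<Rightarrow> 'z::polish_space) measure"
  assumes bd: "bounded (UNIV :: 'z set)" and \<mu>: "\<mu> \<in> prob_measures (power_topology n)" and p: "integrable \<mu> p"
    and "\<epsilon> > 0"
  obtains L g where "sd_lipschitz n L g" "(\<integral>x. \<bar>p x - g x\<bar> \<partial>\<mu>) < \<epsilon>"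
proof -
  interpret prob_space \<mu> by (rule prob_measuresD(1)[OF \<mu>])
  \<comment> \<open>Approximability in mean; the four closure properties below carry the induction over Borel sets and integrable functions.\<close>
  define app where "app p \<longleftrightarrow> (\<forall>\<epsilon>>0. \<exists>L g. sd_lipschitz n L g \<and> (\<integral>x. \<bar>p x - g x\<bar> \<partial>\<mu>) < \<epsilon>)" for p :: "(nat \<Rightarrow> 'z) \<Rightarrow> real"
  have gi: "integrable \<mu> g" if "sd_lipschitz n L g" for L g
    by (rule Cb_integrable[OF Cb_sd_lipschitz[OF bd that] \<mu>])
  have app_lim: "app p" if ip: "integrable \<mu> p" and isn: "\<And>n. integrable \<mu> (s n)" and as: "\<And>n. app (s n)"
    and lim: "(\<lambda>n. \<integral>x. \<bar>p x - s n x\<bar> \<partial>\<mu>) \<longlonglongrightarrow> 0" for p s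
    unfolding app_def
  proof (intro allI impI)
    fix \<epsilon> :: real assume "\<epsilon> > 0"
    then obtain m where m: "(\<integral>x. \<bar>p x - s m x\<bar> \<partial>\<mu>) < \<epsilon> / 2"
      using order_tendstoD(2)[OF lim, of "\<epsilon> / 2"] by (auto simp: eventually_sequentially)
    obtain L g where g: "sd_lipschitz n L g" "(\<integral>x. \<bar>s m x - g x\<bar> \<partial>\<mu>) < \<epsilon> / 2"
      using as[of m] \<open>\<epsilon> > 0\<close> unfolding app_def by (metis half_gt_zero)
    have "(\<integral>x. \<bar>p x - g x\<bar> \<partial>\<mu>) \<le> (\<integral>x. \<bar>p x - s m x\<bar> + \<bar>s m x - g x\<bar> \<partial>\<mu>)"
      using gi[OF g(1)] ip isn by (intro integral_mono) auto
    also have "\<dots> = (\<integral>x. \<bar>p x - s m x\<bar> \<partial>\<mu>) + (\<integral>x. \<bar>s m x - g x\<bar> \<partial>\<mu>)"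
      using gi[OF g(1)] ip isn by (intro Bochner_Integration.integral_add) auto
    finally show "\<exists>L g. sd_lipschitz n L g \<and> (\<integral>x. \<bar>p x - g x\<bar> \<partial>\<mu>) < \<epsilon>" using m g by (intro exI[of _ L] exI[of _ g]) auto
  qed
  have app_add: "app (\<lambda>x. p x + q x)" if ip: "integrable \<mu> p" and iq: "integrable \<mu> q" and ap: "app p" and aq: "app q" for p q
    unfolding app_def
  proof (intro allI impI)
    fix \<epsilon> :: real assume "\<epsilon> > 0"
    obtain L g where g: "sd_lipschitz n L g" "(\<integral>x. \<bar>p x - g x\<bar> \<partial>\<mu>) < \<epsilon> / 2"
      using ap \<open>\<epsilon> > 0\<close> unfolding app_def by (metis half_gt_zero)
    obtain M h where h: "sd_lipschitz n M h" "(\<integral>x. \<bar>q x - h x\<bar> \<partial>\<mu>) < \<epsilon> / 2"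
      using aq \<open>\<epsilon> > 0\<close> unfolding app_def by (metis half_gt_zero)
    have "(\<integral>x. \<bar>p x + q x - (g x + h x)\<bar> \<partial>\<mu>) \<le> (\<integral>x. \<bar>p x - g x\<bar> + \<bar>q x - h x\<bar> \<partial>\<mu>)"
      using gi[OF g(1)] gi[OF h(1)] ip iq by (intro integral_mono) auto
    also have "\<dots> = (\<integral>x. \<bar>p x - g x\<bar> \<partial>\<mu>) + (\<integral>x. \<bar>q x - h x\<bar> \<partial>\<mu>)"
      using gi[OF g(1)] gi[OF h(1)] ip iq by (intro Bochner_Integration.integral_add) auto
    finally show "\<exists>L g. sd_lipschitz n L g \<and> (\<integral>x. \<bar>p x + q x - g x\<bar> \<partial>\<mu>) < \<epsilon>"
      using g h by (intro exI[of _ "L + M"] exI[of _ "\<lambda>x. g x + h x"]) (auto intro: sd_lipschitz_add)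
  qed
  have app_cmult: "app (\<lambda>x. c * p x)" if ap: "app p" for c p
    unfolding app_def
  proof (intro allI impI)
    fix \<epsilon> :: real assume "\<epsilon> > 0"
    define e where "e = \<epsilon> / (\<bar>c\<bar> + 1)"
    have e: "e > 0" "\<bar>c\<bar> * e < \<epsilon>" using \<open>\<epsilon> > 0\<close> by (auto simp: e_def field_simps add_pos_nonneg)
    obtain L g where g: "sd_lipschitz n L g" "(\<integral>x. \<bar>p x - g x\<bar> \<partial>\<mu>) < e"
      using ap e unfolding app_def by metis
    have "(\<integral>x. \<bar>c * p x - c * g x\<bar> \<partial>\<mu>) = \<bar>c\<bar> * (\<integral>x. \<bar>p x - g x\<bar> \<partial>\<mu>)"
      by (simp add: right_diff_distrib[symmetric] abs_mult)
    also have "\<dots> \<le> \<bar>c\<bar> * e" using g by (intro mult_left_mono) auto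
    also have "\<dots> < \<epsilon>" by (rule e)
    finally show "\<exists>L g. sd_lipschitz n L g \<and> (\<integral>x. \<bar>c * p x - g x\<bar> \<partial>\<mu>) < \<epsilon>"
      using sd_lipschitz_cmult[OF g(1), of c] by blast
  qed
  have app_lip: "app g" if "sd_lipschitz n L g" for L g
    unfolding app_def using that by (auto intro!: exI[of _ L] exI[of _ g])
  have app_set: "app (indicator A)" if "A \<in> sigma_sets (topspace (power_topology n)) {U. openin (power_topology n) U}" for A :: "(nat \<Rightarrow> 'z) set"
    using that
  proof induction
    case (Basic U)
    then have U: "openin (power_topology n) U" by simp
    have lsc: "openin (power_topology n) {x \<in> topspace (power_topology n). q < indicat_real U x}" for q
    proof -
      consider "q < 0" | "0 \<le> q" "q < 1" | "1 \<le> q" by linarith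
      then show ?thesis
      proof cases
        case 1
        then have "{x \<in> topspace (power_topology n). q < indicat_real U x} = topspace (power_topology n)"
          by (auto split: split_indicator)
        then show ?thesis by (metis openin_topspace)
      next
        case 2
        then have "{x \<in> topspace (power_topology n). q < indicat_real U x} = U"
          using openin_subset[OF U] by (auto split: split_indicator_asm)
        then show ?thesis using U by simp
      next
        case 3
        then have "{x \<in> topspace (power_topology n). q < indicat_real U x} = {}"
          by (auto split: split_indicator)
        then show ?thesis by (metis openin_empty)
      qed
    qed
    have nn: "0 \<le> indicat_real U x" for x by simp
    obtain s where s: "\<And>k. s k \<in> max_hull (power_family n)"
      "\<And>k x. x \<in> topspace (power_topology n) \<Longrightarrow> 0 \<le> s k x \<and> s k x \<le> indicator U x"
      "\<And>x. x \<in> topspace (power_topology n) \<Longrightarrow> (\<lambda>k. s k x) \<longlonglongrightarrow> indicator U x"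
      by (rule max_hull_increasing_limit_lsc[OF separating_power lsc nn]) (rule that)
    obtain Lf where Lf: "\<And>k. sd_lipschitz n (Lf k) (s k)" using max_hull_power_lipschitz[OF s(1)] by metis
    have Ui: "integrable \<mu> (indicat_real U)"
      using openin_sets_borel_of[OF U] prob_measuresD(2)[OF \<mu>] by (intro integrable_real_indicator) (auto simp: emeasure_eq_measure)
    show ?case
    proof (rule app_lim[of _ s])
      show "integrable \<mu> (indicat_real U)" by (rule Ui)
      show "integrable \<mu> (s k)" for k by (rule gi[OF Lf])
      show "app (s k)" for k by (rule app_lip[OF Lf])
      have "(\<lambda>k. \<integral>x. \<bar>indicator U x - s k x\<bar> \<partial>\<mu>) \<longlonglongrightarrow> (\<integral>x. \<bar>indicator U x - indicat_real U x\<bar> \<partial>\<mu>)"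
      proof (rule integral_dominated_convergence[where w="\<lambda>_. 1"])
        show "(\<lambda>x. \<bar>indicator U x - s k x\<bar>) \<in> borel_measurable \<mu>" for k
          using borel_measurable_integrable[OF Ui] borel_measurable_integrable[OF gi[OF Lf]] by measurable
        show "AE x in \<mu>. (\<lambda>k. \<bar>indicator U x - s k x\<bar>) \<longlonglongrightarrow> \<bar>indicator U x - indicator U x\<bar>"
          by (intro AE_I2 tendsto_intros s(3)) (simp add: prob_measuresD(3)[OF \<mu>])
        show "AE x in \<mu>. norm \<bar>indicat_real U x - s k x\<bar> \<le> 1" for k
        proof (intro AE_I2)
          fix x assume "x \<in> space \<mu>"
          then have "0 \<le> s k x \<and> s k x \<le> indicator U x" by (intro s(2)) (simp add: prob_measuresD(3)[OF \<mu>])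
          then show "norm \<bar>indicat_real U x - s k x\<bar> \<le> 1" by (auto split: split_indicator_asm)
        qed
      qed auto
      then show "(\<lambda>k. \<integral>x. \<bar>indicator U x - s k x\<bar> \<partial>\<mu>) \<longlonglongrightarrow> 0" by simp
    qed
  next
    case Empty
    have "indicat_real {} = (\<lambda>x::nat \<Rightarrow> 'z. 0)" by auto
    then show ?case using app_lip[OF sd_lipschitz_const[of n 0]] by simp
  next
    case (Compl A)
    show ?case unfolding app_def
    proof (intro allI impI)
      fix \<epsilon> :: real assume "\<epsilon> > 0"
      then obtain L g where g: "sd_lipschitz n L g" "(\<integral>x. \<bar>indicator A x - g x\<bar> \<partial>\<mu>) < \<epsilon>"
        using Compl.IH unfolding app_def by metis
      have "(\<integral>x. \<bar>indicator (topspace (power_topology n) - A) x - (1 - g x)\<bar> \<partial>\<mu>) = (\<integral>x. \<bar>indicator A x - g x\<bar> \<partial>\<mu>)"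
        by (intro Bochner_Integration.integral_cong) (auto simp: prob_measuresD(3)[OF \<mu>] split: split_indicator)
      then show "\<exists>L g. sd_lipschitz n L g \<and> (\<integral>x. \<bar>indicator (topspace (power_topology n) - A) x - g x\<bar> \<partial>\<mu>) < \<epsilon>"
        using sd_lipschitz_diff[OF sd_lipschitz_const[of n 1] g(1)] g(2) by (intro exI[of _ "0 + L"] exI[of _ "\<lambda>x. 1 - g x"]) simp
    qed
  next
    case (Union A)
    have Am: "A i \<in> sets \<mu>" for i using Union.hyps prob_measuresD(2)[OF \<mu>] by (simp add: sets_borel_of)
    have ii: "integrable \<mu> (indicat_real B)" if "B \<in> sets \<mu>" for B
      using that by (intro integrable_real_indicator) (auto simp: emeasure_eq_measure)
    have fin: "app (indicator (\<Union>i<k. A i))" for k :: nat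
    proof (induction k)
      case 0
      have "indicat_real {} = (\<lambda>x::nat \<Rightarrow> 'z. 0)" by auto
      then show ?case using app_lip[OF sd_lipschitz_const[of n 0]] by simp
    next
      case (Suc k)
      let ?B = "\<Union>i<k. A i"
      show ?case unfolding app_def
      proof (intro allI impI)
        fix \<epsilon> :: real assume "\<epsilon> > 0"
        obtain L g where g: "sd_lipschitz n L g" "(\<integral>x. \<bar>indicator ?B x - g x\<bar> \<partial>\<mu>) < \<epsilon> / 2"
          using Suc \<open>\<epsilon> > 0\<close> unfolding app_def by (metis half_gt_zero)
        obtain M h where h: "sd_lipschitz n M h" "(\<integral>x. \<bar>indicator (A k) x - h x\<bar> \<partial>\<mu>) < \<epsilon> / 2"
          using Union.IH \<open>\<epsilon> > 0\<close> unfolding app_def by (metis half_gt_zero)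
        have eq: "indicat_real (\<Union>i<Suc k. A i) x = max (indicator ?B x) (indicator (A k) x)" for x
          by (auto simp: lessThan_Suc split: split_indicator)
        have iB: "integrable \<mu> (indicat_real ?B)" "integrable \<mu> (indicat_real (A k))" "integrable \<mu> (indicat_real (\<Union>i<Suc k. A i))"
          using Am by (auto intro!: ii)
        have "(\<integral>x. \<bar>indicator (\<Union>i<Suc k. A i) x - max (g x) (h x)\<bar> \<partial>\<mu>) \<le>
            (\<integral>x. \<bar>indicator ?B x - g x\<bar> + \<bar>indicator (A k) x - h x\<bar> \<partial>\<mu>)"
        proof (rule integral_mono)
          show "integrable \<mu> (\<lambda>x. \<bar>indicator (\<Union>i<Suc k. A i) x - max (g x) (h x)\<bar>)"
            using iB gi[OF sd_lipschitz_max[OF g(1) h(1)]] by (intro integrable_abs Bochner_Integration.integrable_diff)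
          show "integrable \<mu> (\<lambda>x. \<bar>indicator ?B x - g x\<bar> + \<bar>indicator (A k) x - h x\<bar>)"
            using iB gi[OF g(1)] gi[OF h(1)] by (intro Bochner_Integration.integrable_add integrable_abs Bochner_Integration.integrable_diff)
        qed (unfold eq, linarith)
        also have "\<dots> = (\<integral>x. \<bar>indicator ?B x - g x\<bar> \<partial>\<mu>) + (\<integral>x. \<bar>indicator (A k) x - h x\<bar> \<partial>\<mu>)"
          using iB gi[OF g(1)] gi[OF h(1)] by (intro Bochner_Integration.integral_add integrable_abs Bochner_Integration.integrable_diff)
        finally show "\<exists>L g. sd_lipschitz n L g \<and> (\<integral>x. \<bar>indicator (\<Union>i<Suc k. A i) x - g x\<bar> \<partial>\<mu>) < \<epsilon>"
          using g h by (intro exI[of _ "L + M"] exI[of _ "\<lambda>x. max (g x) (h x)"]) (auto intro: sd_lipschitz_max)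
      qed
    qed
    show ?case
    proof (rule app_lim[of _ "\<lambda>k. indicator (\<Union>i<k. A i)"])
      show "integrable \<mu> (indicat_real (\<Union>i. A i))" using Am by (intro ii) auto
      show "integrable \<mu> (indicat_real (\<Union>i<k. A i))" for k using Am by (intro ii) auto
      show "app (indicator (\<Union>i<k. A i))" for k by (rule fin)
      have "(\<lambda>k. \<integral>x. \<bar>indicator (\<Union>i. A i) x - indicat_real (\<Union>i<k. A i) x\<bar> \<partial>\<mu>) \<longlonglongrightarrow>
         (\<integral>x. \<bar>indicator (\<Union>i. A i) x - indicat_real (\<Union>i. A i) x\<bar> \<partial>\<mu>)"
      proof (rule integral_dominated_convergence[where w="\<lambda>_. 1"])
        show "AE x in \<mu>. (\<lambda>k. \<bar>indicator (\<Union>i. A i) x - indicat_real (\<Union>i<k. A i) x\<bar>) \<longlonglongrightarrow>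
            \<bar>indicator (\<Union>i. A i) x - indicator (\<Union>i. A i) x\<bar>"
          by (intro AE_I2 tendsto_intros LIMSEQ_indicator_UN)
        show "AE x in \<mu>. norm \<bar>indicator (\<Union>i. A i) x - indicat_real (\<Union>i<k. A i) x\<bar> \<le> 1" for k
          by (auto split: split_indicator intro!: AE_I2)
      qed (use Am in auto)
      then show "(\<lambda>k. \<integral>x. \<bar>indicator (\<Union>i. A i) x - indicat_real (\<Union>i<k. A i) x\<bar> \<partial>\<mu>) \<longlonglongrightarrow> 0" by simp
    qed
  qed
  have "app p" using p
  proof (induction rule: integrable_induct)
    case (base A c)
    then have "A \<in> sigma_sets (topspace (power_topology n)) {U. openin (power_topology n) U}"
      using prob_measuresD(2)[OF \<mu>] by (simp add: sets_borel_of)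
    from app_cmult[OF app_set[OF this], of c] show ?case by (simp add: mult.commute)
  next
    case (add f g) then show ?case by (intro app_add)
  next
    case (lim f s)
    show ?case
    proof (rule app_lim[of f s])
      have "(\<lambda>k. \<integral>x. \<bar>f x - s k x\<bar> \<partial>\<mu>) \<longlonglongrightarrow> (\<integral>x. \<bar>f x - f x\<bar> \<partial>\<mu>)"
      proof (rule integral_dominated_convergence[where w="\<lambda>x. 3 * norm (f x)"])
        show "AE x in \<mu>. (\<lambda>k. \<bar>f x - s k x\<bar>) \<longlonglongrightarrow> \<bar>f x - f x\<bar>"
          using lim by (intro AE_I2 tendsto_intros) auto
        show "AE x in \<mu>. norm \<bar>f x - s k x\<bar> \<le> 3 * norm (f x)" for k
        proof (intro AE_I2)
          fix x assume "x \<in> space \<mu>"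
          then have "norm (s k x) \<le> 2 * norm (f x)" by (rule lim)
          then show "norm \<bar>f x - s k x\<bar> \<le> 3 * norm (f x)" by auto
        qed
      qed (use lim in auto)
      then show "(\<lambda>k. \<integral>x. \<bar>f x - s k x\<bar> \<partial>\<mu>) \<longlonglongrightarrow> 0" by simp
    qed (use lim in auto)
  qed
  then obtain L g where "sd_lipschitz n L g" "(\<integral>x. \<bar>p x - g x\<bar> \<partial>\<mu>) < \<epsilon>"
    unfolding app_def using \<open>\<epsilon> > 0\<close> by blast
  then show ?thesis by (rule that)
qed

section \<open>Two bounds for the Wasserstein distance\<close>

text \<open>A density with respect to the product law has the right marginals as soon as its integrals along both fibres are
\<open>1\<close> almost surely.\<close>

lemma density_coupling:
  assumes sep: "separating X C" and y1: "y1 \<in> prob_measures X" and y2: "y2 \<in> prob_measures X"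
    and h: "h \<in> borel_measurable (y1 \<Otimes>\<^sub>M y2)"
    and one1: "AE u in y1. (\<integral>\<^sup>+v. h (u, v) \<partial>y2) = 1" and one2: "AE v in y2. (\<integral>\<^sup>+u. h (u, v) \<partial>y1) = 1"
  shows "density (y1 \<Otimes>\<^sub>M y2) h \<in> couplings X y1 y2"
proof -
  interpret y1: prob_space y1 by (rule prob_measuresD(1)[OF y1])
  interpret y2: prob_space y2 by (rule prob_measuresD(1)[OF y2])
  interpret P: pair_prob_space y1 y2 ..
  let ?\<pi> = "density (y1 \<Otimes>\<^sub>M y2) h"
  have s: "sets ?\<pi> = sets (borel_of (prod_topology X X))"
    unfolding sets_density sets_borel_of_prod[OF sep sep]
    by (intro sets_pair_measure_cong prob_measuresD(2)[OF y1] prob_measuresD(2)[OF y2])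
  have mf: "fst \<in> ?\<pi> \<rightarrow>\<^sub>M borel_of X" and ms: "snd \<in> ?\<pi> \<rightarrow>\<^sub>M borel_of X"
    unfolding measurable_cong_sets[OF s refl] by (intro continuous_map_measurable continuous_map_fst continuous_map_snd)+
  have marg1: "distr ?\<pi> (borel_of X) fst = y1"
  proof (rule measure_eqI)
    show "sets (distr ?\<pi> (borel_of X) fst) = sets y1" by (simp add: prob_measuresD(2)[OF y1])
    fix A assume "A \<in> sets (distr ?\<pi> (borel_of X) fst)"
    then have A[measurable]: "A \<in> sets y1" and A': "A \<in> sets (borel_of X)" by (simp_all add: prob_measuresD(2)[OF y1])
    have iA: "(\<lambda>p. indicator A (fst p) * h p) \<in> borel_measurable (y1 \<Otimes>\<^sub>M y2)" using h by measurable
    have "emeasure (distr ?\<pi> (borel_of X) fst) A = (\<integral>\<^sup>+p. indicator A (fst p) \<partial>?\<pi>)"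
      using A' nn_integral_distr[OF mf, of "indicator A"] by simp
    also have "\<dots> = (\<integral>\<^sup>+p. indicator A (fst p) * h p \<partial>(y1 \<Otimes>\<^sub>M y2))"
      using h by (subst nn_integral_density) (auto simp: mult.commute)
    also have "\<dots> = (\<integral>\<^sup>+u. \<integral>\<^sup>+v. indicator A u * h (u, v) \<partial>y2 \<partial>y1)"
      using y2.nn_integral_fst[OF iA] by simp
    also have "\<dots> = (\<integral>\<^sup>+u. indicator A u * (\<integral>\<^sup>+v. h (u, v) \<partial>y2) \<partial>y1)"
      by (intro nn_integral_cong nn_integral_cmult measurable_compose[OF measurable_Pair1' h])
    also have "\<dots> = (\<integral>\<^sup>+u. indicator A u \<partial>y1)"
      by (rule nn_integral_cong_AE) (use one1 in \<open>eventually_elim, simp\<close>)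
    finally show "emeasure (distr ?\<pi> (borel_of X) fst) A = emeasure y1 A" by simp
  qed
  have marg2: "distr ?\<pi> (borel_of X) snd = y2"
  proof (rule measure_eqI)
    show "sets (distr ?\<pi> (borel_of X) snd) = sets y2" by (simp add: prob_measuresD(2)[OF y2])
    fix A assume "A \<in> sets (distr ?\<pi> (borel_of X) snd)"
    then have A[measurable]: "A \<in> sets y2" and A': "A \<in> sets (borel_of X)" by (simp_all add: prob_measuresD(2)[OF y2])
    have iA: "(\<lambda>p. indicator A (snd p) * h p) \<in> borel_measurable (y1 \<Otimes>\<^sub>M y2)" using h by measurable
    have "emeasure (distr ?\<pi> (borel_of X) snd) A = (\<integral>\<^sup>+p. indicator A (snd p) \<partial>?\<pi>)"
      using A' nn_integral_distr[OF ms, of "indicator A"] by simp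
    also have "\<dots> = (\<integral>\<^sup>+p. indicator A (snd p) * h p \<partial>(y1 \<Otimes>\<^sub>M y2))"
      using h by (subst nn_integral_density) (auto simp: mult.commute)
    also have "\<dots> = (\<integral>\<^sup>+v. \<integral>\<^sup>+u. indicator A v * h (u, v) \<partial>y1 \<partial>y2)"
      using P.nn_integral_snd[OF iA] by simp
    also have "\<dots> = (\<integral>\<^sup>+v. indicator A v * (\<integral>\<^sup>+u. h (u, v) \<partial>y1) \<partial>y2)"
      by (intro nn_integral_cong nn_integral_cmult measurable_compose[OF measurable_Pair2' h])
    also have "\<dots> = (\<integral>\<^sup>+v. indicator A v \<partial>y2)"
      by (rule nn_integral_cong_AE) (use one2 in \<open>eventually_elim, simp\<close>)
    finally show "emeasure (distr ?\<pi> (borel_of X) snd) A = emeasure y2 A" by simp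
  qed
  have "prob_space ?\<pi>" by (rule prob_space_distrD[OF mf]) (simp add: marg1 y1.prob_space_axioms)
  then show ?thesis unfolding couplings_def using marg1 marg2 s by (auto intro: prob_measuresI)
qed

text \<open>Let \<open>a\<^sub>i\<close> and \<open>b\<^sub>i\<close> be the masses that the two laws give to the \<open>i\<close>-th piece. Inside each piece the common mass
\<open>min a\<^sub>i b\<^sub>i\<close> is coupled independently, at cost at most \<open>\<delta>\<close> per unit. What remains of the two laws has equal mass \<open>r\<close> and is
coupled independently as well, at cost at most \<open>D\<close> per unit, and \<open>r\<close> is bounded by the mass outside the pieces plus
\<open>\<Sum>\<^sub>i |a\<^sub>i - b\<^sub>i|\<close>.\<close>

lemma exists_cheap_coupling:
  fixes y1 y2 :: "(nat \<Rightarrow> 'z::polish_space) measure"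
  assumes y1: "y1 \<in> prob_measures (power_topology n)" and y2: "y2 \<in> prob_measures (power_topology n)"
    and \<psi>: "subpartition n \<delta> m \<psi>" and "0 \<le> \<delta>"
    and D: "\<And>x y :: nat \<Rightarrow> 'z. sum_dist n x y \<le> D"
  shows "\<exists>\<pi>\<in>couplings (power_topology n) y1 y2. (\<integral>\<^sup>+(x, y). ennreal (sum_dist n x y) \<partial>\<pi>) \<le>
       ennreal (\<delta> + D * ((\<integral>z. 1 - (\<Sum>i<m. \<psi> i z) \<partial>y1) + (\<Sum>i<m. \<bar>(\<integral>z. \<psi> i z \<partial>y1) - (\<integral>z. \<psi> i z \<partial>y2)\<bar>)))"
proof -
  let ?X = "power_topology n :: (nat \<Rightarrow> 'z) topology"
  note \<psi>0 = subpartitionD(2)[OF \<psi>] and \<psi>1 = subpartitionD(3)[OF \<psi>] and diam = subpartitionD(4)[OF \<psi>]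
  interpret y1: prob_space y1 by (rule prob_measuresD(1)[OF y1])
  interpret y2: prob_space y2 by (rule prob_measuresD(1)[OF y2])
  interpret P: pair_prob_space y1 y2 ..
  have D0: "0 \<le> D" using D sum_dist_nonneg order_trans by blast
  have i1: "integrable y1 (\<psi> i)" and i2: "integrable y2 (\<psi> i)" for i
    by (rule Cb_integrable[OF subpartitionD(1)[OF \<psi>] y1], rule Cb_integrable[OF subpartitionD(1)[OF \<psi>] y2])
  note [measurable] = borel_measurable_integrable[OF i1] borel_measurable_integrable[OF i2]
  define a where "a i = (\<integral>z. \<psi> i z \<partial>y1)" for i
  define b where "b i = (\<integral>z. \<psi> i z \<partial>y2)" for i
  have a0: "0 \<le> a i" and b0: "0 \<le> b i" for i using \<psi>0 by (auto simp: a_def b_def)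
  \<comment> \<open>Division by \<open>0\<close> gives \<open>\<theta> i = 0\<close> if one of the laws misses the piece, as it should be.\<close>
  define \<theta> where "\<theta> i = min (a i) (b i) / (a i * b i)" for i
  have \<theta>0: "0 \<le> \<theta> i" for i using a0 b0 by (auto simp: \<theta>_def)
  have \<theta>ab: "\<theta> i * a i * b i = min (a i) (b i)" for i
    using a0[of i] b0[of i] by (cases "a i = 0 \<or> b i = 0") (auto simp: \<theta>_def)
  have \<theta>b: "\<theta> i * b i \<le> 1" and \<theta>a: "\<theta> i * a i \<le> 1" for i
    using a0[of i] b0[of i] by (auto simp: \<theta>_def divide_simps min_def)
  define \<alpha> where "\<alpha> u = (\<Sum>i<m. \<theta> i * b i * \<psi> i u)" for u
  define \<beta> where "\<beta> v = (\<Sum>i<m. \<theta> i * a i * \<psi> i v)" for v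
  have \<alpha>1: "\<alpha> u \<le> 1" for u
  proof -
    have "\<alpha> u \<le> (\<Sum>i<m. \<psi> i u)" unfolding \<alpha>_def by (intro sum_mono mult_left_le_one_le \<psi>0 \<theta>b mult_nonneg_nonneg \<theta>0 b0)
    then show ?thesis using \<psi>1[of u] by simp
  qed
  have \<alpha>0: "0 \<le> \<alpha> u" for u
    unfolding \<alpha>_def by (intro sum_nonneg mult_nonneg_nonneg \<theta>0 b0 \<psi>0)
  have \<beta>1: "\<beta> u \<le> 1" for u
  proof -
    have "\<beta> u \<le> (\<Sum>i<m. \<psi> i u)" unfolding \<beta>_def by (intro sum_mono mult_left_le_one_le \<psi>0 \<theta>a mult_nonneg_nonneg \<theta>0 a0)
    then show ?thesis using \<psi>1[of u] by simp
  qed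
  define S where "S = (\<Sum>i<m. min (a i) (b i))"
  define r where "r = 1 - S"
  have \<alpha>i: "integrable y1 \<alpha>" and \<beta>i: "integrable y2 \<beta>" unfolding \<alpha>_def[abs_def] \<beta>_def[abs_def] using i1 i2 by auto
  note [measurable] = borel_measurable_integrable[OF \<alpha>i] borel_measurable_integrable[OF \<beta>i]
  have \<alpha>S: "(\<integral>u. \<alpha> u \<partial>y1) = S"
    unfolding \<alpha>_def S_def using i1 by (simp add: a_def[symmetric] \<theta>ab[symmetric] mult_ac)
  have \<beta>S: "(\<integral>v. \<beta> v \<partial>y2) = S"
    unfolding \<beta>_def S_def using i2 by (simp add: b_def[symmetric] \<theta>ab[symmetric] mult_ac)
  have \<alpha>r: "(\<integral>u. 1 - \<alpha> u \<partial>y1) = r" using \<alpha>i \<alpha>S by (simp add: r_def y1.prob_space)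
  have \<beta>r: "(\<integral>v. 1 - \<beta> v \<partial>y2) = r" using \<beta>i \<beta>S by (simp add: r_def y2.prob_space)
  have r0: "0 \<le> r" unfolding \<alpha>r[symmetric] using \<alpha>1 by (intro integral_nonneg_AE) auto
  have S0: "0 \<le> S" unfolding S_def using a0 b0 by (intro sum_nonneg) auto
  \<comment> \<open>The density of the coupling is \<open>H 1 1\<close>; its cost is dominated by \<open>H \<delta> D\<close>. If \<open>r = 0\<close> the second summand vanishes, and then \<open>\<alpha> = 1\<close> and \<open>\<beta> = 1\<close> almost surely.\<close>
  define H where "H K L u v = K * (\<Sum>i<m. \<theta> i * \<psi> i u * \<psi> i v) + L * ((1 - \<alpha> u) * (1 - \<beta> v) / r)" for K L u v
  have H0: "0 \<le> H K L u v" if "0 \<le> K" "0 \<le> L" for K L u v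
    unfolding H_def using that \<alpha>1[of u] \<beta>1[of v] r0 \<theta>0 \<psi>0
    by (intro add_nonneg_nonneg mult_nonneg_nonneg sum_nonneg divide_nonneg_nonneg) auto
  have Hm[measurable]: "(\<lambda>p. H K L (fst p) (snd p)) \<in> borel_measurable (y1 \<Otimes>\<^sub>M y2)" for K L
  proof -
    have [measurable]: "\<alpha> \<in> borel_measurable y1" "\<beta> \<in> borel_measurable y2" by measurable
    show ?thesis unfolding H_def by measurable
  qed
  have innerv: "(\<integral>\<^sup>+v. ennreal (H K L u v) \<partial>y2) = ennreal (K * \<alpha> u + L * ((1 - \<alpha> u) * (r / r)))"
    if KL: "0 \<le> K" "0 \<le> L" for K L u
  proof -
    have i: "integrable y2 (\<lambda>v. \<Sum>i<m. \<theta> i * \<psi> i u * \<psi> i v)" using i2 by auto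
    have j: "integrable y2 (\<lambda>v. (1 - \<alpha> u) * (1 - \<beta> v) / r)" using \<beta>i by auto
    have iK: "integrable y2 (\<lambda>v. K * (\<Sum>i<m. \<theta> i * \<psi> i u * \<psi> i v))" by (intro integrable_mult_right i)
    have jL: "integrable y2 (\<lambda>v. L * ((1 - \<alpha> u) * (1 - \<beta> v) / r))" by (intro integrable_mult_right j)
    have "(\<integral>v. H K L u v \<partial>y2) = K * (\<integral>v. (\<Sum>i<m. \<theta> i * \<psi> i u * \<psi> i v) \<partial>y2) + L * (\<integral>v. (1 - \<alpha> u) * (1 - \<beta> v) / r \<partial>y2)"
      unfolding H_def Bochner_Integration.integral_add[OF iK jL] by (simp only: integral_mult_right_zero)
    also have "(\<integral>v. (\<Sum>i<m. \<theta> i * \<psi> i u * \<psi> i v) \<partial>y2) = \<alpha> u"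
      unfolding \<alpha>_def using i2 by (simp add: b_def[symmetric] mult_ac)
    also have "(\<integral>v. (1 - \<alpha> u) * (1 - \<beta> v) / r \<partial>y2) = (1 - \<alpha> u) * (r / r)"
      using \<beta>r by simp
    finally have "(\<integral>v. H K L u v \<partial>y2) = K * \<alpha> u + L * ((1 - \<alpha> u) * (r / r))" .
    moreover have "integrable y2 (H K L u)"
      unfolding H_def[abs_def] by (rule Bochner_Integration.integrable_add[OF iK jL])
    ultimately show ?thesis using H0[OF KL] by (subst nn_integral_eq_integral) auto
  qed
  have inneru: "(\<integral>\<^sup>+u. ennreal (H 1 1 u v) \<partial>y1) = ennreal (\<beta> v + (1 - \<beta> v) * (r / r))" for v
  proof -
    have i: "integrable y1 (\<lambda>u. \<Sum>i<m. \<theta> i * \<psi> i u * \<psi> i v)" using i1 by auto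
    have j: "integrable y1 (\<lambda>u. (1 - \<alpha> u) * (1 - \<beta> v) / r)" using \<alpha>i by auto
    have "(\<integral>u. H 1 1 u v \<partial>y1) = (\<integral>u. (\<Sum>i<m. \<theta> i * \<psi> i u * \<psi> i v) \<partial>y1) + (\<integral>u. (1 - \<alpha> u) * (1 - \<beta> v) / r \<partial>y1)"
      unfolding H_def mult_1 by (rule Bochner_Integration.integral_add[OF i j])
    also have "(\<integral>u. (\<Sum>i<m. \<theta> i * \<psi> i u * \<psi> i v) \<partial>y1) = \<beta> v"
      unfolding \<beta>_def using i1 by (simp add: a_def[symmetric] mult_ac)
    also have "(\<integral>u. (1 - \<alpha> u) * (1 - \<beta> v) / r \<partial>y1) = (1 - \<beta> v) * (r / r)"
      using \<alpha>r by simp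
    finally have "(\<integral>u. H 1 1 u v \<partial>y1) = \<beta> v + (1 - \<beta> v) * (r / r)" .
    moreover have "integrable y1 (\<lambda>u. H 1 1 u v)"
      unfolding H_def mult_1 by (rule Bochner_Integration.integrable_add[OF i j])
    ultimately show ?thesis using H0 by (subst nn_integral_eq_integral) auto
  qed
  have one1: "AE u in y1. \<alpha> u + (1 - \<alpha> u) * (r / r) = 1"
  proof (cases "r = 0")
    case True
    have "AE u in y1. 1 - \<alpha> u = 0"
      using \<alpha>r True \<alpha>i \<alpha>1 by (subst integral_nonneg_eq_0_iff_AE[symmetric]) auto
    then show ?thesis by (eventually_elim) (simp add: True)
  qed auto
  have one2: "AE v in y2. \<beta> v + (1 - \<beta> v) * (r / r) = 1"
  proof (cases "r = 0")
    case True
    have "AE v in y2. 1 - \<beta> v = 0"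
      using \<beta>r True \<beta>i \<beta>1 by (subst integral_nonneg_eq_0_iff_AE[symmetric]) auto
    then show ?thesis by (eventually_elim) (simp add: True)
  qed auto
  have total: "(\<integral>\<^sup>+p. ennreal (H K L (fst p) (snd p)) \<partial>(y1 \<Otimes>\<^sub>M y2)) \<le> ennreal (K * S + L * r)" if KL: "0 \<le> K" "0 \<le> L" for K L
  proof -
    have "(\<integral>\<^sup>+p. ennreal (H K L (fst p) (snd p)) \<partial>(y1 \<Otimes>\<^sub>M y2)) = (\<integral>\<^sup>+u. \<integral>\<^sup>+v. ennreal (H K L u v) \<partial>y2 \<partial>y1)"
      by (subst y2.nn_integral_fst[symmetric]) auto
    also have "\<dots> = (\<integral>\<^sup>+u. ennreal (K * \<alpha> u + L * ((1 - \<alpha> u) * (r / r))) \<partial>y1)" by (simp only: innerv[OF KL])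
    also have "\<dots> \<le> (\<integral>\<^sup>+u. ennreal (K * \<alpha> u + L * (1 - \<alpha> u)) \<partial>y1)"
      using \<alpha>1 KL by (intro nn_integral_mono ennreal_leI add_left_mono mult_left_mono) (auto simp: mult_left_le)
    also have "\<dots> = ennreal (\<integral>u. K * \<alpha> u + L * (1 - \<alpha> u) \<partial>y1)"
      using \<alpha>i \<alpha>1 \<alpha>0 KL by (intro nn_integral_eq_integral) (auto intro!: AE_I2 add_nonneg_nonneg mult_nonneg_nonneg)
    also have "(\<integral>u. K * \<alpha> u + L * (1 - \<alpha> u) \<partial>y1) = K * S + L * r"
      using \<alpha>i \<alpha>S by (subst Bochner_Integration.integral_add) (auto simp: r_def y1.prob_space)
    finally show ?thesis .
  qed
  define \<pi> where "\<pi> = density (y1 \<Otimes>\<^sub>M y2) (\<lambda>p. ennreal (H 1 1 (fst p) (snd p)))"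
  have coupling: "\<pi> \<in> couplings ?X y1 y2"
    unfolding \<pi>_def
  proof (rule density_coupling[OF separating_power y1 y2])
    show "(\<lambda>p. ennreal (H 1 1 (fst p) (snd p))) \<in> borel_measurable (y1 \<Otimes>\<^sub>M y2)" using Hm by measurable
    show "AE u in y1. (\<integral>\<^sup>+v. ennreal (H 1 1 (fst (u, v)) (snd (u, v))) \<partial>y2) = 1"
      using one1 by eventually_elim (use innerv[of 1 1] in \<open>simp only: mult_1 fst_conv snd_conv, simp\<close>)
    show "AE v in y2. (\<integral>\<^sup>+u. ennreal (H 1 1 (fst (u, v)) (snd (u, v))) \<partial>y1) = 1"
      using one2 by eventually_elim (simp only: inneru fst_conv snd_conv, simp)
  qed
  have s12: "sets (y1 \<Otimes>\<^sub>M y2) = sets (borel_of (prod_topology ?X ?X))"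
    unfolding sets_borel_of_prod[OF separating_power separating_power]
    by (intro sets_pair_measure_cong prob_measuresD(2)[OF y1] prob_measuresD(2)[OF y2])
  have costm: "(\<lambda>p. ennreal (sum_dist n (fst p) (snd p))) \<in> borel_measurable (y1 \<Otimes>\<^sub>M y2)"
  proof -
    have "(\<lambda>p. sum_dist n (fst p) (snd p)) \<in> borel_measurable (borel_of (prod_topology ?X ?X))"
      by (intro continuous_map_borel_measurable continuous_map_sum_dist continuous_map_fst continuous_map_snd)
    then show ?thesis by (simp add: measurable_cong_sets[OF s12 refl])
  qed
  have costle: "H 1 1 u v * sum_dist n u v \<le> H \<delta> D u v" for u v
  proof -
    have "\<theta> i * \<psi> i u * \<psi> i v * sum_dist n u v \<le> \<theta> i * \<psi> i u * \<psi> i v * \<delta>" for i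
    proof (cases "\<psi> i u = 0 \<or> \<psi> i v = 0")
      case False
      then show ?thesis by (intro mult_left_mono diam mult_nonneg_nonneg \<theta>0 \<psi>0) auto
    qed auto
    then have "(\<Sum>i<m. \<theta> i * \<psi> i u * \<psi> i v) * sum_dist n u v \<le> (\<Sum>i<m. \<theta> i * \<psi> i u * \<psi> i v) * \<delta>"
      unfolding sum_distrib_right by (intro sum_mono)
    moreover have "((1 - \<alpha> u) * (1 - \<beta> v) / r) * sum_dist n u v \<le> ((1 - \<alpha> u) * (1 - \<beta> v) / r) * D"
      using \<alpha>1[of u] \<beta>1[of v] r0 D by (intro mult_left_mono divide_nonneg_nonneg mult_nonneg_nonneg) auto
    ultimately show ?thesis unfolding H_def by (simp only: mult_1 distrib_right) (simp add: mult.commute)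
  qed
  have "(\<integral>\<^sup>+(x, y). ennreal (sum_dist n x y) \<partial>\<pi>) = (\<integral>\<^sup>+p. ennreal (sum_dist n (fst p) (snd p)) \<partial>\<pi>)"
    by (intro nn_integral_cong) (simp split: prod.split)
  also have "\<dots> = (\<integral>\<^sup>+p. ennreal (H 1 1 (fst p) (snd p)) * ennreal (sum_dist n (fst p) (snd p)) \<partial>(y1 \<Otimes>\<^sub>M y2))"
    unfolding \<pi>_def using costm by (intro nn_integral_density) auto
  also have "\<dots> \<le> (\<integral>\<^sup>+p. ennreal (H \<delta> D (fst p) (snd p)) \<partial>(y1 \<Otimes>\<^sub>M y2))"
    using H0 costle by (intro nn_integral_mono) (simp add: ennreal_mult'[symmetric] ennreal_leI)
  also have "\<dots> \<le> ennreal (\<delta> * S + D * r)" by (rule total[OF \<open>0 \<le> \<delta>\<close> D0])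
  also have "\<dots> \<le> ennreal (\<delta> + D * ((\<integral>z. 1 - (\<Sum>i<m. \<psi> i z) \<partial>y1) + (\<Sum>i<m. \<bar>a i - b i\<bar>)))"
  proof (intro ennreal_leI add_mono mult_left_mono D0)
    show "\<delta> * S \<le> \<delta>" using r0 \<open>0 \<le> \<delta>\<close> by (intro mult_left_le) (auto simp: r_def)
    have "(\<integral>z. 1 - (\<Sum>i<m. \<psi> i z) \<partial>y1) = 1 - (\<Sum>i<m. a i)" using i1 by (simp add: a_def y1.prob_space)
    moreover have "(\<Sum>i<m. a i) \<le> S + (\<Sum>i<m. \<bar>a i - b i\<bar>)"
      unfolding S_def sum.distrib[symmetric] by (intro sum_mono) auto
    ultimately show "r \<le> (\<integral>z. 1 - (\<Sum>i<m. \<psi> i z) \<partial>y1) + (\<Sum>i<m. \<bar>a i - b i\<bar>)" by (simp add: r_def)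
  qed
  finally show ?thesis unfolding a_def b_def by (rule bexI[OF _ coupling])
qed

abbreviation W1 :: "nat \<Rightarrow> (nat \<Rightarrow> 'z::metric_space) measure \<Rightarrow> (nat \<Rightarrow> 'z) measure \<Rightarrow> real" where
  "W1 n \<equiv> wasserstein1 (power_topology n) (sum_dist n)"

lemma W1_le:
  fixes y1 y2 :: "(nat \<Rightarrow> 'z::polish_space) measure"
  assumes y1: "y1 \<in> prob_measures (power_topology n)" and y2: "y2 \<in> prob_measures (power_topology n)"
    and \<psi>: "subpartition n \<delta> m \<psi>" and "0 \<le> \<delta>"
    and D: "\<And>x y :: nat \<Rightarrow> 'z. sum_dist n x y \<le> D"
  shows "W1 n y1 y2 \<le> \<delta> + D * ((\<integral>z. 1 - (\<Sum>i<m. \<psi> i z) \<partial>y1) + (\<Sum>i<m. \<bar>(\<integral>z. \<psi> i z \<partial>y1) - (\<integral>z. \<psi> i z \<partial>y2)\<bar>))"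
    (is "_ \<le> ?B")
proof -
  have "\<exists>\<pi>\<in>couplings (power_topology n) y1 y2. (\<integral>\<^sup>+(x, y). ennreal (sum_dist n x y) \<partial>\<pi>) \<le> ennreal ?B"
    by (rule exists_cheap_coupling[OF assms])
  then obtain \<pi> where \<pi>: "\<pi> \<in> couplings (power_topology n) y1 y2" "(\<integral>\<^sup>+(x, y). ennreal (sum_dist n x y) \<partial>\<pi>) \<le> ennreal ?B"
    by blast
  have D0: "0 \<le> D" using D sum_dist_nonneg order_trans by blast
  show ?thesis unfolding wasserstein1_def
  proof (rule enn2real_leI)
    show "0 \<le> ?B" using D0 \<open>0 \<le> \<delta>\<close> subpartitionD(3)[OF \<psi>]
      by (intro add_nonneg_nonneg mult_nonneg_nonneg integral_nonneg_AE sum_nonneg) auto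
    show "(INF \<pi>\<in>couplings (power_topology n) y1 y2. \<integral>\<^sup>+(x, y). ennreal (sum_dist n x y) \<partial>\<pi>) \<le> ennreal ?B"
      by (rule INF_lower2[OF \<pi>(1)]) (rule \<pi>(2))
  qed
qed

lemma W1_nonneg [simp]: "0 \<le> W1 n y1 y2"
  by (simp add: wasserstein1_def)

text \<open>The elementary half of Kantorovich duality: the bound holds for the cost of every coupling. Existence of some coupling
of finite cost ensures that the infimum is finite and survives the conversion to a real number.\<close>

lemma lipschitz_integral_le_W1:
  fixes y1 y2 :: "(nat \<Rightarrow> 'z::polish_space) measure"
  assumes bd: "bounded (UNIV :: 'z set)"
    and y1: "y1 \<in> prob_measures (power_topology n)" and y2: "y2 \<in> prob_measures (power_topology n)"
    and f: "sd_lipschitz n L f"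
  shows "\<bar>(\<integral>x. f x \<partial>y1) - (\<integral>x. f x \<partial>y2)\<bar> \<le> L * W1 n y1 y2"
proof -
  let ?X = "power_topology n :: (nat \<Rightarrow> 'z) topology"
  obtain D0 where "D0 > 0" "\<And>x y :: 'z. dist x y \<le> D0" using bounded_dist_bound[OF bd] by metis
  then have D: "sum_dist n x y \<le> real n * D0" for x y :: "nat \<Rightarrow> 'z" by (intro sum_dist_le)
  have L0: "0 \<le> L" using f by (rule sd_lipschitzD)
  have fC: "f \<in> Cb ?X" by (rule Cb_sd_lipschitz[OF bd f])
  have sC: "(\<lambda>p. sum_dist n (fst p) (snd p)) \<in> Cb (prod_topology ?X ?X)"
    using D by (intro CbI[of _ _ "real n * D0"] continuous_map_sum_dist continuous_map_fst continuous_map_snd) auto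
  let ?d = "\<bar>(\<integral>x. f x \<partial>y1) - (\<integral>x. f x \<partial>y2)\<bar>"
  let ?I = "INF \<pi>\<in>couplings ?X y1 y2. \<integral>\<^sup>+(x, y). ennreal (sum_dist n x y) \<partial>\<pi>"
  have le: "?d \<le> L * enn2real (\<integral>\<^sup>+(x, y). ennreal (sum_dist n x y) \<partial>\<pi>)"
    "(\<integral>\<^sup>+(x, y). ennreal (sum_dist n x y) \<partial>\<pi>) < \<top>" if \<pi>: "\<pi> \<in> couplings ?X y1 y2" for \<pi>
  proof -
    have \<pi>p: "\<pi> \<in> prob_measures (prod_topology ?X ?X)" and m1: "distr \<pi> (borel_of ?X) fst = y1" and m2: "distr \<pi> (borel_of ?X) snd = y2"
      using \<pi> by (auto simp: couplings_def)
    have cost: "(\<integral>\<^sup>+(x, y). ennreal (sum_dist n x y) \<partial>\<pi>) = ennreal (\<integral>p. sum_dist n (fst p) (snd p) \<partial>\<pi>)"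
    proof -
      have "(\<integral>\<^sup>+(x, y). ennreal (sum_dist n x y) \<partial>\<pi>) = (\<integral>\<^sup>+p. ennreal (sum_dist n (fst p) (snd p)) \<partial>\<pi>)"
        by (intro nn_integral_cong) (simp split: prod.split)
      also have "\<dots> = ennreal (\<integral>p. sum_dist n (fst p) (snd p) \<partial>\<pi>)"
        using Cb_integrable[OF sC \<pi>p] by (intro nn_integral_eq_integral) auto
      finally show ?thesis .
    qed
    then show "(\<integral>\<^sup>+(x, y). ennreal (sum_dist n x y) \<partial>\<pi>) < \<top>" by simp
    note mc = measurable_cong_sets[OF prob_measuresD(2)[OF \<pi>p] refl]
    have mf: "fst \<in> \<pi> \<rightarrow>\<^sub>M borel_of ?X" and ms: "snd \<in> \<pi> \<rightarrow>\<^sub>M borel_of ?X"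
      unfolding mc by (intro continuous_map_measurable continuous_map_fst continuous_map_snd)+
    have if1: "integrable \<pi> (\<lambda>p. f (fst p))" and if2: "integrable \<pi> (\<lambda>p. f (snd p))"
      using Cb_compose[OF continuous_map_fst fC] Cb_compose[OF continuous_map_snd fC] Cb_integrable[OF _ \<pi>p] by auto
    have "(\<integral>x. f x \<partial>y1) = (\<integral>p. f (fst p) \<partial>\<pi>)"
      unfolding m1[symmetric] by (rule integral_distr[OF mf Cb_measurable[OF fC]])
    moreover have "(\<integral>x. f x \<partial>y2) = (\<integral>p. f (snd p) \<partial>\<pi>)"
      unfolding m2[symmetric] by (rule integral_distr[OF ms Cb_measurable[OF fC]])
    ultimately have "?d = \<bar>\<integral>p. f (fst p) - f (snd p) \<partial>\<pi>\<bar>" using if1 if2 by simp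
    also have "\<dots> \<le> (\<integral>p. \<bar>f (fst p) - f (snd p)\<bar> \<partial>\<pi>)" by (rule integral_abs_bound)
    also have "\<dots> \<le> (\<integral>p. L * sum_dist n (fst p) (snd p) \<partial>\<pi>)"
    proof (rule integral_mono)
      fix p assume "p \<in> space \<pi>"
      then have "p \<in> extensional {1..n} \<times> extensional {1..n}"
        by (simp only: prob_measuresD(3)[OF \<pi>p] topspace_prod_topology topspace_power)
      then have "fst p \<in> extensional {1..n}" "snd p \<in> extensional {1..n}"
        by (simp_all only: mem_Times_iff)
      then show "\<bar>f (fst p) - f (snd p)\<bar> \<le> L * sum_dist n (fst p) (snd p)" by (rule sd_lipschitzD(1)[OF f])
    qed (intro integrable_abs Bochner_Integration.integrable_diff integrable_mult_right if1 if2 Cb_integrable[OF sC \<pi>p])+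
    also have "\<dots> = L * enn2real (\<integral>\<^sup>+(x, y). ennreal (sum_dist n x y) \<partial>\<pi>)" unfolding cost by simp
    finally show "?d \<le> L * enn2real (\<integral>\<^sup>+(x, y). ennreal (sum_dist n x y) \<partial>\<pi>)" .
  qed
  obtain \<pi>0 where \<pi>0: "\<pi>0 \<in> couplings ?X y1 y2"
    using exists_cheap_coupling[OF y1 y2, of 0 0 "\<lambda>_ _. 0" "real n * D0"] D by (auto simp: subpartition_def)
  show ?thesis
  proof (cases "L = 0")
    case True
    then show ?thesis using le(1)[OF \<pi>0] by simp
  next
    case False
    then have "L > 0" using L0 by simp
    have "ennreal (?d / L) \<le> ?I"
    proof (rule INF_greatest)
      fix \<pi> assume \<pi>: "\<pi> \<in> couplings ?X y1 y2"
      have "?d / L \<le> enn2real (\<integral>\<^sup>+(x, y). ennreal (sum_dist n x y) \<partial>\<pi>)"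
        using le(1)[OF \<pi>] \<open>L > 0\<close> by (simp add: field_simps)
      then have "ennreal (?d / L) \<le> ennreal (enn2real (\<integral>\<^sup>+(x, y). ennreal (sum_dist n x y) \<partial>\<pi>))" by (rule ennreal_leI)
      then show "ennreal (?d / L) \<le> (\<integral>\<^sup>+(x, y). ennreal (sum_dist n x y) \<partial>\<pi>)" using le(2)[OF \<pi>] by simp
    qed
    moreover have "?I < \<top>" using INF_lower[OF \<pi>0] le(2)[OF \<pi>0] by (rule order_le_less_trans)
    ultimately have "?d / L \<le> enn2real ?I" using \<open>L > 0\<close> enn2real_mono[of "ennreal (?d / L)" ?I] by simp
    then show ?thesis using \<open>L > 0\<close> by (simp add: wasserstein1_def field_simps)
  qed
qed

section \<open>The information topology refines the weak topology\<close>

lemma topspace_information_topology: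
  assumes "N \<ge> 2"
  shows "topspace (information_topology N :: (nat \<Rightarrow> 'z::polish_space) measure topology) = prob_measures (power_topology N)"
  unfolding information_topology_def
  by (rule topspace_initial_topology) (use assms in \<open>auto intro!: information_map_prob\<close>)

lemma continuous_map_information_map:
  assumes "t \<in> {1..<N}"
  shows "continuous_map (information_topology N) (weak_topology (info_space N t))
    (information_map N t :: (nat \<Rightarrow> 'z::polish_space) measure \<Rightarrow> _)"
  unfolding information_topology_def
  by (rule continuous_map_from_initial_topology[OF assms]) (auto intro!: information_map_prob)

lemma continuous_map_information_integral:
  fixes G :: "(nat \<Rightarrow> 'z::polish_space) \<times> (nat \<Rightarrow> 'z) measure \<Rightarrow> real"
  assumes "t \<in> {1..<N}" "G \<in> Cb (info_space N t)"
  shows "continuous_map (information_topology N) euclideanreal (\<lambda>\<mu>. \<integral>p. G p \<partial>information_map N t \<mu>)"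
  using continuous_map_compose[OF continuous_map_information_map[OF assms(1)] continuous_map_weak_integral[OF assms(2)]]
  by (simp add: o_def)

text \<open>The inverse of splitting a point into its first \<open>t\<close> and its remaining coordinates.\<close>

definition join_coords :: "nat \<Rightarrow> nat \<Rightarrow> (nat \<Rightarrow> 'z) \<Rightarrow> (nat \<Rightarrow> 'z) \<Rightarrow> nat \<Rightarrow> 'z" where
  "join_coords N t x y = (\<lambda>i\<in>{1..N}. if i \<le> t then x i else y (i - t))"

lemma join_coords_first_last:
  "t \<le> N \<Longrightarrow> z \<in> extensional {1..N} \<Longrightarrow> join_coords N t (first_coords t z) (last_coords N t z) = z"
  by (auto simp: join_coords_def first_coords_def last_coords_def fun_eq_iff extensional_def)

lemma continuous_map_join_coords:
  assumes "t \<le> N"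
  shows "continuous_map (prod_topology (power_topology t) (power_topology (N - t))) (power_topology N)
    (\<lambda>p. join_coords N t (fst p) (snd p) :: nat \<Rightarrow> 'z::topological_space)"
  unfolding continuous_map_into_power
proof (intro conjI ballI)
  let ?P = "prod_topology (power_topology t) (power_topology (N - t)) :: ((nat \<Rightarrow> 'z) \<times> (nat \<Rightarrow> 'z)) topology"
  show "(\<lambda>p. join_coords N t (fst p) (snd p)) \<in> topspace ?P \<rightarrow> extensional {1..N}"
    by (simp add: join_coords_def)
  fix i assume i: "i \<in> {1..N}"
  show "continuous_map ?P euclidean (\<lambda>p. join_coords N t (fst p) (snd p) i)"
  proof (cases "i \<le> t")
    case True
    then have "i \<in> {1..t}" using i by auto
    from continuous_map_compose[OF continuous_map_fst continuous_map_coord[OF this]]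
    have "continuous_map ?P euclidean (\<lambda>p. fst p i)" by (simp add: o_def)
    then show ?thesis using True i by (simp add: join_coords_def)
  next
    case False
    then have "i - t \<in> {1..N - t}" using i by auto
    from continuous_map_compose[OF continuous_map_snd continuous_map_coord[OF this]]
    have "continuous_map ?P euclidean (\<lambda>p. snd p (i - t))" by (simp add: o_def)
    then show ?thesis using False i by (simp add: join_coords_def)
  qed
qed

lemma sum_dist_join_coords:
  assumes "t \<le> N"
  shows "sum_dist N (join_coords N t x y) (join_coords N t x' y) = sum_dist t x x'"
proof -
  have "sum_dist N (join_coords N t x y) (join_coords N t x' y) = (\<Sum>i=1..N. if i \<le> t then dist (x i) (x' i) else 0)"
    unfolding sum_dist_def join_coords_def by (intro sum.cong) auto
  also have "\<dots> = (\<Sum>i\<in>{1..t}. dist (x i) (x' i))"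
    using assms by (intro sum.mono_neutral_cong_right) auto
  finally show ?thesis by (simp add: sum_dist_def)
qed

text \<open>For fixed first coordinates the average is a weakly continuous function of the measure, and a Lipschitz \<open>f\<close> makes the
dependence on the first coordinates uniform in the measure.\<close>

lemma kernel_average_Cb:
  fixes f :: "(nat \<Rightarrow> 'z::polish_space) \<Rightarrow> real"
  assumes bd: "bounded (UNIV :: 'z set)" and t: "t \<le> N" and f: "sd_lipschitz N L f"
  shows "(\<lambda>p. \<integral>y. f (join_coords N t (fst p) y) \<partial>snd p) \<in> Cb (info_space N t)"
proof -
  let ?X = "power_topology t :: (nat \<Rightarrow> 'z) topology" and ?Y = "power_topology (N - t) :: (nat \<Rightarrow> 'z) topology"
  let ?F = "\<lambda>p. \<integral>y. f (join_coords N t (fst p) y) \<partial>snd p"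
  have L0: "0 \<le> L" using f by (rule sd_lipschitzD)
  have fC: "f \<in> Cb (power_topology N)" by (rule Cb_sd_lipschitz[OF bd f])
  obtain M where M: "M \<ge> 0" "\<And>z. z \<in> extensional {1..N} \<Longrightarrow> \<bar>f z\<bar> \<le> M" using CbE[OF fC] by (metis topspace_power)
  have je: "join_coords N t x y \<in> extensional {1..N}" for x y :: "nat \<Rightarrow> 'z" by (simp add: join_coords_def)
  have fx: "(\<lambda>y. f (join_coords N t x y)) \<in> Cb ?Y" if x: "x \<in> extensional {1..t}" for x
  proof -
    have "continuous_map ?Y (prod_topology ?X ?Y) (\<lambda>y. (x, y))" using x by (intro continuous_map_pairedI) auto
    from Cb_compose[OF this Cb_compose[OF continuous_map_join_coords[OF t] fC]] show ?thesis by simp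
  qed
  have avg: "\<bar>\<integral>y. k y \<partial>\<nu>\<bar> \<le> B" if "\<nu> \<in> prob_measures ?Y" "k \<in> Cb ?Y" "\<And>y. \<bar>k y\<bar> \<le> B" for \<nu> k B
  proof -
    interpret prob_space \<nu> by (rule prob_measuresD(1)[OF that(1)])
    have "\<bar>\<integral>y. k y \<partial>\<nu>\<bar> \<le> (\<integral>y. \<bar>k y\<bar> \<partial>\<nu>)" by (rule integral_abs_bound)
    also have "\<dots> \<le> (\<integral>y. B \<partial>\<nu>)" using Cb_integrable[OF that(2,1)] that(3) by (intro integral_mono) auto
    finally show ?thesis by (simp add: prob_space)
  qed
  show ?thesis
  proof (rule CbI[of _ _ M])
    fix p assume "p \<in> topspace (info_space N t :: ((nat \<Rightarrow> 'z) \<times> (nat \<Rightarrow> 'z) measure) topology)"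
    then have p: "fst p \<in> extensional {1..t}" "snd p \<in> prob_measures ?Y" by auto
    show "\<bar>?F p\<bar> \<le> M" by (rule avg[OF p(2) fx[OF p(1)]]) (use M(2) je in auto)
  next
    show "continuous_map (info_space N t) euclideanreal ?F"
    proof (rule continuous_map_real_local_bound)
      fix p assume "p \<in> topspace (info_space N t :: ((nat \<Rightarrow> 'z) \<times> (nat \<Rightarrow> 'z) measure) topology)"
      then have p: "fst p \<in> extensional {1..t}" "snd p \<in> prob_measures ?Y" by auto
      let ?f0 = "\<lambda>y. f (join_coords N t (fst p) y)"
      let ?h = "\<lambda>q. L * sum_dist t (fst q) (fst p) + \<bar>(\<integral>y. ?f0 y \<partial>snd q) - (\<integral>y. ?f0 y \<partial>snd p)\<bar>"
      have "continuous_map (info_space N t) euclideanreal (\<lambda>q. \<integral>y. ?f0 y \<partial>snd q)"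
        using continuous_map_compose[OF continuous_map_snd continuous_map_weak_integral[OF fx[OF p(1)]]] by (simp add: o_def)
      then have "continuous_map (info_space N t) euclideanreal ?h"
        using p by (intro continuous_map_add continuous_map_real_mult continuous_map_sum_dist continuous_map_fst
            continuous_map_real_abs continuous_map_diff) auto
      moreover have "\<bar>?F q - ?F p\<bar> \<le> ?h q" if "q \<in> topspace (info_space N t :: ((nat \<Rightarrow> 'z) \<times> (nat \<Rightarrow> 'z) measure) topology)" for q
      proof -
        have q: "fst q \<in> extensional {1..t}" "snd q \<in> prob_measures ?Y" using that by auto
        note i = Cb_integrable[OF fx[OF q(1)] q(2)] Cb_integrable[OF fx[OF p(1)] q(2)]
        have "\<bar>\<integral>y. f (join_coords N t (fst q) y) - ?f0 y \<partial>snd q\<bar> \<le> L * sum_dist t (fst q) (fst p)"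
        proof (rule avg[OF q(2) Cb_diff[OF fx[OF q(1)] fx[OF p(1)]]])
          fix y show "\<bar>f (join_coords N t (fst q) y) - ?f0 y\<bar> \<le> L * sum_dist t (fst q) (fst p)"
            using sd_lipschitzD(1)[OF f je je, of "fst q" y "fst p" y] by (simp add: sum_dist_join_coords[OF t])
        qed
        then show ?thesis using i by simp
      qed
      ultimately show "\<exists>h. continuous_map (info_space N t) euclideanreal h \<and> h p = 0 \<and>
          (\<forall>q\<in>topspace (info_space N t). \<bar>?F q - ?F p\<bar> \<le> h q)" by (intro exI[of _ ?h]) simp
    qed
  qed
qed

text \<open>A law is determined by \<^const>\<open>information_map\<close>: averaging first over the conditional law and then over the first
coordinates recovers every integral.\<close>

lemma information_integral_kernel_average:
  fixes f :: "(nat \<Rightarrow> 'z::polish_space) \<Rightarrow> real"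
  assumes bd: "bounded (UNIV :: 'z set)" and t: "t \<le> N" and f: "sd_lipschitz N L f"
    and \<mu>: "\<mu> \<in> prob_measures (power_topology N)"
  shows "(\<integral>p. (\<integral>y. f (join_coords N t (fst p) y) \<partial>snd p) \<partial>information_map N t \<mu>) = (\<integral>z. f z \<partial>\<mu>)"
proof -
  have fC: "f \<in> Cb (power_topology N)" by (rule Cb_sd_lipschitz[OF bd f])
  have "(\<integral>p. (\<integral>y. f (join_coords N t (fst p) y) \<partial>snd p) \<partial>information_map N t \<mu>) =
      (\<integral>z. (\<integral>y. f (join_coords N t (first_coords t z) y) \<partial>conditional_law N t \<mu> (first_coords t z)) \<partial>\<mu>)"
    unfolding integral_information_map[OF \<mu> t kernel_average_Cb[OF bd t f]] by simp
  also have "\<dots> = (\<integral>z. f (join_coords N t (first_coords t z) (last_coords N t z)) \<partial>\<mu>)"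
    using integral_conditional_law(1)[OF \<mu> t Cb_compose[OF continuous_map_join_coords[OF t] fC]] by simp
  also have "\<dots> = (\<integral>z. f z \<partial>\<mu>)"
    using t by (intro Bochner_Integration.integral_cong) (auto simp: prob_measuresD(3)[OF \<mu>] join_coords_first_last)
  finally show ?thesis .
qed

text \<open>For Lipschitz \<open>f\<close> the functional \<open>\<mu> \<mapsto> \<integral>f d\<mu>\<close> is the integral of a bounded continuous function against
\<open>information_map N 1 \<mu>\<close>. Nonnegative bounded continuous functions are increasing limits of Lipschitz ones, which
gives lower semicontinuity of their integrals; applied to \<open>M + f\<close> and \<open>M - f\<close> this gives continuity.\<close>

lemma information_finer_than_weak:
  assumes bd: "bounded (UNIV :: 'z::polish_space set)" and N: "N \<ge> 2"
  shows "continuous_map (information_topology N) (weak_topology (power_topology N)) (\<lambda>\<mu> :: (nat \<Rightarrow> 'z) measure. \<mu>)"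
proof (rule continuous_map_into_weak_topology)
  let ?I = "information_topology N :: (nat \<Rightarrow> 'z) measure topology"
  show "(\<lambda>\<mu>. \<mu>) \<in> topspace ?I \<rightarrow> prob_measures (power_topology N)"
    by (simp add: topspace_information_topology[OF N])
  have lip: "continuous_map ?I euclideanreal (\<lambda>\<mu>. \<integral>z. f z \<partial>\<mu>)" if f: "sd_lipschitz N L f" for L and f :: "(nat \<Rightarrow> 'z) \<Rightarrow> real"
  proof -
    have "continuous_map ?I euclideanreal (\<lambda>\<mu>. \<integral>p. (\<integral>y. f (join_coords N 1 (fst p) y) \<partial>snd p) \<partial>information_map N 1 \<mu>)"
      using N by (intro continuous_map_information_integral kernel_average_Cb[OF bd _ f]) auto
    then show ?thesis
      by (rule continuous_map_eq) (use N in \<open>simp add: information_integral_kernel_average[OF bd _ f] topspace_information_topology\<close>)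
  qed
  have lsc: "openin ?I {\<mu> \<in> topspace ?I. a < (\<integral>z. f z \<partial>\<mu>)}"
    if f: "f \<in> Cb (power_topology N)" and nn: "\<And>z. z \<in> topspace (power_topology N) \<Longrightarrow> 0 \<le> f z" for f :: "(nat \<Rightarrow> 'z) \<Rightarrow> real" and a
  proof -
    obtain s where s: "\<And>k. s k \<in> max_hull (power_family N)"
      "\<And>k z. z \<in> topspace (power_topology N) \<Longrightarrow> 0 \<le> s k z \<and> s k z \<le> f z"
      "\<And>z. incseq (\<lambda>k. s k z)"
      "\<And>z. z \<in> topspace (power_topology N) \<Longrightarrow> (\<lambda>k. s k z) \<longlonglongrightarrow> f z"
      by (rule max_hull_increasing_limit[OF separating_power Cb_continuous[OF f]]) (erule nn, rule that)
    obtain Lf where Lf: "\<And>k. sd_lipschitz N (Lf k) (s k)" using max_hull_power_lipschitz[OF s(1)] by metis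
    have sC: "s k \<in> Cb (power_topology N)" for k by (rule Cb_sd_lipschitz[OF bd Lf])
    have eq: "{\<mu> \<in> topspace ?I. a < (\<integral>z. f z \<partial>\<mu>)} = (\<Union>k. {\<mu> \<in> topspace ?I. (\<integral>z. s k z \<partial>\<mu>) \<in> {a<..}})"
    proof (intro set_eqI iffI)
      fix \<mu> assume "\<mu> \<in> {\<mu> \<in> topspace ?I. a < (\<integral>z. f z \<partial>\<mu>)}"
      then have \<mu>: "\<mu> \<in> topspace ?I" "\<mu> \<in> prob_measures (power_topology N)" and a: "a < (\<integral>z. f z \<partial>\<mu>)"
        by (auto simp: topspace_information_topology[OF N])
      have "(\<lambda>k. \<integral>z. s k z \<partial>\<mu>) \<longlonglongrightarrow> (\<integral>z. f z \<partial>\<mu>)"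
        by (rule integral_increasing_limit[OF \<mu>(2) f sC s(2,4)])
      then have "\<forall>\<^sub>F k in sequentially. a < (\<integral>z. s k z \<partial>\<mu>)" using a by (rule order_tendstoD)
      then obtain k where "a < (\<integral>z. s k z \<partial>\<mu>)" by (auto simp: eventually_sequentially)
      then show "\<mu> \<in> (\<Union>k. {\<mu> \<in> topspace ?I. (\<integral>z. s k z \<partial>\<mu>) \<in> {a<..}})" using \<mu>(1) by blast
    next
      fix \<mu> assume "\<mu> \<in> (\<Union>k. {\<mu> \<in> topspace ?I. (\<integral>z. s k z \<partial>\<mu>) \<in> {a<..}})"
      then obtain k where \<mu>: "\<mu> \<in> topspace ?I" "\<mu> \<in> prob_measures (power_topology N)" and a: "a < (\<integral>z. s k z \<partial>\<mu>)"
        by (auto simp: topspace_information_topology[OF N])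
      have "(\<integral>z. s k z \<partial>\<mu>) \<le> (\<integral>z. f z \<partial>\<mu>)"
        using s(2) prob_measuresD(3)[OF \<mu>(2)]
        by (intro integral_mono Cb_integrable[OF sC \<mu>(2)] Cb_integrable[OF f \<mu>(2)]) auto
      then show "\<mu> \<in> {\<mu> \<in> topspace ?I. a < (\<integral>z. f z \<partial>\<mu>)}" using a \<mu>(1) by auto
    qed
    have "openin ?I {\<mu> \<in> topspace ?I. (\<integral>z. s k z \<partial>\<mu>) \<in> {a<..}}" for k
      by (rule openin_continuous_map_preimage[OF lip[OF Lf]]) auto
    then show ?thesis unfolding eq by (intro openin_Union) blast
  qed
  fix f :: "(nat \<Rightarrow> 'z) \<Rightarrow> real" assume f: "f \<in> Cb (power_topology N)"
  obtain M where M: "\<And>z. z \<in> topspace (power_topology N) \<Longrightarrow> \<bar>f z\<bar> \<le> M" using CbE[OF f] by metis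
  have nn: "0 \<le> M + f z" "0 \<le> M - f z" if "z \<in> topspace (power_topology N)" for z using M[OF that] by auto
  show "continuous_map ?I euclideanreal (\<lambda>\<mu>. \<integral>z. f z \<partial>\<mu>)"
    unfolding continuous_map_upper_lower_semicontinuous_lt
  proof (intro conjI allI)
    fix a :: real
    have p: "\<mu> \<in> prob_measures (power_topology N)" if "\<mu> \<in> topspace ?I" for \<mu> using that topspace_information_topology[OF N] by blast
    have "{\<mu> \<in> topspace ?I. M + a < (\<integral>z. M + f z \<partial>\<mu>)} = {\<mu> \<in> topspace ?I. a < (\<integral>z. f z \<partial>\<mu>)}"
      using integral_add_const_prob(1)[OF p f, of _ M] by auto
    then show "openin ?I {\<mu> \<in> topspace ?I. a < (\<integral>z. f z \<partial>\<mu>)}"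
      using lsc[OF Cb_add[OF Cb_const f] nn(1), of "M + a"] by simp
    have "{\<mu> \<in> topspace ?I. M - a < (\<integral>z. M - f z \<partial>\<mu>)} = {\<mu> \<in> topspace ?I. (\<integral>z. f z \<partial>\<mu>) < a}"
      using integral_add_const_prob(2)[OF p f, of _ M] by auto
    then show "openin ?I {\<mu> \<in> topspace ?I. (\<integral>z. f z \<partial>\<mu>) < a}"
      using lsc[OF Cb_diff[OF Cb_const f] nn(2), of "M - a"] by simp
  qed
qed

section \<open>Compactness in the information topology controls the modulus\<close>

lemma nn_integral_submarginal:
  assumes le: "distr \<gamma> \<nu> T \<le> \<nu>" and T: "T \<in> \<gamma> \<rightarrow>\<^sub>M \<nu>" and h: "h \<in> borel_measurable \<nu>"
  shows "(\<integral>\<^sup>+p. h (T p) \<partial>\<gamma>) \<le> (\<integral>\<^sup>+p. h p \<partial>\<nu>)"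
proof -
  have "(\<integral>\<^sup>+p. h (T p) \<partial>\<gamma>) = (\<integral>\<^sup>+p. h p \<partial>distr \<gamma> \<nu> T)" by (rule nn_integral_distr[OF T, symmetric]) (use h in simp)
  also have "\<dots> \<le> (\<integral>\<^sup>+p. h p \<partial>\<nu>)"
    by (rule nn_integral_mono_measure) (use le h in auto)
  finally show ?thesis .
qed

text \<open>Both marginals of a perturbation are dominated by \<open>\<nu>\<close>, so bounds that depend on one of the two points only integrate to
at most their \<open>\<nu>\<close>-integrals, and the coupling enters only through the transport cost in \<open>X\<close>.\<close>

lemma modulus_le:
  assumes \<nu>: "\<nu> \<in> prob_measures (prod_topology X Y)"
    and u: "u \<in> Cb (prod_topology X Y)" "\<And>p. 0 \<le> u p" and v: "v \<in> Cb (prod_topology X Y)" "\<And>p. 0 \<le> v p"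
    and dX: "continuous_map (prod_topology X X) euclideanreal (\<lambda>p. dX (fst p) (snd p))" "\<And>x x'. 0 \<le> dX x x'"
    and bound: "\<And>x1 y1 x2 y2. x1 \<in> topspace X \<Longrightarrow> x2 \<in> topspace X \<Longrightarrow> y1 \<in> topspace Y \<Longrightarrow> y2 \<in> topspace Y \<Longrightarrow>
        dY y1 y2 \<le> e + u (x1, y1) + v (x2, y2) + L * dX x1 x2"
    and "0 \<le> e" "0 \<le> L" "0 \<le> \<delta>"
  shows "modulus_of_continuity X Y dX dY \<nu> \<delta> \<le> ennreal (e + (\<integral>p. u p \<partial>\<nu>) + (\<integral>p. v p \<partial>\<nu>) + L * \<delta>)"
  unfolding modulus_of_continuity_def
proof (rule SUP_least)
  let ?Q = "prod_topology X (prod_topology Y (prod_topology X Y))"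
  let ?p1 = "\<lambda>(x1, y1, x2, y2). (x1, y1)" and ?p2 = "\<lambda>(x1, y1, x2, y2). (x2, y2)"
  fix \<gamma> assume "\<gamma> \<in> perturbations X Y dX \<nu> \<delta>"
  then have \<gamma>: "\<gamma> \<in> subprob_measures ?Q" and le1: "distr \<gamma> \<nu> ?p1 \<le> \<nu>" and le2: "distr \<gamma> \<nu> ?p2 \<le> \<nu>"
    and cost: "(\<integral>\<^sup>+(x1, y1, x2, y2). ennreal (dX x1 x2) \<partial>\<gamma>) \<le> ennreal \<delta>"
    by (auto simp: perturbations_def)
  have sg: "sets \<gamma> = sets (borel_of ?Q)" and sub: "subprob_space \<gamma>" using \<gamma> by (auto simp: space_subprob_algebra)
  have spg: "space \<gamma> = topspace ?Q" using sets_eq_imp_space_eq[OF sg] by simp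
  have e1: "?p1 = (\<lambda>p. (fst p, fst (snd p)))" and e2: "?p2 = (\<lambda>p. snd (snd p))" by (auto simp: fun_eq_iff)
  have c1: "continuous_map ?Q (prod_topology X Y) ?p1" unfolding e1
    by (intro continuous_map_pairedI continuous_map_fst continuous_map_compose[OF continuous_map_snd continuous_map_fst, unfolded o_def])
  have c2: "continuous_map ?Q (prod_topology X Y) ?p2" unfolding e2
    by (intro continuous_map_compose[OF continuous_map_snd continuous_map_snd, unfolded o_def])
  have m1: "?p1 \<in> \<gamma> \<rightarrow>\<^sub>M \<nu>" and m2: "?p2 \<in> \<gamma> \<rightarrow>\<^sub>M \<nu>"
    using continuous_map_measurable[OF c1] continuous_map_measurable[OF c2]
    by (simp_all only: measurable_cong_sets[OF sg prob_measuresD(2)[OF \<nu>]])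
  have ui: "integrable \<nu> u" and vi: "integrable \<nu> v" by (rule Cb_integrable[OF u(1) \<nu>], rule Cb_integrable[OF v(1) \<nu>])
  have cX: "continuous_map ?Q euclideanreal (\<lambda>p. dX (fst p) (fst (snd (snd p))))"
  proof -
    have "continuous_map ?Q (prod_topology X X) (\<lambda>p. (fst p, fst (snd (snd p))))"
      by (intro continuous_map_pairedI continuous_map_fst continuous_map_compose[OF c2[unfolded e2] continuous_map_fst, unfolded o_def])
    from continuous_map_compose[OF this dX(1)] show ?thesis by (simp add: o_def)
  qed
  have mX[measurable]: "(\<lambda>p. dX (fst p) (fst (snd (snd p)))) \<in> borel_measurable \<gamma>"
    using continuous_map_borel_measurable[OF cX] by (simp only: measurable_cong_sets[OF sg refl])
  have um[measurable]: "(\<lambda>p. u (?p1 p)) \<in> borel_measurable \<gamma>" by (rule measurable_compose[OF m1 borel_measurable_integrable[OF ui]])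
  have vm[measurable]: "(\<lambda>p. v (?p2 p)) \<in> borel_measurable \<gamma>" by (rule measurable_compose[OF m2 borel_measurable_integrable[OF vi]])
  have "(\<integral>\<^sup>+(x1, y1, x2, y2). ennreal (dY y1 y2) \<partial>\<gamma>) \<le>
      (\<integral>\<^sup>+p. ((ennreal e + ennreal (u (?p1 p))) + ennreal (v (?p2 p))) + ennreal L * ennreal (dX (fst p) (fst (snd (snd p)))) \<partial>\<gamma>)"
  proof (rule nn_integral_mono)
    fix p assume p: "p \<in> space \<gamma>"
    obtain x1 y1 x2 y2 where pe: "p = (x1, y1, x2, y2)" by (cases p) auto
    have "dY y1 y2 \<le> e + u (x1, y1) + v (x2, y2) + L * dX x1 x2"
      using p unfolding spg pe by (intro bound) auto
    then have "ennreal (dY y1 y2) \<le> ennreal (e + u (x1, y1) + v (x2, y2) + L * dX x1 x2)" by (rule ennreal_leI)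
    also have "\<dots> = ((ennreal e + ennreal (u (x1, y1))) + ennreal (v (x2, y2))) + ennreal L * ennreal (dX x1 x2)"
      using u(2) v(2) dX(2) \<open>0 \<le> e\<close> \<open>0 \<le> L\<close> by (simp add: ennreal_plus ennreal_mult)
    finally show "(case p of (x1, y1, x2, y2) \<Rightarrow> ennreal (dY y1 y2)) \<le>
        ((ennreal e + ennreal (u (?p1 p))) + ennreal (v (?p2 p))) + ennreal L * ennreal (dX (fst p) (fst (snd (snd p))))"
      by (simp add: pe)
  qed
  also have "\<dots> = ((\<integral>\<^sup>+p. ennreal e \<partial>\<gamma>) + (\<integral>\<^sup>+p. ennreal (u (?p1 p)) \<partial>\<gamma>)) + (\<integral>\<^sup>+p. ennreal (v (?p2 p)) \<partial>\<gamma>)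
      + ennreal L * (\<integral>\<^sup>+p. ennreal (dX (fst p) (fst (snd (snd p)))) \<partial>\<gamma>)"
    using um vm mX by (simp add: nn_integral_add nn_integral_cmult)
  also have "\<dots> \<le> ((ennreal e + ennreal (\<integral>p. u p \<partial>\<nu>)) + ennreal (\<integral>p. v p \<partial>\<nu>)) + ennreal L * ennreal \<delta>"
  proof (intro add_mono mult_left_mono)
    have "(\<integral>\<^sup>+p. ennreal e \<partial>\<gamma>) = ennreal e * emeasure \<gamma> (space \<gamma>)" by simp
    also have "\<dots> \<le> ennreal e * 1" by (intro mult_left_mono subprob_space.emeasure_space_le_1[OF sub]) simp
    finally show "(\<integral>\<^sup>+p. ennreal e \<partial>\<gamma>) \<le> ennreal e" by simp
    have "(\<integral>\<^sup>+p. ennreal (u (?p1 p)) \<partial>\<gamma>) \<le> (\<integral>\<^sup>+p. ennreal (u p) \<partial>\<nu>)"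
      using borel_measurable_integrable[OF ui] by (intro nn_integral_submarginal[OF le1 m1]) simp
    also have "\<dots> = ennreal (\<integral>p. u p \<partial>\<nu>)" using ui u(2) by (intro nn_integral_eq_integral) auto
    finally show "(\<integral>\<^sup>+p. ennreal (u (?p1 p)) \<partial>\<gamma>) \<le> ennreal (\<integral>p. u p \<partial>\<nu>)" .
    have "(\<integral>\<^sup>+p. ennreal (v (?p2 p)) \<partial>\<gamma>) \<le> (\<integral>\<^sup>+p. ennreal (v p) \<partial>\<nu>)"
      using borel_measurable_integrable[OF vi] by (intro nn_integral_submarginal[OF le2 m2]) simp
    also have "\<dots> = ennreal (\<integral>p. v p \<partial>\<nu>)" using vi v(2) by (intro nn_integral_eq_integral) auto
    finally show "(\<integral>\<^sup>+p. ennreal (v (?p2 p)) \<partial>\<gamma>) \<le> ennreal (\<integral>p. v p \<partial>\<nu>)" .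
    have "(\<integral>\<^sup>+p. ennreal (dX (fst p) (fst (snd (snd p)))) \<partial>\<gamma>) = (\<integral>\<^sup>+(x1, y1, x2, y2). ennreal (dX x1 x2) \<partial>\<gamma>)"
      by (intro nn_integral_cong) (simp split: prod.split)
    then show "(\<integral>\<^sup>+p. ennreal (dX (fst p) (fst (snd (snd p)))) \<partial>\<gamma>) \<le> ennreal \<delta>" using cost by simp
  qed simp
  also have "\<dots> = ennreal (e + (\<integral>p. u p \<partial>\<nu>) + (\<integral>p. v p \<partial>\<nu>) + L * \<delta>)"
    using u(2) v(2) \<open>0 \<le> e\<close> \<open>0 \<le> L\<close> \<open>0 \<le> \<delta>\<close> by (simp add: ennreal_plus ennreal_mult)
  finally show "(\<integral>\<^sup>+(x1, y1, x2, y2). ennreal (dY y1 y2) \<partial>\<gamma>) \<le> ennreal (e + (\<integral>p. u p \<partial>\<nu>) + (\<integral>p. v p \<partial>\<nu>) + L * \<delta>)" .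
qed


text \<open>The cost of moving between conditional laws is split into terms that depend on one of the two points only. They are
continuous in \<open>(x, y)\<close>, so smallness of their integrals persists on an open set, whereas \<open>x \<mapsto> \<kappa> x\<close> itself is only
measurable: Lipschitz functions \<open>g\<^sub>i\<close> that are close in mean to the integrals of the pieces take over its role.\<close>

lemma W1_le_continuous_cost:
  fixes \<mu> :: "(nat \<Rightarrow> 'z::polish_space) measure"
  assumes bd: "bounded (UNIV :: 'z set)" and t: "t \<le> N" and \<mu>: "\<mu> \<in> prob_measures (power_topology N)" and "\<epsilon> > 0"
  obtains u v L where "u \<in> Cb (info_space N t)" "\<And>p. 0 \<le> u p" "v \<in> Cb (info_space N t)" "\<And>p. 0 \<le> v p" "0 \<le> L"
    "(\<integral>p. u p + v p \<partial>information_map N t \<mu>) < \<epsilon>"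
    "\<And>x1 y1 x2 y2. x1 \<in> extensional {1..t} \<Longrightarrow> x2 \<in> extensional {1..t} \<Longrightarrow>
       y1 \<in> prob_measures (power_topology (N - t)) \<Longrightarrow> y2 \<in> prob_measures (power_topology (N - t)) \<Longrightarrow>
       W1 (N - t) y1 y2 \<le> \<epsilon> + u (x1, y1) + v (x2, y2) + L * sum_dist t x1 x2"
proof -
  let ?X = "power_topology t :: (nat \<Rightarrow> 'z) topology" and ?n = "N - t"
  let ?Y = "power_topology ?n :: (nat \<Rightarrow> 'z) topology"
  let ?IS = "info_space N t :: ((nat \<Rightarrow> 'z) \<times> (nat \<Rightarrow> 'z) measure) topology"
  interpret prob_space \<mu> by (rule prob_measuresD(1)[OF \<mu>])
  obtain D0 where "D0 > 0" and D0: "\<And>x y :: 'z. dist x y \<le> D0" using bounded_dist_bound[OF bd] by metis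
  define D where "D = real ?n * D0 + 1"
  have "D > 0" using \<open>D0 > 0\<close> by (simp add: D_def add_nonneg_pos)
  have D: "sum_dist ?n x y \<le> D" for x y :: "nat \<Rightarrow> 'z" using sum_dist_le[OF D0, of ?n x y] by (simp add: D_def)
  define \<mu>Y where "\<mu>Y = distr \<mu> (borel_of ?Y) (last_coords N t)"
  define \<mu>X where "\<mu>X = distr \<mu> (borel_of ?X) (first_coords t)"
  have \<mu>Y: "\<mu>Y \<in> prob_measures ?Y" unfolding \<mu>Y_def
    by (intro prob_measuresI prob_space_distr measurable_last_coords[OF \<mu> t]) simp
  have \<mu>X: "\<mu>X \<in> prob_measures ?X" unfolding \<mu>X_def
    by (intro prob_measuresI prob_space_distr measurable_first_coords[OF \<mu> t]) simp
  have \<epsilon>D: "\<epsilon> / (2 * D) > 0" using \<open>\<epsilon> > 0\<close> \<open>D > 0\<close> by simp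
  obtain m \<psi> where \<psi>: "subpartition ?n \<epsilon> m \<psi>" and rest: "(\<integral>z. 1 - (\<Sum>i<m. \<psi> i z) \<partial>\<mu>Y) < \<epsilon> / (2 * D)"
    by (rule subpartition_of_unity[OF \<mu>Y \<open>\<epsilon> > 0\<close> \<epsilon>D]) (rule that)
  note \<psi>C = subpartitionD(1)[OF \<psi>] and \<psi>1 = subpartitionD(3)[OF \<psi>]
  let ?rest = "\<lambda>z. 1 - (\<Sum>i<m. \<psi> i z)"
  have restC: "?rest \<in> Cb ?Y" by (intro Cb_diff Cb_const Cb_sum \<psi>C)
  have Ycomp: "(\<lambda>p. f (snd p)) \<in> Cb (prod_topology ?X ?Y)" if "f \<in> Cb ?Y" for f
    by (rule Cb_compose[OF continuous_map_snd that])
  note tower = integral_conditional_law[OF \<mu> t Ycomp]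
  define \<kappa> where "\<kappa> = conditional_law N t \<mu>"
  define p where "p i x = (\<integral>y. \<psi> i y \<partial>\<kappa> x)" for i x
  have pm: "p i \<in> borel_measurable (borel_of ?X)" for i
    unfolding p_def[abs_def] \<kappa>_def
    by (rule measurable_compose[OF measurable_prob_algebraD[OF measurable_conditional_law[OF \<mu> t]]
        integral_measurable_subprob_algebra[OF Cb_measurable[OF \<psi>C]]])
  have pi: "integrable \<mu>X (p i)" for i
    unfolding \<mu>X_def using tower(2)[OF \<psi>C, of i] pm
    by (subst integrable_distr_eq[OF measurable_first_coords[OF \<mu> t]]) (simp_all add: p_def \<kappa>_def)
  \<comment> \<open>The errors of the \<open>m\<close> functions enter twice, with factor \<open>D\<close>, and may use up half of \<open>\<epsilon>\<close> in total.\<close>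
  define e where "e = \<epsilon> / (4 * D * (real m + 1))"
  have "e > 0" using \<open>\<epsilon> > 0\<close> \<open>D > 0\<close> by (simp add: e_def)
  have "\<exists>L g. sd_lipschitz t L g \<and> (\<integral>x. \<bar>p i x - g x\<bar> \<partial>\<mu>X) < e" for i
    by (rule lipschitz_dense_L1[OF bd \<mu>X pi \<open>e > 0\<close>]) blast
  then obtain Lg g where g: "\<And>i. sd_lipschitz t (Lg i) (g i)" and gp: "\<And>i. (\<integral>x. \<bar>p i x - g i x\<bar> \<partial>\<mu>X) < e" by metis
  have gC: "g i \<in> Cb ?X" for i by (rule Cb_sd_lipschitz[OF bd g])
  define d where "d q = (\<Sum>i<m. \<bar>(\<integral>y. \<psi> i y \<partial>snd q) - g i (fst q)\<bar>)" for q
  define c where "c q = (\<integral>y. ?rest y \<partial>snd q)" for q :: "(nat \<Rightarrow> 'z) \<times> (nat \<Rightarrow> 'z) measure"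
  have IC: "(\<lambda>q. \<integral>y. f y \<partial>snd q) \<in> Cb ?IS" if "f \<in> Cb ?Y" for f
    by (rule Cb_compose[OF continuous_map_snd Cb_weak_integral[OF that]])
  have dC: "d \<in> Cb ?IS" unfolding d_def[abs_def]
    by (intro Cb_sum Cb_abs Cb_diff IC \<psi>C Cb_compose[OF continuous_map_fst gC])
  have cC: "c \<in> Cb ?IS" unfolding c_def[abs_def] by (rule IC[OF restC])
  have d0: "0 \<le> d q" for q unfolding d_def by (intro sum_nonneg) auto
  have c0: "0 \<le> c q" for q unfolding c_def using \<psi>1 by (intro integral_nonneg_AE) auto
  define L where "L = D * (\<Sum>i<m. Lg i)"
  show ?thesis
  proof (rule that[of "\<lambda>q. D * (c q + d q)" "\<lambda>q. D * d q" L])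
    show "(\<lambda>q. D * (c q + d q)) \<in> Cb ?IS" "(\<lambda>q. D * d q) \<in> Cb ?IS" by (intro Cb_cmult Cb_add cC dC)+
    show "0 \<le> D * (c q + d q)" "0 \<le> D * d q" for q using c0 d0 \<open>D > 0\<close> by auto
    show "0 \<le> L" unfolding L_def using g[THEN sd_lipschitzD(2)] \<open>D > 0\<close> by (intro mult_nonneg_nonneg sum_nonneg) auto
    have ci: "(\<integral>q. c q \<partial>information_map N t \<mu>) < \<epsilon> / (2 * D)"
    proof -
      have "(\<integral>q. c q \<partial>information_map N t \<mu>) = (\<integral>z. (\<integral>y. ?rest y \<partial>conditional_law N t \<mu> (first_coords t z)) \<partial>\<mu>)"
        unfolding integral_information_map[OF \<mu> t cC] by (simp add: c_def)
      also have "\<dots> = (\<integral>z. ?rest (last_coords N t z) \<partial>\<mu>)" using tower(1)[OF restC] by simp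
      also have "\<dots> = (\<integral>z. ?rest z \<partial>\<mu>Y)" unfolding \<mu>Y_def
        by (rule integral_distr[OF measurable_last_coords[OF \<mu> t] Cb_measurable[OF restC], symmetric])
      finally show ?thesis using rest by simp
    qed
    have di: "(\<integral>q. d q \<partial>information_map N t \<mu>) \<le> real m * e"
    proof -
      have gi: "integrable \<mu>X (g i)" for i by (rule Cb_integrable[OF gC \<mu>X])
      have "(\<integral>q. d q \<partial>information_map N t \<mu>) = (\<integral>z. (\<Sum>i<m. \<bar>p i (first_coords t z) - g i (first_coords t z)\<bar>) \<partial>\<mu>)"
        unfolding integral_information_map[OF \<mu> t dC] by (simp add: d_def p_def \<kappa>_def)
      also have "\<dots> = (\<integral>x. (\<Sum>i<m. \<bar>p i x - g i x\<bar>) \<partial>\<mu>X)" unfolding \<mu>X_def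
        by (rule integral_distr[OF measurable_first_coords[OF \<mu> t], symmetric])
           (intro borel_measurable_sum borel_measurable_abs borel_measurable_diff pm Cb_measurable[OF gC])
      also have "\<dots> = (\<Sum>i<m. \<integral>x. \<bar>p i x - g i x\<bar> \<partial>\<mu>X)"
        by (intro Bochner_Integration.integral_sum integrable_abs Bochner_Integration.integrable_diff pi gi)
      also have "\<dots> \<le> (\<Sum>i<m. e)" using gp by (intro sum_mono) (simp add: less_imp_le)
      finally show ?thesis by simp
    qed
    have "(\<integral>q. D * (c q + d q) + D * d q \<partial>information_map N t \<mu>) =
        D * (\<integral>q. c q \<partial>information_map N t \<mu>) + 2 * D * (\<integral>q. d q \<partial>information_map N t \<mu>)"
      using Cb_integrable[OF cC information_map_prob[OF \<mu> t]] Cb_integrable[OF dC information_map_prob[OF \<mu> t]]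
      by (simp add: algebra_simps)
    also have "\<dots> < D * (\<epsilon> / (2 * D)) + 2 * D * (real m * e)"
      using ci di \<open>D > 0\<close> by (intro add_less_le_mono mult_strict_left_mono mult_left_mono) auto
    also have "\<dots> \<le> \<epsilon>"
    proof -
      have "real m + 1 \<noteq> 0" by linarith
      then have "4 * D * (real m + 1) * e = \<epsilon>" using \<open>D > 0\<close> by (simp add: e_def)
      moreover have "2 * D * (real m * e) \<le> 2 * D * ((real m + 1) * e)"
        using \<open>D > 0\<close> \<open>e > 0\<close> by (intro mult_left_mono mult_right_mono) auto
      ultimately have "2 * D * (real m * e) \<le> \<epsilon> / 2" by (simp add: algebra_simps)
      then show ?thesis using \<open>D > 0\<close> by simp
    qed
    finally show "(\<integral>q. D * (c q + d q) + D * d q \<partial>information_map N t \<mu>) < \<epsilon>" .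
    fix x1 x2 :: "nat \<Rightarrow> 'z" and y1 y2
    assume x: "x1 \<in> extensional {1..t}" "x2 \<in> extensional {1..t}"
      and y: "y1 \<in> prob_measures ?Y" "y2 \<in> prob_measures ?Y"
    have "W1 ?n y1 y2 \<le> \<epsilon> + D * ((\<integral>z. ?rest z \<partial>y1) + (\<Sum>i<m. \<bar>(\<integral>z. \<psi> i z \<partial>y1) - (\<integral>z. \<psi> i z \<partial>y2)\<bar>))"
      by (rule W1_le[OF y \<psi> less_imp_le[OF \<open>\<epsilon> > 0\<close>] D])
    also have "\<dots> \<le> \<epsilon> + D * (c (x1, y1) + (d (x1, y1) + d (x2, y2) + (\<Sum>i<m. Lg i * sum_dist t x1 x2)))"
    proof (intro add_left_mono mult_left_mono add_mono)
      show "(\<integral>z. ?rest z \<partial>y1) \<le> c (x1, y1)" by (simp add: c_def)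
      show "(\<Sum>i<m. \<bar>(\<integral>z. \<psi> i z \<partial>y1) - (\<integral>z. \<psi> i z \<partial>y2)\<bar>) \<le> d (x1, y1) + d (x2, y2) + (\<Sum>i<m. Lg i * sum_dist t x1 x2)"
        unfolding d_def sum.distrib[symmetric]
      proof (rule sum_mono)
        fix i
        show "\<bar>(\<integral>z. \<psi> i z \<partial>y1) - (\<integral>z. \<psi> i z \<partial>y2)\<bar> \<le>
            \<bar>(\<integral>y. \<psi> i y \<partial>snd (x1, y1)) - g i (fst (x1, y1))\<bar> + \<bar>(\<integral>y. \<psi> i y \<partial>snd (x2, y2)) - g i (fst (x2, y2))\<bar> + Lg i * sum_dist t x1 x2"
          using sd_lipschitzD(1)[OF g x, of i] unfolding fst_conv snd_conv by linarith
      qed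
    qed (use \<open>D > 0\<close> in auto)
    also have "\<dots> = \<epsilon> + D * (c (x1, y1) + d (x1, y1)) + D * d (x2, y2) + L * sum_dist t x1 x2"
      unfolding L_def sum_distrib_right[symmetric] by (simp add: algebra_simps)
    finally show "W1 ?n y1 y2 \<le> \<epsilon> + D * (c (x1, y1) + d (x1, y1)) + D * d (x2, y2) + L * sum_dist t x1 x2" .
  qed
qed

text \<open>The functions of the previous lemma bound the modulus at all points of an open set; finitely many of these open sets
cover the compact set, so finitely many Lipschitz constants occur.\<close>

lemma compactin_information_modulus:
  fixes C :: "(nat \<Rightarrow> 'z::polish_space) measure set"
  assumes bd: "bounded (UNIV :: 'z set)" and t: "t \<in> {1..<N}" and C: "compactin (information_topology N) C" and "\<epsilon> > 0"
  obtains \<delta>0 where "\<delta>0 > 0" "\<And>\<delta> \<mu>. 0 \<le> \<delta> \<Longrightarrow> \<delta> \<le> \<delta>0 \<Longrightarrow> \<mu> \<in> C \<Longrightarrow> information_modulus N t \<mu> \<delta> \<le> ennreal \<epsilon>"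
proof -
  let ?I = "information_topology N :: (nat \<Rightarrow> 'z) measure topology"
  have N: "N \<ge> 2" and t': "t \<le> N" using t by auto
  have top: "topspace ?I = prob_measures (power_topology N)" by (rule topspace_information_topology[OF N])
  \<comment> \<open>Each good neighbourhood comes with a linear bound of the modulus, uniform over the neighbourhood.\<close>
  define good where "good U L \<longleftrightarrow> openin ?I U \<and> L \<ge> 0 \<and>
    (\<forall>\<mu>\<in>U. \<forall>\<delta>\<ge>0. information_modulus N t \<mu> \<delta> \<le> ennreal (2 * (\<epsilon> / 3) + L * \<delta>))" for U L
  have nbhd: "\<exists>U L. \<mu> \<in> U \<and> good U L" if "\<mu> \<in> C" for \<mu>
  proof -
    have \<mu>: "\<mu> \<in> prob_measures (power_topology N)" using compactin_subset_topspace[OF C] that top by auto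
    have "\<epsilon> / 3 > 0" using \<open>\<epsilon> > 0\<close> by simp
    obtain u v L where u: "u \<in> Cb (info_space N t)" "\<And>p. 0 \<le> u p" and v: "v \<in> Cb (info_space N t)" "\<And>p. 0 \<le> v p" and L: "0 \<le> L"
      and small: "(\<integral>p. u p + v p \<partial>information_map N t \<mu>) < \<epsilon> / 3"
      and bound: "\<And>x1 y1 x2 y2. x1 \<in> extensional {1..t} \<Longrightarrow> x2 \<in> extensional {1..t} \<Longrightarrow>
       y1 \<in> prob_measures (power_topology (N - t)) \<Longrightarrow> y2 \<in> prob_measures (power_topology (N - t)) \<Longrightarrow>
       W1 (N - t) y1 y2 \<le> \<epsilon> / 3 + u (x1, y1) + v (x2, y2) + L * sum_dist t x1 x2"
      by (rule W1_le_continuous_cost[OF bd t' \<mu> \<open>\<epsilon> / 3 > 0\<close>]) (rule that)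
    define U where "U = {\<mu> \<in> topspace ?I. (\<integral>p. u p + v p \<partial>information_map N t \<mu>) \<in> {..<\<epsilon> / 3}}"
    have "openin ?I U" unfolding U_def
      by (rule openin_continuous_map_preimage[OF continuous_map_information_integral[OF t Cb_add[OF u(1) v(1)]]]) auto
    moreover have "information_modulus N t \<nu> \<delta> \<le> ennreal (2 * (\<epsilon> / 3) + L * \<delta>)" if "\<nu> \<in> U" "0 \<le> \<delta>" for \<nu> \<delta>
    proof -
      have \<nu>: "\<nu> \<in> prob_measures (power_topology N)" and le: "(\<integral>p. u p + v p \<partial>information_map N t \<nu>) < \<epsilon> / 3"
        using that(1) top by (auto simp: U_def)
      have I\<nu>: "information_map N t \<nu> \<in> prob_measures (info_space N t)" by (rule information_map_prob[OF \<nu> t'])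
      have "information_modulus N t \<nu> \<delta> \<le> ennreal (\<epsilon> / 3 + (\<integral>p. u p \<partial>information_map N t \<nu>) + (\<integral>p. v p \<partial>information_map N t \<nu>) + L * \<delta>)"
        unfolding information_modulus_def
      proof (rule modulus_le[OF I\<nu> u v])
        show "continuous_map (prod_topology (power_topology t) (power_topology t)) euclideanreal (\<lambda>p. sum_dist t (fst p) (snd p :: nat \<Rightarrow> 'z))"
          by (intro continuous_map_sum_dist continuous_map_fst continuous_map_snd)
      qed (use bound L \<open>\<epsilon> > 0\<close> that(2) in auto)
      also have "\<dots> \<le> ennreal (2 * (\<epsilon> / 3) + L * \<delta>)"
        using le Cb_integrable[OF u(1) I\<nu>] Cb_integrable[OF v(1) I\<nu>] by (intro ennreal_leI) simp
      finally show ?thesis .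
    qed
    moreover have "\<mu> \<in> U" using small \<mu> top by (simp add: U_def)
    ultimately show ?thesis unfolding good_def using L by blast
  qed
  then obtain U L where U: "\<And>\<mu>. \<mu> \<in> C \<Longrightarrow> \<mu> \<in> U \<mu>" "\<And>\<mu>. \<mu> \<in> C \<Longrightarrow> good (U \<mu>) (L \<mu>)" by metis
  obtain F where F: "finite F" "F \<subseteq> U ` C" "C \<subseteq> \<Union>F"
    using compactinD[OF C, of "U ` C"] U unfolding good_def by blast
  obtain C' where C': "C' \<subseteq> C" "finite C'" "F = U ` C'" using finite_subset_image[OF F(1,2)] by metis
  define M where "M = Max (insert 0 (L ` C'))"
  have M: "0 \<le> M" "\<And>\<mu>. \<mu> \<in> C' \<Longrightarrow> L \<mu> \<le> M" using C'(2) by (auto simp: M_def)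
  show ?thesis
  proof (rule that[of "\<epsilon> / 3 / (M + 1)"])
    show "\<epsilon> / 3 / (M + 1) > 0" using \<open>\<epsilon> > 0\<close> M(1) by simp
    fix \<delta> \<mu> assume \<delta>: "0 \<le> \<delta>" "\<delta> \<le> \<epsilon> / 3 / (M + 1)" and "\<mu> \<in> C"
    then obtain \<nu> where \<nu>: "\<nu> \<in> C'" "\<mu> \<in> U \<nu>" using F(3) C'(3) by auto
    then have "information_modulus N t \<mu> \<delta> \<le> ennreal (2 * (\<epsilon> / 3) + L \<nu> * \<delta>)"
      using U(2)[of \<nu>] C'(1) \<delta>(1) by (auto simp: good_def)
    also have "\<dots> \<le> ennreal \<epsilon>"
    proof (rule ennreal_leI)
      have "L \<nu> * \<delta> \<le> (M + 1) * \<delta>" using M(2)[OF \<nu>(1)] \<delta>(1) by (intro mult_right_mono) auto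
      also have "\<dots> \<le> \<epsilon> / 3" using \<delta>(2) M(1) by (simp add: field_simps)
      finally show "2 * (\<epsilon> / 3) + L \<nu> * \<delta> \<le> \<epsilon>" by simp
    qed
    finally show "information_modulus N t \<mu> \<delta> \<le> ennreal \<epsilon>" .
  qed
qed

section \<open>Local averages of conditional expectations\<close>

text \<open>The value \<open>c i\<close> is the average of \<open>q\<close> with weight \<open>F i\<close>. Its distance from \<open>q z\<close> is at most the average distance of
\<open>q z'\<close> from \<open>q z\<close>, so the deviation is bounded by the oscillation of \<open>q\<close> between a point and a second one that is
drawn independently and reweighted by \<open>\<Sum>\<^sub>i F\<^sub>i(z) F\<^sub>i(z') / a\<^sub>i\<close>.\<close>

lemma (in prob_space) local_average_deviation:
  fixes F :: "nat \<Rightarrow> 'a \<Rightarrow> real" and q :: "'a \<Rightarrow> real"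
  assumes F: "\<And>i. F i \<in> borel_measurable M" "\<And>i z. z \<in> space M \<Longrightarrow> 0 \<le> F i z" "\<And>i z. z \<in> space M \<Longrightarrow> F i z \<le> 1"
    and q: "q \<in> borel_measurable M" "\<And>z. z \<in> space M \<Longrightarrow> \<bar>q z\<bar> \<le> B"
  defines "a \<equiv> \<lambda>i. \<integral>z. F i z \<partial>M"
  defines "c \<equiv> \<lambda>i. (\<integral>z. F i z * q z \<partial>M) / a i"
  shows "ennreal (\<integral>z. (\<Sum>i<m. F i z * \<bar>q z - c i\<bar>) \<partial>M) \<le>
      (\<integral>\<^sup>+z. \<integral>\<^sup>+z'. ennreal ((\<Sum>i<m. F i z * F i z' / a i) * \<bar>q z - q z'\<bar>) \<partial>M \<partial>M)"
proof -
  note [measurable] = F(1) q(1)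
  have Fi: "integrable M (F i)" for i
    by (rule integrable_const_bound[of _ 1]) (use F in auto)
  have B0: "0 \<le> B" using not_empty q(2) by (metis abs_ge_zero ex_in_conv order_trans)
  have Fqi: "integrable M (\<lambda>z. F i z * q z)" for i
  proof (rule integrable_const_bound[of _ B])
    show "AE z in M. norm (F i z * q z) \<le> B"
    proof (rule AE_I2)
      fix z assume z: "z \<in> space M"
      have "\<bar>F i z\<bar> * \<bar>q z\<bar> \<le> 1 * B" by (intro mult_mono q z) (use F z in auto)
      then show "norm (F i z * q z) \<le> B" by (simp add: abs_mult)
    qed
  qed measurable
  have ae: "(\<integral>z. F i z \<partial>M) = a i" for i by (simp add: a_def)
  have a0: "0 \<le> a i" for i unfolding a_def using F(2) by (intro integral_nonneg_AE) auto
  have null: "AE z in M. a i = 0 \<longrightarrow> F i z = 0" for i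
  proof (cases "a i = 0")
    case True
    then have "AE z in M. F i z = 0"
      unfolding a_def using F(2) Fi by (subst (asm) integral_nonneg_eq_0_iff_AE) auto
    then show ?thesis by eventually_elim simp
  qed simp
  then have AEn: "AE z in M. \<forall>i\<in>{..<m}. a i = 0 \<longrightarrow> F i z = 0" by (simp add: AE_ball_countable)
  have Fqd: "integrable M (\<lambda>z. F i z * \<bar>q z - c i\<bar>)" for i
  proof (rule integrable_const_bound[of _ "B + \<bar>c i\<bar>"])
    show "AE z in M. norm (F i z * \<bar>q z - c i\<bar>) \<le> B + \<bar>c i\<bar>"
    proof (rule AE_I2)
      fix z assume z: "z \<in> space M"
      have "\<bar>F i z\<bar> * \<bar>q z - c i\<bar> \<le> 1 * (B + \<bar>c i\<bar>)" by (intro mult_mono) (use F z q(2)[OF z] in auto)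
      then show "norm (F i z * \<bar>q z - c i\<bar>) \<le> B + \<bar>c i\<bar>" by (simp add: abs_mult)
    qed
  qed measurable
  have "ennreal (\<integral>z. (\<Sum>i<m. F i z * \<bar>q z - c i\<bar>) \<partial>M) = (\<integral>\<^sup>+z. ennreal (\<Sum>i<m. F i z * \<bar>q z - c i\<bar>) \<partial>M)"
    using Fqd F(2) by (intro nn_integral_eq_integral[symmetric] AE_I2 sum_nonneg) auto
  also have "\<dots> \<le> (\<integral>\<^sup>+z. \<integral>\<^sup>+z'. ennreal ((\<Sum>i<m. F i z * F i z' / a i) * \<bar>q z - q z'\<bar>) \<partial>M \<partial>M)"
  proof (rule nn_integral_mono_AE)
    show "AE z in M. ennreal (\<Sum>i<m. F i z * \<bar>q z - c i\<bar>) \<le>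
        (\<integral>\<^sup>+z'. ennreal ((\<Sum>i<m. F i z * F i z' / a i) * \<bar>q z - q z'\<bar>) \<partial>M)"
      using AEn AE_space
    proof eventually_elim
      case (elim z)
      then have z: "z \<in> space M" and nz: "\<And>i. i < m \<Longrightarrow> a i = 0 \<Longrightarrow> F i z = 0" by auto
      have Fqq: "integrable M (\<lambda>z'. F i z' * \<bar>q z - q z'\<bar>)" for i
      proof (rule integrable_const_bound[of _ "2 * B"])
        show "AE z' in M. norm (F i z' * \<bar>q z - q z'\<bar>) \<le> 2 * B"
        proof (rule AE_I2)
          fix z' assume z': "z' \<in> space M"
          have "\<bar>F i z'\<bar> * \<bar>q z - q z'\<bar> \<le> 1 * (2 * B)"
            by (intro mult_mono) (use F z' q(2)[OF z] q(2)[OF z'] in auto)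
          then show "norm (F i z' * \<bar>q z - q z'\<bar>) \<le> 2 * B" by (simp add: abs_mult)
        qed
      qed measurable
      have le: "F i z * \<bar>q z - c i\<bar> \<le> F i z / a i * (\<integral>z'. F i z' * \<bar>q z - q z'\<bar> \<partial>M)" if i: "i < m" for i
      proof (cases "a i = 0")
        case True then show ?thesis using nz[OF i] by simp
      next
        case False
        then have ap: "a i > 0" using a0[of i] by simp
        have "a i * \<bar>q z - c i\<bar> = \<bar>a i * q z - a i * c i\<bar>"
          using ap by (simp add: right_diff_distrib[symmetric] abs_mult)
        also have "a i * q z - a i * c i = (\<integral>z'. F i z' * (q z - q z') \<partial>M)"
          using ap Fi[of i] Fqi[of i] by (simp add: c_def ae right_diff_distrib)
        also have "\<bar>\<dots>\<bar> \<le> (\<integral>z'. \<bar>F i z' * (q z - q z')\<bar> \<partial>M)" by (rule integral_abs_bound)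
        also have "\<dots> = (\<integral>z'. F i z' * \<bar>q z - q z'\<bar> \<partial>M)"
          using F(2) by (intro Bochner_Integration.integral_cong) (auto simp: abs_mult)
        finally have "\<bar>q z - c i\<bar> \<le> (\<integral>z'. F i z' * \<bar>q z - q z'\<bar> \<partial>M) / a i" using ap by (simp add: field_simps)
        then have "F i z * \<bar>q z - c i\<bar> \<le> F i z * ((\<integral>z'. F i z' * \<bar>q z - q z'\<bar> \<partial>M) / a i)"
          using F(2)[OF z] by (rule mult_left_mono)
        then show ?thesis by simp
      qed
      have eq: "(\<Sum>i<m. F i z * F i z' / a i) * \<bar>q z - q z'\<bar> = (\<Sum>i<m. F i z / a i * (F i z' * \<bar>q z - q z'\<bar>))" for z'
        unfolding sum_distrib_right by (intro sum.cong refl) simp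
      have "(\<Sum>i<m. F i z * \<bar>q z - c i\<bar>) \<le> (\<Sum>i<m. F i z / a i * (\<integral>z'. F i z' * \<bar>q z - q z'\<bar> \<partial>M))"
        by (intro sum_mono le) simp
      also have "\<dots> = (\<integral>z'. (\<Sum>i<m. F i z / a i * (F i z' * \<bar>q z - q z'\<bar>)) \<partial>M)"
        using Fqq by (subst Bochner_Integration.integral_sum) (simp_all only: integrable_mult_right integral_mult_right_zero)
      finally have "ennreal (\<Sum>i<m. F i z * \<bar>q z - c i\<bar>) \<le> ennreal (\<integral>z'. (\<Sum>i<m. F i z / a i * (F i z' * \<bar>q z - q z'\<bar>)) \<partial>M)"
        by (rule ennreal_leI)
      also have "\<dots> = (\<integral>\<^sup>+z'. ennreal (\<Sum>i<m. F i z / a i * (F i z' * \<bar>q z - q z'\<bar>)) \<partial>M)"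
      proof (rule nn_integral_eq_integral[symmetric])
        show "integrable M (\<lambda>z'. \<Sum>i<m. F i z / a i * (F i z' * \<bar>q z - q z'\<bar>))"
          by (intro Bochner_Integration.integrable_sum integrable_mult_right Fqq)
        show "AE z' in M. 0 \<le> (\<Sum>i<m. F i z / a i * (F i z' * \<bar>q z - q z'\<bar>))"
          using F(2) z a0 by (intro AE_I2 sum_nonneg mult_nonneg_nonneg divide_nonneg_nonneg) auto
      qed
      finally show ?case unfolding eq .
    qed
  qed
  finally show ?thesis .
qed

lemma measure_leI:
  assumes "sets M = sets N" "\<And>A. A \<in> sets N \<Longrightarrow> emeasure M A \<le> emeasure N A"
  shows "M \<le> N"
proof -
  have "emeasure M A \<le> emeasure N A" for A
    using assms by (cases "A \<in> sets N") (auto simp: emeasure_notin_sets)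
  then show ?thesis
    using assms(1) sets_eq_imp_space_eq[OF assms(1)] by (simp add: le_measure_iff le_fun_def)
qed

text \<open>The weight \<open>w\<close> turns two independent samples \<open>z, z'\<close> into a pair of nearby points. The law of
\<open>(x, \<kappa> x, x', \<kappa> x')\<close> under this weight is a perturbation of the information map: its marginals are dominated because \<open>w\<close> has
fibre integrals at most \<open>1\<close>, and it moves mass by at most \<open>\<delta>\<close>. Along it \<open>|p z - p z'| \<le> W\<^sub>1(\<kappa> x, \<kappa> x')\<close>.\<close>

lemma averaged_oscillation_le_modulus:
  fixes \<mu> :: "(nat \<Rightarrow> 'z::polish_space) measure"
  assumes bd: "bounded (UNIV :: 'z set)" and t: "t \<le> N" and \<mu>: "\<mu> \<in> prob_measures (power_topology N)"
    and wm: "(\<lambda>r. w (fst r) (snd r)) \<in> borel_measurable (\<mu> \<Otimes>\<^sub>M \<mu>)" and w0: "\<And>z z'. 0 \<le> w z z'"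
    and wsym: "\<And>z z'. w z z' = w z' z" and wint: "\<And>z. (\<integral>\<^sup>+z'. ennreal (w z z') \<partial>\<mu>) \<le> 1"
    and wsupp: "\<And>z z'. w z z' \<noteq> 0 \<Longrightarrow> sum_dist t (first_coords t z) (first_coords t z') \<le> \<delta>"
    and f: "sd_lipschitz (N - t) 1 f"
    and p: "p = (\<lambda>z. \<integral>y. f y \<partial>conditional_law N t \<mu> (first_coords t z))"
  shows "(\<integral>\<^sup>+z. \<integral>\<^sup>+z'. ennreal (w z z' * \<bar>p z - p z'\<bar>) \<partial>\<mu> \<partial>\<mu>) \<le> information_modulus N t \<mu> \<delta>"
proof -
  let ?X = "power_topology t :: (nat \<Rightarrow> 'z) topology" and ?PY = "weak_topology (power_topology (N - t)) :: (nat \<Rightarrow> 'z) measure topology"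
  let ?Q = "prod_topology ?X (prod_topology ?PY (prod_topology ?X ?PY))"
  let ?\<kappa> = "\<lambda>z. conditional_law N t \<mu> (first_coords t z)"
  let ?\<nu> = "information_map N t \<mu>"
  interpret prob_space \<mu> by (rule prob_measuresD(1)[OF \<mu>])
  interpret P: pair_prob_space \<mu> \<mu> ..
  have first: "first_coords t \<in> \<mu> \<rightarrow>\<^sub>M borel_of ?X" by (rule measurable_first_coords[OF \<mu> t])
  note [measurable] = wm
  have wm1: "(\<lambda>z'. ennreal (w z z')) \<in> borel_measurable \<mu>" if "z \<in> space \<mu>" for z
    using measurable_compose[OF measurable_Pair1'[OF that] wm] by simp
  have fC: "f \<in> Cb (power_topology (N - t))" by (rule Cb_sd_lipschitz[OF bd f])
  have fint: "(\<lambda>y. \<integral>x. f x \<partial>y) \<in> Cb ?PY" by (rule Cb_weak_integral[OF fC])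
  have \<kappa>m: "?\<kappa> \<in> \<mu> \<rightarrow>\<^sub>M borel_of ?PY"
    by (rule measurable_compose[OF first measurable_kernel_into_weak[OF separating_power measurable_conditional_law[OF \<mu> t]]])
  define T where "T r = (first_coords t (fst r), ?\<kappa> (fst r), first_coords t (snd r), ?\<kappa> (snd r))" for r
  have Tm[measurable]: "T \<in> \<mu> \<Otimes>\<^sub>M \<mu> \<rightarrow>\<^sub>M borel_of ?Q"
    unfolding T_def
    by (intro measurable_Pair_borel_of[OF separating_power separating_prod[OF separating_weak_power separating_info_space]]
        measurable_Pair_borel_of[OF separating_weak_power separating_info_space]
        measurable_Pair_borel_of[OF separating_power separating_weak_power]
        measurable_compose[OF measurable_fst first] measurable_compose[OF measurable_fst \<kappa>m]
        measurable_compose[OF measurable_snd first] measurable_compose[OF measurable_snd \<kappa>m])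
  define D where "D = density (\<mu> \<Otimes>\<^sub>M \<mu>) (\<lambda>r. ennreal (w (fst r) (snd r)))"
  define \<gamma> where "\<gamma> = distr D (borel_of ?Q) T"
  have TD: "T \<in> D \<rightarrow>\<^sub>M borel_of ?Q" using Tm by (simp add: D_def)
  have \<gamma>int: "(\<integral>\<^sup>+r. h r \<partial>\<gamma>) = (\<integral>\<^sup>+z. \<integral>\<^sup>+z'. ennreal (w z z') * h (T (z, z')) \<partial>\<mu> \<partial>\<mu>)"
    if h: "h \<in> borel_measurable (borel_of ?Q)" for h
  proof -
    have [measurable]: "(\<lambda>r. h (T r)) \<in> borel_measurable (\<mu> \<Otimes>\<^sub>M \<mu>)" by (rule measurable_compose[OF Tm h])
    have wh: "(\<lambda>r. ennreal (w (fst r) (snd r)) * h (T r)) \<in> borel_measurable (\<mu> \<Otimes>\<^sub>M \<mu>)" by measurable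
    have "(\<integral>\<^sup>+r. h r \<partial>\<gamma>) = (\<integral>\<^sup>+r. h (T r) \<partial>D)" unfolding \<gamma>_def by (rule nn_integral_distr[OF TD]) (use h in simp)
    also have "\<dots> = (\<integral>\<^sup>+r. ennreal (w (fst r) (snd r)) * h (T r) \<partial>(\<mu> \<Otimes>\<^sub>M \<mu>))"
      unfolding D_def by (rule nn_integral_density) measurable
    also have "\<dots> = (\<integral>\<^sup>+z. \<integral>\<^sup>+z'. ennreal (w z z') * h (T (z, z')) \<partial>\<mu> \<partial>\<mu>)"
      using nn_integral_fst[OF wh] by simp
    finally show ?thesis .
  qed
  have \<gamma>int': "(\<integral>\<^sup>+r. h r \<partial>\<gamma>) = (\<integral>\<^sup>+z'. \<integral>\<^sup>+z. ennreal (w z z') * h (T (z, z')) \<partial>\<mu> \<partial>\<mu>)"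
    if h: "h \<in> borel_measurable (borel_of ?Q)" for h
  proof -
    have [measurable]: "(\<lambda>r. h (T r)) \<in> borel_measurable (\<mu> \<Otimes>\<^sub>M \<mu>)" by (rule measurable_compose[OF Tm h])
    have wh: "(\<lambda>r. ennreal (w (fst r) (snd r)) * h (T r)) \<in> borel_measurable (\<mu> \<Otimes>\<^sub>M \<mu>)" by measurable
    have "(\<integral>\<^sup>+r. h r \<partial>\<gamma>) = (\<integral>\<^sup>+r. h (T r) \<partial>D)" unfolding \<gamma>_def by (rule nn_integral_distr[OF TD]) (use h in simp)
    also have "\<dots> = (\<integral>\<^sup>+r. ennreal (w (fst r) (snd r)) * h (T r) \<partial>(\<mu> \<Otimes>\<^sub>M \<mu>))"
      unfolding D_def by (rule nn_integral_density) measurable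
    also have "\<dots> = (\<integral>\<^sup>+z'. \<integral>\<^sup>+z. ennreal (w z z') * h (T (z, z')) \<partial>\<mu> \<partial>\<mu>)"
      using P.nn_integral_snd[OF wh] by simp
    finally show ?thesis .
  qed
  have I\<nu>: "?\<nu> \<in> prob_measures (info_space N t)" by (rule information_map_prob[OF \<mu> t])
  have s\<gamma>: "sets \<gamma> = sets (borel_of ?Q)" by (simp add: \<gamma>_def)
  have sp\<gamma>: "space \<gamma> = topspace ?Q" by (simp add: \<gamma>_def)
  let ?p1 = "\<lambda>(x1 :: nat \<Rightarrow> 'z, y1 :: (nat \<Rightarrow> 'z) measure, x2 :: nat \<Rightarrow> 'z, y2 :: (nat \<Rightarrow> 'z) measure). (x1, y1)"
  let ?p2 = "\<lambda>(x1 :: nat \<Rightarrow> 'z, y1 :: (nat \<Rightarrow> 'z) measure, x2 :: nat \<Rightarrow> 'z, y2 :: (nat \<Rightarrow> 'z) measure). (x2, y2)"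
  have e1: "?p1 = (\<lambda>p. (fst p, fst (snd p)))" and e2: "?p2 = (\<lambda>p. snd (snd p))" by (auto simp: fun_eq_iff)
  have c1: "continuous_map ?Q (info_space N t) ?p1" unfolding e1
    by (intro continuous_map_pairedI continuous_map_fst continuous_map_compose[OF continuous_map_snd continuous_map_fst, unfolded o_def])
  have c2: "continuous_map ?Q (info_space N t) ?p2" unfolding e2
    by (intro continuous_map_compose[OF continuous_map_snd continuous_map_snd, unfolded o_def])
  have m1: "?p1 \<in> borel_of ?Q \<rightarrow>\<^sub>M borel_of (info_space N t)" and m2: "?p2 \<in> borel_of ?Q \<rightarrow>\<^sub>M borel_of (info_space N t)"
    by (rule continuous_map_measurable[OF c1], rule continuous_map_measurable[OF c2])
  have n1: "?p1 \<in> \<gamma> \<rightarrow>\<^sub>M ?\<nu>" and n2: "?p2 \<in> \<gamma> \<rightarrow>\<^sub>M ?\<nu>"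
    using m1 m2 by (simp_all only: measurable_cong_sets[OF s\<gamma> prob_measuresD(2)[OF I\<nu>]])
  have \<nu>A: "emeasure ?\<nu> A = (\<integral>\<^sup>+z. indicator A (info_pair N t \<mu> z) \<partial>\<mu>)" if A: "A \<in> sets ?\<nu>" for A
  proof -
    have A': "A \<in> sets (borel_of (info_space N t))" using A prob_measuresD(2)[OF I\<nu>] by simp
    have "emeasure ?\<nu> A = (\<integral>\<^sup>+r. indicator A r \<partial>?\<nu>)" using A by simp
    also have "\<dots> = (\<integral>\<^sup>+z. indicator A (info_pair N t \<mu> z) \<partial>\<mu>)"
      unfolding information_map_eq[OF \<mu> t]
      by (rule nn_integral_distr[OF measurable_info_pair[OF \<mu> t]]) (use A' in simp)
    finally show ?thesis .
  qed
  have marg1: "distr \<gamma> ?\<nu> ?p1 \<le> ?\<nu>"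
  proof (rule measure_leI)
    fix A assume A: "A \<in> sets ?\<nu>"
    have A': "A \<in> sets (borel_of (info_space N t))" using A prob_measuresD(2)[OF I\<nu>] by simp
    have hA: "(\<lambda>r. indicator A (?p1 r) :: ennreal) \<in> borel_measurable (borel_of ?Q)"
      by (rule measurable_compose[OF m1 borel_measurable_indicator[OF A']])
    have "emeasure (distr \<gamma> ?\<nu> ?p1) A = (\<integral>\<^sup>+r. indicator A r \<partial>distr \<gamma> ?\<nu> ?p1)" using A by simp
    also have "\<dots> = (\<integral>\<^sup>+r. indicator A (?p1 r) \<partial>\<gamma>)" by (rule nn_integral_distr[OF n1]) (use A in simp)
    also have "\<dots> = (\<integral>\<^sup>+z. \<integral>\<^sup>+z'. ennreal (w z z') * indicator A (info_pair N t \<mu> z) \<partial>\<mu> \<partial>\<mu>)"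
      unfolding \<gamma>int[OF hA] by (simp add: T_def info_pair_def)
    also have "\<dots> = (\<integral>\<^sup>+z. (\<integral>\<^sup>+z'. ennreal (w z z') \<partial>\<mu>) * indicator A (info_pair N t \<mu> z) \<partial>\<mu>)"
      by (intro nn_integral_cong nn_integral_multc wm1)
    also have "\<dots> \<le> (\<integral>\<^sup>+z. 1 * indicator A (info_pair N t \<mu> z) \<partial>\<mu>)"
      by (intro nn_integral_mono mult_right_mono wint) simp
    also have "\<dots> = emeasure ?\<nu> A" using \<nu>A[OF A] by simp
    finally show "emeasure (distr \<gamma> ?\<nu> ?p1) A \<le> emeasure ?\<nu> A" .
  qed simp
  have marg2: "distr \<gamma> ?\<nu> ?p2 \<le> ?\<nu>"
  proof (rule measure_leI)
    fix A assume A: "A \<in> sets ?\<nu>"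
    have A': "A \<in> sets (borel_of (info_space N t))" using A prob_measuresD(2)[OF I\<nu>] by simp
    have hA: "(\<lambda>r. indicator A (?p2 r) :: ennreal) \<in> borel_measurable (borel_of ?Q)"
      by (rule measurable_compose[OF m2 borel_measurable_indicator[OF A']])
    have "emeasure (distr \<gamma> ?\<nu> ?p2) A = (\<integral>\<^sup>+r. indicator A r \<partial>distr \<gamma> ?\<nu> ?p2)" using A by simp
    also have "\<dots> = (\<integral>\<^sup>+r. indicator A (?p2 r) \<partial>\<gamma>)" by (rule nn_integral_distr[OF n2]) (use A in simp)
    also have "\<dots> = (\<integral>\<^sup>+z'. \<integral>\<^sup>+z. ennreal (w z' z) * indicator A (info_pair N t \<mu> z') \<partial>\<mu> \<partial>\<mu>)"
      unfolding \<gamma>int'[OF hA] by (subst wsym) (simp add: T_def info_pair_def)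
    also have "\<dots> = (\<integral>\<^sup>+z'. (\<integral>\<^sup>+z. ennreal (w z' z) \<partial>\<mu>) * indicator A (info_pair N t \<mu> z') \<partial>\<mu>)"
      by (intro nn_integral_cong nn_integral_multc wm1)
    also have "\<dots> \<le> (\<integral>\<^sup>+z. 1 * indicator A (info_pair N t \<mu> z) \<partial>\<mu>)"
      by (intro nn_integral_mono mult_right_mono wint) simp
    also have "\<dots> = emeasure ?\<nu> A" using \<nu>A[OF A] by simp
    finally show "emeasure (distr \<gamma> ?\<nu> ?p2) A \<le> emeasure ?\<nu> A" .
  qed simp
  have total: "(\<integral>\<^sup>+z. \<integral>\<^sup>+z'. ennreal (w z z') \<partial>\<mu> \<partial>\<mu>) \<le> 1"
  proof -
    have "(\<integral>\<^sup>+z. \<integral>\<^sup>+z'. ennreal (w z z') \<partial>\<mu> \<partial>\<mu>) \<le> (\<integral>\<^sup>+z. 1 \<partial>\<mu>)" by (intro nn_integral_mono wint)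
    then show ?thesis by (simp add: emeasure_space_1)
  qed
  have sub: "subprob_space \<gamma>"
  proof
    have "emeasure \<gamma> (space \<gamma>) = (\<integral>\<^sup>+r. 1 \<partial>\<gamma>)" by simp
    also have "\<dots> = (\<integral>\<^sup>+z. \<integral>\<^sup>+z'. ennreal (w z z') * 1 \<partial>\<mu> \<partial>\<mu>)" by (rule \<gamma>int) simp
    also have "\<dots> \<le> 1" using total by simp
    finally show "emeasure \<gamma> (space \<gamma>) \<le> 1" .
    obtain z where "z \<in> space \<mu>" using not_empty by blast
    then have "T (z, z) \<in> space (borel_of ?Q)" by (intro measurable_space[OF Tm]) (simp add: space_pair_measure)
    then show "space \<gamma> \<noteq> {}" by (auto simp: \<gamma>_def)
  qed
  have cX: "continuous_map ?Q euclideanreal (\<lambda>r. sum_dist t (fst r) (fst (snd (snd r))))"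
    by (intro continuous_map_sum_dist continuous_map_fst continuous_map_compose[OF c2[unfolded e2] continuous_map_fst, unfolded o_def])
  have cost: "(\<integral>\<^sup>+(x1, y1, x2, y2). ennreal (sum_dist t x1 x2) \<partial>\<gamma>) \<le> ennreal \<delta>"
  proof -
    have h: "(\<lambda>r. ennreal (sum_dist t (fst r) (fst (snd (snd r))))) \<in> borel_measurable (borel_of ?Q)"
      using continuous_map_borel_measurable[OF cX] by measurable
    have "(\<integral>\<^sup>+(x1, y1, x2, y2). ennreal (sum_dist t x1 x2) \<partial>\<gamma>) = (\<integral>\<^sup>+r. ennreal (sum_dist t (fst r) (fst (snd (snd r)))) \<partial>\<gamma>)"
      by (intro nn_integral_cong) (simp split: prod.split)
    also have "\<dots> = (\<integral>\<^sup>+z. \<integral>\<^sup>+z'. ennreal (w z z') * ennreal (sum_dist t (first_coords t z) (first_coords t z')) \<partial>\<mu> \<partial>\<mu>)"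
      unfolding \<gamma>int[OF h] by (simp add: T_def)
    also have "\<dots> \<le> (\<integral>\<^sup>+z. \<integral>\<^sup>+z'. ennreal (w z z') * ennreal \<delta> \<partial>\<mu> \<partial>\<mu>)"
    proof (intro nn_integral_mono)
      fix z z'
      show "ennreal (w z z') * ennreal (sum_dist t (first_coords t z) (first_coords t z')) \<le> ennreal (w z z') * ennreal \<delta>"
      proof (cases "w z z' = 0")
        case False
        then show ?thesis by (intro mult_left_mono ennreal_leI wsupp) auto
      qed simp
    qed
    also have "\<dots> = (\<integral>\<^sup>+z. \<integral>\<^sup>+z'. ennreal (w z z') \<partial>\<mu> \<partial>\<mu>) * ennreal \<delta>"
    proof -
      have "(\<integral>\<^sup>+z. \<integral>\<^sup>+z'. ennreal (w z z') * ennreal \<delta> \<partial>\<mu> \<partial>\<mu>) = (\<integral>\<^sup>+z. (\<integral>\<^sup>+z'. ennreal (w z z') \<partial>\<mu>) * ennreal \<delta> \<partial>\<mu>)"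
        by (intro nn_integral_cong nn_integral_multc wm1)
      also have "\<dots> = (\<integral>\<^sup>+z. \<integral>\<^sup>+z'. ennreal (w z z') \<partial>\<mu> \<partial>\<mu>) * ennreal \<delta>"
        by (rule nn_integral_multc, rule borel_measurable_nn_integral) (use wm in \<open>simp add: case_prod_beta'\<close>)
      finally show ?thesis .
    qed
    also have "\<dots> \<le> 1 * ennreal \<delta>" by (intro mult_right_mono total) simp
    finally show ?thesis by simp
  qed
  have \<gamma>P: "\<gamma> \<in> perturbations ?X ?PY (sum_dist t) ?\<nu> \<delta>"
    unfolding perturbations_def using sub s\<gamma> marg1 marg2 cost by (simp add: space_subprob_algebra)
  have c1': "continuous_map ?Q ?PY (\<lambda>r. fst (snd r))"
    by (intro continuous_map_compose[OF continuous_map_snd continuous_map_fst, unfolded o_def])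
  have c2': "continuous_map ?Q ?PY (\<lambda>r. snd (snd (snd r)))"
    by (intro continuous_map_compose[OF c2[unfolded e2] continuous_map_snd, unfolded o_def])
  let ?h = "\<lambda>r. \<bar>(\<integral>x. f x \<partial>fst (snd r)) - (\<integral>x. f x \<partial>snd (snd (snd r)))\<bar>"
  have hC: "?h \<in> Cb ?Q" by (intro Cb_abs Cb_diff Cb_compose[OF c1' fint] Cb_compose[OF c2' fint])
  have hm: "(\<lambda>r. ennreal (?h r)) \<in> borel_measurable (borel_of ?Q)"
    using Cb_measurable[OF hC] by measurable
  have "(\<integral>\<^sup>+z. \<integral>\<^sup>+z'. ennreal (w z z' * \<bar>p z - p z'\<bar>) \<partial>\<mu> \<partial>\<mu>) = (\<integral>\<^sup>+z. \<integral>\<^sup>+z'. ennreal (w z z') * ennreal (?h (T (z, z'))) \<partial>\<mu> \<partial>\<mu>)"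
    by (intro nn_integral_cong) (simp add: T_def p ennreal_mult w0)
  also have "\<dots> = (\<integral>\<^sup>+r. ennreal (?h r) \<partial>\<gamma>)" by (rule \<gamma>int[OF hm, symmetric])
  also have "\<dots> \<le> (\<integral>\<^sup>+(x1, y1, x2, y2). ennreal (W1 (N - t) y1 y2) \<partial>\<gamma>)"
  proof (rule nn_integral_mono)
    fix r assume "r \<in> space \<gamma>"
    then obtain x1 y1 x2 y2 where r: "r = (x1, y1, x2, y2)"
      and y: "y1 \<in> prob_measures (power_topology (N - t))" "y2 \<in> prob_measures (power_topology (N - t))"
      unfolding sp\<gamma> by (cases r) auto
    show "ennreal (?h r) \<le> (case r of (x1, y1, x2, y2) \<Rightarrow> ennreal (W1 (N - t) y1 y2))"
      using lipschitz_integral_le_W1[OF bd y f] by (simp add: r ennreal_leI)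
  qed
  also have "\<dots> \<le> information_modulus N t \<mu> \<delta>"
    unfolding information_modulus_def modulus_of_continuity_def by (rule SUP_upper[OF \<gamma>P])
  finally show ?thesis .
qed

text \<open>The weight built from a partition into pieces of diameter at most \<open>\<delta>\<close> charges only pairs that lie in a common piece.\<close>

lemma local_average_deviation_le_modulus:
  fixes \<mu> :: "(nat \<Rightarrow> 'z::polish_space) measure"
  assumes bd: "bounded (UNIV :: 'z set)" and t: "t \<le> N" and \<mu>: "\<mu> \<in> prob_measures (power_topology N)"
    and \<phi>: "subpartition t \<delta> m \<phi>"
    and f: "sd_lipschitz (N - t) 1 f"
    and p: "p = (\<lambda>z. \<integral>y. f y \<partial>conditional_law N t \<mu> (first_coords t z))"
    and c: "c = (\<lambda>i. (\<integral>z. \<phi> i (first_coords t z) * p z \<partial>\<mu>) / (\<integral>z. \<phi> i (first_coords t z) \<partial>\<mu>))"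
  shows "ennreal (\<integral>z. (\<Sum>i<m. \<phi> i (first_coords t z) * \<bar>p z - c i\<bar>) \<partial>\<mu>) \<le> information_modulus N t \<mu> \<delta>"
proof -
  let ?X = "power_topology t :: (nat \<Rightarrow> 'z) topology" and ?PY = "weak_topology (power_topology (N - t)) :: (nat \<Rightarrow> 'z) measure topology"
  let ?\<kappa> = "\<lambda>z. conditional_law N t \<mu> (first_coords t z)"
  interpret prob_space \<mu> by (rule prob_measuresD(1)[OF \<mu>])
  note \<phi>C = subpartitionD(1)[OF \<phi>] and \<phi>0 = subpartitionD(2)[OF \<phi>] and \<phi>1 = subpartitionD(3)[OF \<phi>]
  \<comment> \<open>Pieces beyond the \<open>m\<close>-th are not subject to the bound on the sum and are switched off.\<close>
  define F where "F i z = (if i < m then \<phi> i (first_coords t z) else 0)" for i z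
  have first: "first_coords t \<in> \<mu> \<rightarrow>\<^sub>M borel_of ?X" by (rule measurable_first_coords[OF \<mu> t])
  have F0: "0 \<le> F i z" for i z using \<phi>0 by (simp add: F_def)
  have Fsum: "(\<Sum>i<m. F i z) \<le> 1" for z using \<phi>1[of "first_coords t z"] by (simp add: F_def)
  have F1: "F i z \<le> 1" for i z
  proof (cases "i < m")
    case True
    have "F i z \<le> (\<Sum>i<m. F i z)" using True F0 by (intro member_le_sum) auto
    then show ?thesis using Fsum[of z] by simp
  qed (simp add: F_def)
  have Fm[measurable]: "F i \<in> borel_measurable \<mu>" for i
  proof (cases "i < m")
    case True
    then have "F i = (\<lambda>z. \<phi> i (first_coords t z))" by (simp add: F_def fun_eq_iff)
    then show ?thesis using measurable_compose[OF first Cb_measurable[OF \<phi>C]] by simp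
  next
    case False
    then have "F i = (\<lambda>z. 0)" by (simp add: F_def fun_eq_iff)
    then show ?thesis by simp
  qed
  define a where "a i = (\<integral>z. F i z \<partial>\<mu>)" for i
  have a0: "0 \<le> a i" for i unfolding a_def using F0 by (intro integral_nonneg_AE) auto
  have Fi: "integrable \<mu> (F i)" for i by (rule integrable_const_bound[of _ 1]) (use F0 F1 in auto)
  define w where "w z z' = (\<Sum>i<m. F i z * F i z' / a i)" for z z'
  have w0: "0 \<le> w z z'" for z z' unfolding w_def using F0 a0 by (intro sum_nonneg divide_nonneg_nonneg mult_nonneg_nonneg) auto
  have wsym: "w z z' = w z' z" for z z' by (simp add: w_def mult.commute)
  have wm[measurable]: "(\<lambda>r. w (fst r) (snd r)) \<in> borel_measurable (\<mu> \<Otimes>\<^sub>M \<mu>)" unfolding w_def by measurable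
  have wint: "(\<integral>\<^sup>+z'. ennreal (w z z') \<partial>\<mu>) \<le> 1" for z
  proof -
    have "(\<integral>\<^sup>+z'. ennreal (w z z') \<partial>\<mu>) = ennreal (\<integral>z'. w z z' \<partial>\<mu>)"
      unfolding w_def using Fi F0 a0
      by (intro nn_integral_eq_integral AE_I2 sum_nonneg divide_nonneg_nonneg mult_nonneg_nonneg) auto
    also have "(\<integral>z'. w z z' \<partial>\<mu>) = (\<Sum>i<m. F i z * (a i / a i))"
      unfolding w_def using Fi by (simp add: a_def[symmetric]) (intro sum.cong refl, simp)
    also have "ennreal \<dots> \<le> ennreal (\<Sum>i<m. F i z * 1)"
      by (intro ennreal_leI sum_mono mult_left_mono F0) simp
    also have "\<dots> \<le> 1" using Fsum[of z] by simp
    finally show ?thesis .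
  qed
  have fC: "f \<in> Cb (power_topology (N - t))" by (rule Cb_sd_lipschitz[OF bd f])
  have fint: "(\<lambda>y. \<integral>x. f x \<partial>y) \<in> Cb ?PY" by (rule Cb_weak_integral[OF fC])
  have \<kappa>m: "?\<kappa> \<in> \<mu> \<rightarrow>\<^sub>M borel_of ?PY"
    by (rule measurable_compose[OF first measurable_kernel_into_weak[OF separating_power measurable_conditional_law[OF \<mu> t]]])
  have pm[measurable]: "p \<in> borel_measurable \<mu>" unfolding p by (rule measurable_compose[OF \<kappa>m Cb_measurable[OF fint]])
  obtain B where B: "\<And>y. y \<in> prob_measures (power_topology (N - t)) \<Longrightarrow> \<bar>\<integral>x. f x \<partial>y\<bar> \<le> B"
    using CbE[OF fint] by (metis topspace_weak_topology)
  have \<kappa>p: "?\<kappa> z \<in> prob_measures (power_topology (N - t))" for z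
    by (rule conditional_law_prob[OF \<mu> t first_coords_ext])
  have pB: "\<bar>p z\<bar> \<le> B" for z unfolding p by (rule B[OF \<kappa>p])
  have "ennreal (\<integral>z. (\<Sum>i<m. \<phi> i (first_coords t z) * \<bar>p z - c i\<bar>) \<partial>\<mu>) =
      ennreal (\<integral>z. (\<Sum>i<m. F i z * \<bar>p z - (\<integral>z. F i z * p z \<partial>\<mu>) / (\<integral>z. F i z \<partial>\<mu>)\<bar>) \<partial>\<mu>)"
    by (intro arg_cong[of _ _ ennreal] Bochner_Integration.integral_cong refl sum.cong) (simp add: F_def c)
  also have "\<dots> \<le> (\<integral>\<^sup>+z. \<integral>\<^sup>+z'. ennreal ((\<Sum>i<m. F i z * F i z' / (\<integral>z. F i z \<partial>\<mu>)) * \<bar>p z - p z'\<bar>) \<partial>\<mu> \<partial>\<mu>)"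
    by (rule local_average_deviation[OF Fm F0 F1 pm pB])
  also have "\<dots> = (\<integral>\<^sup>+z. \<integral>\<^sup>+z'. ennreal (w z z' * \<bar>p z - p z'\<bar>) \<partial>\<mu> \<partial>\<mu>)"
    by (simp only: w_def a_def)
  also have "\<dots> \<le> information_modulus N t \<mu> \<delta>"
  proof (rule averaged_oscillation_le_modulus[OF bd t \<mu> wm w0 wsym wint _ f p])
    fix z z' assume "w z z' \<noteq> 0"
    then obtain i where "i < m" "F i z * F i z' / a i \<noteq> 0" unfolding w_def by (meson lessThan_iff sum.neutral)
    then show "sum_dist t (first_coords t z) (first_coords t z') \<le> \<delta>"
      by (intro subpartitionD(4)[OF \<phi>, of i]) (auto simp: F_def)
  qed
  finally show ?thesis .
qed

section \<open>A uniformly small modulus makes the information map weakly continuous\<close>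

text \<open>Under \<open>information_map N t \<nu>\<close> the second coordinate is a function of the first, but one that varies with \<open>\<nu>\<close>. The
condition says that, as far as \<open>G\<close> is concerned, a single continuous function of the first coordinate serves all \<open>\<nu>\<close> near \<open>\<mu>\<close>.
The point \<open>\<mu>\<close> is included because it need not belong to \<open>K\<close>.\<close>

definition locally_approximable ::
    "nat \<Rightarrow> nat \<Rightarrow> (nat \<Rightarrow> 'z::polish_space) measure set \<Rightarrow> (nat \<Rightarrow> 'z) measure \<Rightarrow>
      ((nat \<Rightarrow> 'z) \<times> (nat \<Rightarrow> 'z) measure \<Rightarrow> real) \<Rightarrow> bool" where
  "locally_approximable N t K \<mu> G \<longleftrightarrow> G \<in> Cb (info_space N t) \<and>
     (\<forall>\<epsilon>>0. \<exists>g\<in>Cb (power_topology t). \<exists>V. openin (weak_topology (power_topology N)) V \<and> \<mu> \<in> V \<and>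
        (\<forall>\<nu>\<in>V \<inter> insert \<mu> K. (\<integral>q. \<bar>G q - g (fst q)\<bar> \<partial>information_map N t \<nu>) \<le> \<epsilon>))"

lemma locally_approximableD:
  assumes "locally_approximable N t K \<mu> G"
  shows "G \<in> Cb (info_space N t)"
    "\<epsilon> > 0 \<Longrightarrow> \<exists>g\<in>Cb (power_topology t). \<exists>V. openin (weak_topology (power_topology N)) V \<and> \<mu> \<in> V \<and>
        (\<forall>\<nu>\<in>V \<inter> insert \<mu> K. (\<integral>q. \<bar>G q - g (fst q)\<bar> \<partial>information_map N t \<nu>) \<le> \<epsilon>)"
  using assms unfolding locally_approximable_def by blast+

context
  fixes N t :: nat and K :: "(nat \<Rightarrow> 'z::polish_space) measure set" and \<mu> :: "(nat \<Rightarrow> 'z) measure"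
  assumes bd: "bounded (UNIV :: 'z set)" and t: "t \<le> N"
    and K: "K \<subseteq> prob_measures (power_topology N)" and \<mu>: "\<mu> \<in> prob_measures (power_topology N)"
begin

lemma Cb_fst: "g \<in> Cb (power_topology t) \<Longrightarrow> (\<lambda>q. g (fst q)) \<in> Cb (info_space N t)"
  by (rule Cb_compose[OF continuous_map_fst])

lemma insert_prob: "\<nu> \<in> insert \<mu> K \<Longrightarrow> \<nu> \<in> prob_measures (power_topology N)"
  using K \<mu> by auto

lemma locally_approximable_first:
  assumes g: "g \<in> Cb (power_topology t)"
  shows "locally_approximable N t K \<mu> (\<lambda>q. g (fst q))"
  unfolding locally_approximable_def
proof (intro conjI allI impI)
  show "(\<lambda>q. g (fst q)) \<in> Cb (info_space N t)" by (rule Cb_fst[OF g])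
  fix \<epsilon> :: real assume "\<epsilon> > 0"
  have "openin (weak_topology (power_topology N)) (topspace (weak_topology (power_topology N :: (nat \<Rightarrow> 'z) topology)))" by (rule openin_topspace)
  then show "\<exists>h\<in>Cb (power_topology t). \<exists>V. openin (weak_topology (power_topology N)) V \<and> \<mu> \<in> V \<and>
        (\<forall>\<nu>\<in>V \<inter> insert \<mu> K. (\<integral>q. \<bar>g (fst q) - h (fst q)\<bar> \<partial>information_map N t \<nu>) \<le> \<epsilon>)"
    using g \<mu> \<open>\<epsilon> > 0\<close> by (intro bexI[of _ g] exI[of _ "prob_measures (power_topology N)"]) auto
qed

text \<open>Stated for an abstract operation so that it covers \<open>max\<close>, \<open>min\<close> and differences; the last two premises express that the operation
preserves bounded continuous functions on both spaces involved.\<close>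

lemma locally_approximable_combine:
  assumes G1: "locally_approximable N t K \<mu> G1" and G2: "locally_approximable N t K \<mu> G2"
    and H: "\<And>a b c d. \<bar>H a b - H c d\<bar> \<le> \<bar>a - c\<bar> + \<bar>b - d :: real\<bar>"
    and HCb: "\<And>X :: ((nat \<Rightarrow> 'z) \<times> (nat \<Rightarrow> 'z) measure) topology. \<And>f g. f \<in> Cb X \<Longrightarrow> g \<in> Cb X \<Longrightarrow> (\<lambda>x. H (f x) (g x)) \<in> Cb X"
    and HCb': "\<And>X :: (nat \<Rightarrow> 'z) topology. \<And>f g. f \<in> Cb X \<Longrightarrow> g \<in> Cb X \<Longrightarrow> (\<lambda>x. H (f x) (g x)) \<in> Cb X"
  shows "locally_approximable N t K \<mu> (\<lambda>q. H (G1 q) (G2 q))"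
  unfolding locally_approximable_def
proof (intro conjI allI impI)
  note C1 = locally_approximableD(1)[OF G1] and C2 = locally_approximableD(1)[OF G2]
  show "(\<lambda>q. H (G1 q) (G2 q)) \<in> Cb (info_space N t)" by (rule HCb[OF C1 C2])
  fix \<epsilon> :: real assume "\<epsilon> > 0"
  then have e: "\<epsilon> / 2 > 0" by simp
  obtain g1 V1 where g1: "g1 \<in> Cb (power_topology t)" and V1: "openin (weak_topology (power_topology N)) V1" "\<mu> \<in> V1"
    and le1: "\<And>\<nu>. \<nu> \<in> V1 \<Longrightarrow> \<nu> \<in> insert \<mu> K \<Longrightarrow> (\<integral>q. \<bar>G1 q - g1 (fst q)\<bar> \<partial>information_map N t \<nu>) \<le> \<epsilon> / 2"
    using locally_approximableD(2)[OF G1 e] by blast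
  obtain g2 V2 where g2: "g2 \<in> Cb (power_topology t)" and V2: "openin (weak_topology (power_topology N)) V2" "\<mu> \<in> V2"
    and le2: "\<And>\<nu>. \<nu> \<in> V2 \<Longrightarrow> \<nu> \<in> insert \<mu> K \<Longrightarrow> (\<integral>q. \<bar>G2 q - g2 (fst q)\<bar> \<partial>information_map N t \<nu>) \<le> \<epsilon> / 2"
    using locally_approximableD(2)[OF G2 e] by blast
  have "(\<integral>q. \<bar>H (G1 q) (G2 q) - H (g1 (fst q)) (g2 (fst q))\<bar> \<partial>information_map N t \<nu>) \<le> \<epsilon>"
    if \<nu>: "\<nu> \<in> (V1 \<inter> V2) \<inter> insert \<mu> K" for \<nu>
  proof -
    have I: "information_map N t \<nu> \<in> prob_measures (info_space N t)"
      using \<nu> by (intro information_map_prob insert_prob t) auto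
    have A1: "(\<lambda>q. \<bar>G1 q - g1 (fst q)\<bar>) \<in> Cb (info_space N t)" and A2: "(\<lambda>q. \<bar>G2 q - g2 (fst q)\<bar>) \<in> Cb (info_space N t)"
      by (intro Cb_abs Cb_diff C1 C2 Cb_fst g1 g2)+
    have "(\<integral>q. \<bar>H (G1 q) (G2 q) - H (g1 (fst q)) (g2 (fst q))\<bar> \<partial>information_map N t \<nu>) \<le>
        (\<integral>q. \<bar>G1 q - g1 (fst q)\<bar> + \<bar>G2 q - g2 (fst q)\<bar> \<partial>information_map N t \<nu>)"
      by (intro integral_mono H Cb_integrable[OF _ I] Cb_add Cb_abs Cb_diff HCb C1 C2 Cb_fst g1 g2)
    also have "\<dots> = (\<integral>q. \<bar>G1 q - g1 (fst q)\<bar> \<partial>information_map N t \<nu>) + (\<integral>q. \<bar>G2 q - g2 (fst q)\<bar> \<partial>information_map N t \<nu>)"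
      by (rule Bochner_Integration.integral_add[OF Cb_integrable[OF A1 I] Cb_integrable[OF A2 I]])
    also have "\<dots> \<le> \<epsilon> / 2 + \<epsilon> / 2" using \<nu> by (intro add_mono le1 le2) auto
    finally show ?thesis by simp
  qed
  moreover have "openin (weak_topology (power_topology N)) (V1 \<inter> V2)" by (rule openin_Int[OF V1(1) V2(1)])
  ultimately show "\<exists>g\<in>Cb (power_topology t). \<exists>V. openin (weak_topology (power_topology N)) V \<and> \<mu> \<in> V \<and>
        (\<forall>\<nu>\<in>V \<inter> insert \<mu> K. (\<integral>q. \<bar>H (G1 q) (G2 q) - g (fst q)\<bar> \<partial>information_map N t \<nu>) \<le> \<epsilon>)"
    using V1(2) V2(2) by (intro bexI[OF _ HCb'[OF g1 g2]] exI[of _ "V1 \<inter> V2"]) blast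
qed

lemma locally_approximable_max:
  assumes "locally_approximable N t K \<mu> G1" "locally_approximable N t K \<mu> G2"
  shows "locally_approximable N t K \<mu> (\<lambda>q. max (G1 q) (G2 q))"
  by (rule locally_approximable_combine[OF assms]) (auto intro: Cb_max)

lemma locally_approximable_min:
  assumes "locally_approximable N t K \<mu> G1" "locally_approximable N t K \<mu> G2"
  shows "locally_approximable N t K \<mu> (\<lambda>q. min (G1 q) (G2 q))"
  by (rule locally_approximable_combine[OF assms]) (auto intro: Cb_min)

lemma locally_approximable_diff:
  assumes "locally_approximable N t K \<mu> G1" "locally_approximable N t K \<mu> G2"
  shows "locally_approximable N t K \<mu> (\<lambda>q. G1 q - G2 q)"
  by (rule locally_approximable_combine[OF assms]) (auto intro: Cb_diff)

lemma locally_approximable_const: "locally_approximable N t K \<mu> (\<lambda>q. c)"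
  using locally_approximable_first[OF Cb_const] .

lemma locally_approximable_cmult:
  assumes G: "locally_approximable N t K \<mu> G"
  shows "locally_approximable N t K \<mu> (\<lambda>q. c * G q)"
  unfolding locally_approximable_def
proof (intro conjI allI impI)
  show "(\<lambda>q. c * G q) \<in> Cb (info_space N t)" by (rule Cb_cmult[OF locally_approximableD(1)[OF G]])
  fix \<epsilon> :: real assume "\<epsilon> > 0"
  then have e: "\<epsilon> / (\<bar>c\<bar> + 1) > 0" by (simp add: add_nonneg_pos)
  obtain g V where g: "g \<in> Cb (power_topology t)" and V: "openin (weak_topology (power_topology N)) V" "\<mu> \<in> V"
    and le: "\<And>\<nu>. \<nu> \<in> V \<Longrightarrow> \<nu> \<in> insert \<mu> K \<Longrightarrow> (\<integral>q. \<bar>G q - g (fst q)\<bar> \<partial>information_map N t \<nu>) \<le> \<epsilon> / (\<bar>c\<bar> + 1)"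
    using locally_approximableD(2)[OF G e] by blast
  have "(\<integral>q. \<bar>c * G q - c * g (fst q)\<bar> \<partial>information_map N t \<nu>) \<le> \<epsilon>" if \<nu>: "\<nu> \<in> V \<inter> insert \<mu> K" for \<nu>
  proof -
    have "(\<integral>q. \<bar>c * G q - c * g (fst q)\<bar> \<partial>information_map N t \<nu>) = \<bar>c\<bar> * (\<integral>q. \<bar>G q - g (fst q)\<bar> \<partial>information_map N t \<nu>)"
      by (simp add: right_diff_distrib[symmetric] abs_mult)
    also have "\<dots> \<le> (\<bar>c\<bar> + 1) * (\<epsilon> / (\<bar>c\<bar> + 1))" using le[of \<nu>] \<nu> e by (intro mult_mono) auto
    also have "\<dots> = \<epsilon>" by (simp add: add_nonneg_pos less_imp_neq[symmetric])
    finally show ?thesis .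
  qed
  then show "\<exists>g\<in>Cb (power_topology t). \<exists>V. openin (weak_topology (power_topology N)) V \<and> \<mu> \<in> V \<and>
        (\<forall>\<nu>\<in>V \<inter> insert \<mu> K. (\<integral>q. \<bar>c * G q - g (fst q)\<bar> \<partial>information_map N t \<nu>) \<le> \<epsilon>)"
    using V by (intro bexI[OF _ Cb_cmult[OF g]] exI[of _ V]) blast
qed

text \<open>With \<open>a i = \<integral>\<phi>\<^sub>i d\<nu>\<close> and \<open>b i = \<integral>\<phi>\<^sub>i f d\<nu>\<close>, the error of replacing \<open>p = \<integral>f d\<kappa>\<close> by \<open>\<Sum>\<^sub>i \<phi>\<^sub>i c\<^sub>i\<close> has three sources: the mass outside the pieces,
the deviation of \<open>p\<close> from its local averages \<open>b i / a i\<close>, and the deviation of these averages from the given constants. Only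
the second involves the conditional law, and it is controlled by the modulus; the other two are weakly continuous in \<open>\<nu>\<close>.\<close>

lemma integral_conditional_approximation:
  fixes \<phi> :: "nat \<Rightarrow> (nat \<Rightarrow> 'z) \<Rightarrow> real"
  assumes \<nu>: "\<nu> \<in> prob_measures (power_topology N)"
    and \<phi>: "subpartition t \<delta> m \<phi>" and f: "sd_lipschitz (N - t) 1 f"
    and B: "\<And>y. y \<in> extensional {1..N - t} \<Longrightarrow> \<bar>f y\<bar> \<le> B"
    and mod: "information_modulus N t \<nu> \<delta> \<le> ennreal \<epsilon>" and "0 \<le> \<epsilon>"
  shows "(\<integral>q. \<bar>(\<integral>y. f y \<partial>snd q) - (\<Sum>i<m. \<phi> i (fst q) * c i)\<bar> \<partial>information_map N t \<nu>) \<le>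
    B * (\<integral>z. 1 - (\<Sum>i<m. \<phi> i (first_coords t z)) \<partial>\<nu>) + \<epsilon> +
    (\<Sum>i<m. \<bar>(\<integral>z. \<phi> i (first_coords t z) * f (last_coords N t z) \<partial>\<nu>) - (\<integral>z. \<phi> i (first_coords t z) \<partial>\<nu>) * c i\<bar>)"
proof -
  interpret prob_space \<nu> by (rule prob_measuresD(1)[OF \<nu>])
  let ?IS = "info_space N t :: ((nat \<Rightarrow> 'z) \<times> (nat \<Rightarrow> 'z) measure) topology"
  note \<phi>C = subpartitionD(1)[OF \<phi>] and \<phi>0 = subpartitionD(2)[OF \<phi>] and \<phi>1 = subpartitionD(3)[OF \<phi>]
  have fC: "f \<in> Cb (power_topology (N - t))" by (rule Cb_sd_lipschitz[OF bd f])
  define F where "F i z = \<phi> i (first_coords t z)" for i z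
  define p where "p = (\<lambda>z. \<integral>y. f y \<partial>conditional_law N t \<nu> (first_coords t z))"
  have IC: "(\<lambda>q. \<integral>y. f y \<partial>snd q) \<in> Cb ?IS" by (rule Cb_compose[OF continuous_map_snd Cb_weak_integral[OF fC]])
  have FC: "(\<lambda>q. \<phi> i (fst q)) \<in> Cb ?IS" for i by (rule Cb_fst[OF \<phi>C])
  have int: "integrable \<nu> (\<lambda>z. G (info_pair N t \<nu> z))" if "G \<in> Cb ?IS" for G by (rule Cb_info_pair_integrable[OF \<nu> t that])
  have pi: "integrable \<nu> p" using int[OF IC] by (simp add: p_def)
  have Fi: "integrable \<nu> (F i)" for i using int[OF FC] by (simp add: F_def[abs_def])
  have Fpi: "integrable \<nu> (\<lambda>z. F i z * p z)" for i using int[OF Cb_mult[OF FC IC]] by (simp add: F_def p_def)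
  have Fdi: "integrable \<nu> (\<lambda>z. F i z * \<bar>p z - d\<bar>)" for i d
    using int[OF Cb_mult[OF FC Cb_abs[OF Cb_diff[OF IC Cb_const]]]] by (simp add: F_def p_def)
  define a where "a i = (\<integral>z. F i z \<partial>\<nu>)" for i
  define b where "b i = (\<integral>z. F i z * p z \<partial>\<nu>)" for i
  have F0: "0 \<le> F i z" for i z using \<phi>0 by (simp add: F_def)
  have F1: "(\<Sum>i<m. F i z) \<le> 1" for z using \<phi>1 by (simp add: F_def)
  have a0: "0 \<le> a i" for i unfolding a_def using F0 by (intro integral_nonneg_AE) auto
  have pB: "\<bar>p z\<bar> \<le> B" for z
  proof -
    have kp: "conditional_law N t \<nu> (first_coords t z) \<in> prob_measures (power_topology (N - t))"
      by (rule conditional_law_prob[OF \<nu> t first_coords_ext])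
    interpret k: prob_space "conditional_law N t \<nu> (first_coords t z)" by (rule prob_measuresD(1)[OF kp])
    have "\<bar>p z\<bar> \<le> (\<integral>y. \<bar>f y\<bar> \<partial>conditional_law N t \<nu> (first_coords t z))" unfolding p_def by (rule integral_abs_bound)
    also have "\<dots> \<le> (\<integral>y. B \<partial>conditional_law N t \<nu> (first_coords t z))"
      using B prob_measuresD(3)[OF kp] Cb_integrable[OF fC kp] by (intro integral_mono) auto
    finally show ?thesis by (simp add: k.prob_space)
  qed
  have bt: "b i = (\<integral>z. \<phi> i (first_coords t z) * f (last_coords N t z) \<partial>\<nu>)" for i
  proof -
    have "(\<lambda>r. \<phi> i (fst r) * f (snd r)) \<in> Cb (prod_topology (power_topology t) (power_topology (N - t)))"
      by (intro Cb_mult Cb_compose[OF continuous_map_fst \<phi>C] Cb_compose[OF continuous_map_snd fC])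
    from integral_conditional_law(1)[OF \<nu> t this] show ?thesis by (simp add: b_def p_def F_def)
  qed
  have dev: "(\<integral>z. (\<Sum>i<m. F i z * \<bar>p z - b i / a i\<bar>) \<partial>\<nu>) \<le> \<epsilon>"
  proof -
    have "ennreal (\<integral>z. (\<Sum>i<m. \<phi> i (first_coords t z) * \<bar>p z - b i / a i\<bar>) \<partial>\<nu>) \<le> information_modulus N t \<nu> \<delta>"
      by (rule local_average_deviation_le_modulus[OF bd t \<nu> \<phi> f p_def]) (simp add: fun_eq_iff a_def b_def F_def)
    also note mod
    finally show ?thesis using \<open>0 \<le> \<epsilon>\<close> by (simp add: F_def)
  qed
  have "(\<integral>q. \<bar>(\<integral>y. f y \<partial>snd q) - (\<Sum>i<m. \<phi> i (fst q) * c i)\<bar> \<partial>information_map N t \<nu>) =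
      (\<integral>z. \<bar>p z - (\<Sum>i<m. F i z * c i)\<bar> \<partial>\<nu>)"
  proof -
    have "(\<lambda>q. \<bar>(\<integral>y. f y \<partial>snd q) - (\<Sum>i<m. \<phi> i (fst q) * c i)\<bar>) \<in> Cb ?IS"
      by (intro Cb_abs Cb_diff IC Cb_sum Cb_mult FC Cb_const)
    from integral_information_map[OF \<nu> t this] show ?thesis by (simp add: p_def F_def)
  qed
  also have "\<dots> \<le> (\<integral>z. B * (1 - (\<Sum>i<m. F i z)) + ((\<Sum>i<m. F i z * \<bar>p z - b i / a i\<bar>) + (\<Sum>i<m. F i z * \<bar>b i / a i - c i\<bar>)) \<partial>\<nu>)"
  proof (rule integral_mono)
    show "integrable \<nu> (\<lambda>z. \<bar>p z - (\<Sum>i<m. F i z * c i)\<bar>)"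
      using pi Fi by (intro integrable_abs Bochner_Integration.integrable_diff Bochner_Integration.integrable_sum integrable_mult_left)
    show "integrable \<nu> (\<lambda>z. B * (1 - (\<Sum>i<m. F i z)) + ((\<Sum>i<m. F i z * \<bar>p z - b i / a i\<bar>) + (\<Sum>i<m. F i z * \<bar>b i / a i - c i\<bar>)))"
      using Fi Fdi by (intro Bochner_Integration.integrable_add integrable_mult_right Bochner_Integration.integrable_diff
          Bochner_Integration.integrable_sum integrable_mult_left) auto
    fix z
    have "p z - (\<Sum>i<m. F i z * c i) = (1 - (\<Sum>i<m. F i z)) * p z + (\<Sum>i<m. F i z * (p z - c i))"
      by (simp add: algebra_simps sum_subtractf sum_distrib_left)
    then have "\<bar>p z - (\<Sum>i<m. F i z * c i)\<bar> \<le> \<bar>(1 - (\<Sum>i<m. F i z)) * p z\<bar> + \<bar>\<Sum>i<m. F i z * (p z - c i)\<bar>" by linarith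
    also have "\<dots> \<le> B * (1 - (\<Sum>i<m. F i z)) + (\<Sum>i<m. F i z * \<bar>p z - b i / a i\<bar> + F i z * \<bar>b i / a i - c i\<bar>)"
    proof (rule add_mono)
      show "\<bar>(1 - (\<Sum>i<m. F i z)) * p z\<bar> \<le> B * (1 - (\<Sum>i<m. F i z))"
        using F1[of z] pB[of z] by (simp add: abs_mult mult.commute[of B] mult_left_mono)
      have "\<bar>\<Sum>i<m. F i z * (p z - c i)\<bar> \<le> (\<Sum>i<m. \<bar>F i z * (p z - c i)\<bar>)" by (rule sum_abs)
      also have "\<dots> \<le> (\<Sum>i<m. F i z * \<bar>p z - b i / a i\<bar> + F i z * \<bar>b i / a i - c i\<bar>)"
      proof (rule sum_mono)
        fix i
        have "\<bar>F i z * (p z - c i)\<bar> = F i z * \<bar>p z - c i\<bar>" using F0 by (simp add: abs_mult)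
        also have "\<dots> \<le> F i z * (\<bar>p z - b i / a i\<bar> + \<bar>b i / a i - c i\<bar>)" by (intro mult_left_mono F0) linarith
        finally show "\<bar>F i z * (p z - c i)\<bar> \<le> F i z * \<bar>p z - b i / a i\<bar> + F i z * \<bar>b i / a i - c i\<bar>" by (simp add: distrib_left)
      qed
      finally show "\<bar>\<Sum>i<m. F i z * (p z - c i)\<bar> \<le> (\<Sum>i<m. F i z * \<bar>p z - b i / a i\<bar> + F i z * \<bar>b i / a i - c i\<bar>)" .
    qed
    finally show "\<bar>p z - (\<Sum>i<m. F i z * c i)\<bar> \<le>
        B * (1 - (\<Sum>i<m. F i z)) + ((\<Sum>i<m. F i z * \<bar>p z - b i / a i\<bar>) + (\<Sum>i<m. F i z * \<bar>b i / a i - c i\<bar>))"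
      by (simp only: sum.distrib)
  qed
  also have "\<dots> = B * (\<integral>z. 1 - (\<Sum>i<m. F i z) \<partial>\<nu>) + ((\<integral>z. (\<Sum>i<m. F i z * \<bar>p z - b i / a i\<bar>) \<partial>\<nu>) + (\<Sum>i<m. a i * \<bar>b i / a i - c i\<bar>))"
  proof -
    have i1: "integrable \<nu> (\<lambda>z. B * (1 - (\<Sum>i<m. F i z)))"
      using Fi by (intro integrable_mult_right Bochner_Integration.integrable_diff Bochner_Integration.integrable_sum) auto
    have i2: "integrable \<nu> (\<lambda>z. \<Sum>i<m. F i z * \<bar>p z - b i / a i\<bar>)" by (intro Bochner_Integration.integrable_sum Fdi)
    have i3: "integrable \<nu> (\<lambda>z. \<Sum>i<m. F i z * \<bar>b i / a i - c i\<bar>)"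
      using Fi by (intro Bochner_Integration.integrable_sum integrable_mult_left)
    have "(\<integral>z. (\<Sum>i<m. F i z * \<bar>b i / a i - c i\<bar>) \<partial>\<nu>) = (\<Sum>i<m. a i * \<bar>b i / a i - c i\<bar>)"
      using Fi by (simp add: a_def)
    then show ?thesis
      unfolding Bochner_Integration.integral_add[OF i1 Bochner_Integration.integrable_add[OF i2 i3]]
        Bochner_Integration.integral_add[OF i2 i3] by simp
  qed
  also have "\<dots> \<le> B * (\<integral>z. 1 - (\<Sum>i<m. F i z) \<partial>\<nu>) + (\<epsilon> + (\<Sum>i<m. \<bar>b i - a i * c i\<bar>))"
  proof (intro add_left_mono add_mono dev sum_mono)
    fix i
    show "a i * \<bar>b i / a i - c i\<bar> \<le> \<bar>b i - a i * c i\<bar>"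
    proof (cases "a i = 0")
      case False
      then have "a i * \<bar>b i / a i - c i\<bar> = \<bar>a i * (b i / a i - c i)\<bar>" using a0[of i] by (simp add: abs_mult)
      also have "a i * (b i / a i - c i) = b i - a i * c i" using False by (simp add: right_diff_distrib)
      finally show ?thesis by simp
    qed simp
  qed
  finally show ?thesis by (simp add: F_def a_def bt add.assoc)
qed


text \<open>The constants \<open>c i\<close> are the local averages under \<open>\<mu>\<close>. They are exact at \<open>\<nu> = \<mu>\<close>, so the weakly continuous error terms are small
near \<open>\<mu>\<close>.\<close>

lemma locally_approximable_kernel_integral_unit:
  assumes modK: "\<And>e. e > 0 \<Longrightarrow> \<exists>\<delta>>0. \<forall>\<nu>\<in>insert \<mu> K. information_modulus N t \<nu> \<delta> \<le> ennreal e"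
    and f: "sd_lipschitz (N - t) 1 f"
  shows "locally_approximable N t K \<mu> (\<lambda>q. \<integral>y. f y \<partial>snd q)"
  unfolding locally_approximable_def
proof (intro conjI allI impI)
  let ?W = "weak_topology (power_topology N) :: (nat \<Rightarrow> 'z) measure topology"
  interpret prob_space \<mu> by (rule prob_measuresD(1)[OF \<mu>])
  have fC: "f \<in> Cb (power_topology (N - t))" by (rule Cb_sd_lipschitz[OF bd f])
  show "(\<lambda>q. \<integral>y. f y \<partial>snd q) \<in> Cb (info_space N t)"
    by (rule Cb_compose[OF continuous_map_snd Cb_weak_integral[OF fC]])
  obtain B where "B \<ge> 0" and B: "\<And>y. y \<in> extensional {1..N - t} \<Longrightarrow> \<bar>f y\<bar> \<le> B" using CbE[OF fC] by (metis topspace_power)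
  fix \<epsilon> :: real assume "\<epsilon> > 0"
  define e where "e = \<epsilon> / 3"
  have "e > 0" using \<open>\<epsilon> > 0\<close> by (simp add: e_def)
  obtain \<delta> where \<delta>: "\<delta> > 0" "\<And>\<nu>. \<nu> \<in> insert \<mu> K \<Longrightarrow> information_modulus N t \<nu> \<delta> \<le> ennreal e"
    using modK[OF \<open>e > 0\<close>] by blast
  define \<mu>X where "\<mu>X = distr \<mu> (borel_of (power_topology t)) (first_coords t)"
  have \<mu>X: "\<mu>X \<in> prob_measures (power_topology t)" unfolding \<mu>X_def
    by (intro prob_measuresI prob_space_distr measurable_first_coords[OF \<mu> t]) simp
  have eB: "e / (B + 1) > 0" using \<open>e > 0\<close> \<open>B \<ge> 0\<close> by simp
  obtain m \<phi> where \<phi>: "subpartition t \<delta> m \<phi>" and rest: "(\<integral>x. 1 - (\<Sum>i<m. \<phi> i x) \<partial>\<mu>X) < e / (B + 1)"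
    by (rule subpartition_of_unity[OF \<mu>X \<delta>(1) eB]) (rule that)
  note \<phi>C = subpartitionD(1)[OF \<phi>] and \<phi>0 = subpartitionD(2)[OF \<phi>] and \<phi>1 = subpartitionD(3)[OF \<phi>]
  define R where "R z = 1 - (\<Sum>i<m. \<phi> i (first_coords t z))" for z
  define b where "b i z = \<phi> i (first_coords t z) * f (last_coords N t z)" for i z
  define a where "a i z = \<phi> i (first_coords t z)" for i z
  have aC: "a i \<in> Cb (power_topology N)" for i
    unfolding a_def[abs_def] by (rule Cb_compose[OF continuous_map_first_coords[OF t] \<phi>C])
  have RC: "R \<in> Cb (power_topology N)"
    unfolding R_def[abs_def] using aC by (intro Cb_diff Cb_const Cb_sum) (simp add: a_def[abs_def])
  have bC: "b i \<in> Cb (power_topology N)" for i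
    unfolding b_def[abs_def] using aC[of i] Cb_compose[OF continuous_map_last_coords[OF t] fC]
    by (intro Cb_mult) (simp_all add: a_def[abs_def])
  define c where "c i = (\<integral>z. b i z \<partial>\<mu>) / (\<integral>z. a i z \<partial>\<mu>)" for i
  \<comment> \<open>If \<open>\<mu>\<close> misses the \<open>i\<close>-th piece, both integrals vanish and any value of \<open>c i\<close> would do.\<close>
  have exact: "(\<integral>z. b i z \<partial>\<mu>) - (\<integral>z. a i z \<partial>\<mu>) * c i = 0" for i
  proof (cases "(\<integral>z. a i z \<partial>\<mu>) = 0")
    case True
    have "AE z in \<mu>. a i z = 0"
      using True Cb_integrable[OF aC \<mu>, of i] \<phi>0 by (subst (asm) integral_nonneg_eq_0_iff_AE) (auto simp: a_def)
    then have "AE z in \<mu>. b i z = 0" by eventually_elim (simp add: a_def b_def)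
    then have "(\<integral>z. b i z \<partial>\<mu>) = 0" by (rule integral_eq_zero_AE)
    then show ?thesis using True by simp
  qed (simp add: c_def)
  define V where "V = {\<nu> \<in> topspace ?W. (\<integral>z. R z \<partial>\<nu>) \<in> {..<e / (B + 1)}} \<inter>
    {\<nu> \<in> topspace ?W. (\<Sum>i<m. \<bar>(\<integral>z. b i z \<partial>\<nu>) - (\<integral>z. a i z \<partial>\<nu>) * c i\<bar>) \<in> {..<e}}"
  have "openin ?W V" unfolding V_def
  proof (intro openin_Int openin_continuous_map_preimage[of _ euclideanreal])
    show "continuous_map ?W euclideanreal (\<lambda>\<nu>. \<integral>z. R z \<partial>\<nu>)" by (rule continuous_map_weak_integral[OF RC])
    have "(\<lambda>\<nu>. \<Sum>i<m. \<bar>(\<integral>z. b i z \<partial>\<nu>) - (\<integral>z. a i z \<partial>\<nu>) * c i\<bar>) \<in> Cb ?W"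
      by (intro Cb_sum Cb_abs Cb_diff Cb_mult Cb_const Cb_weak_integral aC bC)
    then show "continuous_map ?W euclideanreal (\<lambda>\<nu>. \<Sum>i<m. \<bar>(\<integral>z. b i z \<partial>\<nu>) - (\<integral>z. a i z \<partial>\<nu>) * c i\<bar>)"
      by (rule Cb_continuous)
  qed auto
  moreover have "\<mu> \<in> V"
  proof -
    have "(\<integral>z. R z \<partial>\<mu>) = (\<integral>x. 1 - (\<Sum>i<m. \<phi> i x) \<partial>\<mu>X)"
      unfolding R_def[abs_def] \<mu>X_def
      by (rule integral_distr[OF measurable_first_coords[OF \<mu> t], symmetric])
         (intro Cb_measurable Cb_diff Cb_const Cb_sum \<phi>C)
    then show ?thesis using rest exact \<mu> \<open>e > 0\<close> by (simp add: V_def)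
  qed
  moreover have "(\<lambda>x. \<Sum>i<m. \<phi> i x * c i) \<in> Cb (power_topology t)" by (intro Cb_sum Cb_mult \<phi>C Cb_const)
  moreover have "(\<integral>q. \<bar>(\<integral>y. f y \<partial>snd q) - (\<Sum>i<m. \<phi> i (fst q) * c i)\<bar> \<partial>information_map N t \<nu>) \<le> \<epsilon>"
    if \<nu>: "\<nu> \<in> V \<inter> insert \<mu> K" for \<nu>
  proof -
    have \<nu>p: "\<nu> \<in> prob_measures (power_topology N)" using \<nu> by (intro insert_prob) auto
    have "(\<integral>q. \<bar>(\<integral>y. f y \<partial>snd q) - (\<Sum>i<m. \<phi> i (fst q) * c i)\<bar> \<partial>information_map N t \<nu>) \<le>
        B * (\<integral>z. R z \<partial>\<nu>) + e + (\<Sum>i<m. \<bar>(\<integral>z. b i z \<partial>\<nu>) - (\<integral>z. a i z \<partial>\<nu>) * c i\<bar>)"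
      unfolding R_def b_def a_def
      by (rule integral_conditional_approximation[OF \<nu>p \<phi> f B]) (use \<delta> \<nu> \<open>e > 0\<close> in auto)
    also have "\<dots> \<le> (B + 1) * (e / (B + 1)) + e + e"
    proof (intro add_mono)
      have R0: "0 \<le> (\<integral>z. R z \<partial>\<nu>)" unfolding R_def using \<phi>1 by (intro integral_nonneg_AE) auto
      have "B * (\<integral>z. R z \<partial>\<nu>) \<le> (B + 1) * (\<integral>z. R z \<partial>\<nu>)" using R0 by (simp add: distrib_right)
      also have "\<dots> \<le> (B + 1) * (e / (B + 1))" using \<nu> \<open>B \<ge> 0\<close> by (intro mult_left_mono) (auto simp: V_def)
      finally show "B * (\<integral>z. R z \<partial>\<nu>) \<le> (B + 1) * (e / (B + 1))" .
    qed (use \<nu> in \<open>auto simp: V_def\<close>)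
    also have "(B + 1) * (e / (B + 1)) = e" using \<open>B \<ge> 0\<close> by simp
    finally show ?thesis by (simp add: e_def)
  qed
  ultimately show "\<exists>g\<in>Cb (power_topology t). \<exists>V. openin ?W V \<and> \<mu> \<in> V \<and>
        (\<forall>\<nu>\<in>V \<inter> insert \<mu> K. (\<integral>q. \<bar>(\<integral>y. f y \<partial>snd q) - g (fst q)\<bar> \<partial>information_map N t \<nu>) \<le> \<epsilon>)"
    by (intro bexI[of _ "\<lambda>x. \<Sum>i<m. \<phi> i x * c i"] exI[of _ V]) blast+
qed

context
  assumes modK: "\<And>e. e > 0 \<Longrightarrow> \<exists>\<delta>>0. \<forall>\<nu>\<in>insert \<mu> K. information_modulus N t \<nu> \<delta> \<le> ennreal e"
begin

lemma locally_approximable_kernel_integral: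
  assumes f: "sd_lipschitz (N - t) L f"
  shows "locally_approximable N t K \<mu> (\<lambda>q. \<integral>y. f y \<partial>snd q)"
proof -
  have L0: "0 \<le> L" using f by (rule sd_lipschitzD)
  have "sd_lipschitz (N - t) (\<bar>1 / (L + 1)\<bar> * L) (\<lambda>y. 1 / (L + 1) * f y)" by (rule sd_lipschitz_cmult[OF f])
  then have "sd_lipschitz (N - t) 1 (\<lambda>y. 1 / (L + 1) * f y)"
  proof (rule sd_lipschitz_mono)
    show "\<bar>1 / (L + 1)\<bar> * L \<le> 1" using L0 by simp
  qed
  from locally_approximable_cmult[OF locally_approximable_kernel_integral_unit[OF modK this], of "L + 1"]
  show ?thesis using L0 by simp
qed

lemma locally_approximable_weak_bump:
  assumes "b \<in> weak_bumps (power_family (N - t))"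
  shows "locally_approximable N t K \<mu> (\<lambda>q. b (snd q))"
proof -
  obtain g k r where b: "b = weak_bump g k r" and g: "g \<in> max_hull (power_family (N - t))"
    using assms by (auto simp: weak_bumps_def)
  obtain L where "sd_lipschitz (N - t) L g" using max_hull_power_lipschitz[OF g] by blast
  from locally_approximable_kernel_integral[OF this]
  have "locally_approximable N t K \<mu> (\<lambda>q. max 0 (min 1 (real k * ((\<integral>y. g y \<partial>snd q) - r))))"
    by (intro locally_approximable_max locally_approximable_min locally_approximable_cmult
        locally_approximable_diff locally_approximable_const)
  then show ?thesis by (simp add: b weak_bump_def)
qed

lemma locally_approximable_list_min:
  "set cs \<subseteq> weak_bumps (power_family (N - t)) \<Longrightarrow> locally_approximable N t K \<mu> (\<lambda>q. list_min cs (snd q))"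
  by (induction cs) (auto intro: locally_approximable_const locally_approximable_min locally_approximable_weak_bump)

text \<open>All members of the separating family of the product space are built from functions of the first coordinate and integrals of
Lipschitz functions by lattice operations and scaling.\<close>

lemma locally_approximable_max_hull:
  assumes "G \<in> max_hull ((\<lambda>(c, d) p. min (c (fst p)) (d (snd p))) ` (power_family t \<times> weak_family (power_family (N - t))))"
  shows "locally_approximable N t K \<mu> G"
  using assms
proof (induction rule: max_hull_induct)
  case zero
  show ?case by (rule locally_approximable_const)
next
  case (max r c G)
  then obtain d cs where c: "c = (\<lambda>p. min (d (fst p)) (list_min cs (snd p)))"
    and d: "d \<in> power_family t" and cs: "set cs \<subseteq> weak_bumps (power_family (N - t))"
    by (auto simp: weak_family_def)
  have "d \<in> Cb (power_topology t)" using separatingD(2)[OF separating_power d] .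
  then have "locally_approximable N t K \<mu> c"
    unfolding c by (intro locally_approximable_min locally_approximable_first locally_approximable_list_min cs)
  then show ?case by (intro locally_approximable_max locally_approximable_cmult max.IH)
qed

text \<open>Replace \<open>G\<close> by \<open>g\<close> at \<open>\<nu>\<close> and at \<open>\<mu>\<close>; in between, \<open>\<nu> \<mapsto> \<integral>g(x) d\<nu>\<close> is weakly continuous.\<close>

lemma locally_approximable_near:
  assumes G: "locally_approximable N t K \<mu> G" and "\<epsilon> > 0"
  obtains V where "openin (weak_topology (power_topology N)) V" "\<mu> \<in> V"
    "\<And>\<nu>. \<nu> \<in> V \<Longrightarrow> \<nu> \<in> K \<Longrightarrow> \<bar>(\<integral>q. G q \<partial>information_map N t \<nu>) - (\<integral>q. G q \<partial>information_map N t \<mu>)\<bar> < \<epsilon>"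
proof -
  let ?W = "weak_topology (power_topology N) :: (nat \<Rightarrow> 'z) measure topology"
  have e: "\<epsilon> / 4 > 0" using \<open>\<epsilon> > 0\<close> by simp
  note GC = locally_approximableD(1)[OF G]
  obtain g V where g: "g \<in> Cb (power_topology t)" and V: "openin ?W V" "\<mu> \<in> V"
    and le: "\<And>\<nu>. \<nu> \<in> V \<Longrightarrow> \<nu> \<in> insert \<mu> K \<Longrightarrow> (\<integral>q. \<bar>G q - g (fst q)\<bar> \<partial>information_map N t \<nu>) \<le> \<epsilon> / 4"
    using locally_approximableD(2)[OF G e] by blast
  have gC: "(\<lambda>z. g (first_coords t z)) \<in> Cb (power_topology N)"
    by (rule Cb_compose[OF continuous_map_first_coords[OF t] g])
  define U where "U = {\<nu> \<in> topspace ?W. (\<integral>z. g (first_coords t z) \<partial>\<nu>) \<in> ball (\<integral>z. g (first_coords t z) \<partial>\<mu>) (\<epsilon> / 4)}"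
  have U: "openin ?W U" unfolding U_def
    by (rule openin_continuous_map_preimage[OF continuous_map_weak_integral[OF gC]]) auto
  have close: "\<bar>(\<integral>q. G q \<partial>information_map N t \<nu>) - (\<integral>z. g (first_coords t z) \<partial>\<nu>)\<bar> \<le> \<epsilon> / 4"
    if \<nu>: "\<nu> \<in> V" "\<nu> \<in> insert \<mu> K" for \<nu>
  proof -
    have I: "information_map N t \<nu> \<in> prob_measures (info_space N t)"
      by (intro information_map_prob insert_prob t \<nu>)
    have "(\<integral>z. g (first_coords t z) \<partial>\<nu>) = (\<integral>q. g (fst q) \<partial>information_map N t \<nu>)"
      unfolding integral_information_map[OF insert_prob[OF \<nu>(2)] t Cb_fst[OF g]] by simp
    then have "\<bar>(\<integral>q. G q \<partial>information_map N t \<nu>) - (\<integral>z. g (first_coords t z) \<partial>\<nu>)\<bar> = \<bar>\<integral>q. G q - g (fst q) \<partial>information_map N t \<nu>\<bar>"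
      using Cb_integrable[OF GC I] Cb_integrable[OF Cb_fst[OF g] I] by simp
    also have "\<dots> \<le> (\<integral>q. \<bar>G q - g (fst q)\<bar> \<partial>information_map N t \<nu>)" by (rule integral_abs_bound)
    finally show ?thesis using le[OF \<nu>] by simp
  qed
  show ?thesis
  proof (rule that[of "V \<inter> U"])
    show "openin ?W (V \<inter> U)" by (rule openin_Int[OF V(1) U])
    show "\<mu> \<in> V \<inter> U" using V \<mu> e by (auto simp: U_def)
    fix \<nu> assume "\<nu> \<in> V \<inter> U" "\<nu> \<in> K"
    then have "\<bar>(\<integral>z. g (first_coords t z) \<partial>\<mu>) - (\<integral>z. g (first_coords t z) \<partial>\<nu>)\<bar> < \<epsilon> / 4"
      and "\<bar>(\<integral>q. G q \<partial>information_map N t \<nu>) - (\<integral>z. g (first_coords t z) \<partial>\<nu>)\<bar> \<le> \<epsilon> / 4"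
      and "\<bar>(\<integral>q. G q \<partial>information_map N t \<mu>) - (\<integral>z. g (first_coords t z) \<partial>\<mu>)\<bar> \<le> \<epsilon> / 4"
      using close[of \<nu>] close[of \<mu>] V(2) by (auto simp: U_def dist_real_def)
    then show "\<bar>(\<integral>q. G q \<partial>information_map N t \<nu>) - (\<integral>q. G q \<partial>information_map N t \<mu>)\<bar> < \<epsilon>"
      using \<open>\<epsilon> > 0\<close> by linarith
  qed
qed

text \<open>Monotone convergence at \<open>\<mu>\<close> selects an approximant from below that already exceeds \<open>a\<close>, and this approximant is locally
approximable.\<close>

lemma information_integral_lower_near:
  assumes G: "G \<in> Cb (info_space N t)" and nn: "\<And>q. q \<in> topspace (info_space N t) \<Longrightarrow> 0 \<le> G q"
    and a: "a < (\<integral>q. G q \<partial>information_map N t \<mu>)"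
  obtains V where "openin (weak_topology (power_topology N)) V" "\<mu> \<in> V"
    "\<And>\<nu>. \<nu> \<in> V \<Longrightarrow> \<nu> \<in> K \<Longrightarrow> a < (\<integral>q. G q \<partial>information_map N t \<nu>)"
proof -
  let ?C = "(\<lambda>(c, d) p. min (c (fst p)) (d (snd p))) ` (power_family t \<times> weak_family (power_family (N - t))) :: ((nat \<Rightarrow> 'z) \<times> (nat \<Rightarrow> 'z) measure \<Rightarrow> real) set"
  obtain s where s: "\<And>k. s k \<in> max_hull ?C"
      "\<And>k q. q \<in> topspace (info_space N t) \<Longrightarrow> 0 \<le> s k q \<and> s k q \<le> G q"
      "\<And>q. incseq (\<lambda>k. s k q)"
      "\<And>q. q \<in> topspace (info_space N t) \<Longrightarrow> (\<lambda>k. s k q) \<longlonglongrightarrow> G q"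
    by (rule max_hull_increasing_limit[OF separating_info_space Cb_continuous[OF G]]) (erule nn, rule that)
  note sA = locally_approximable_max_hull[OF s(1)]
  note sC = locally_approximableD(1)[OF sA]
  have I: "information_map N t \<mu> \<in> prob_measures (info_space N t)" by (rule information_map_prob[OF \<mu> t])
  have "(\<lambda>k. \<integral>q. s k q \<partial>information_map N t \<mu>) \<longlonglongrightarrow> (\<integral>q. G q \<partial>information_map N t \<mu>)"
    by (rule integral_increasing_limit[OF I G sC s(2,4)])
  then have "\<forall>\<^sub>F k in sequentially. a < (\<integral>q. s k q \<partial>information_map N t \<mu>)" using a by (rule order_tendstoD)
  then obtain k where k: "a < (\<integral>q. s k q \<partial>information_map N t \<mu>)" by (auto simp: eventually_sequentially)
  then have pos: "0 < (\<integral>q. s k q \<partial>information_map N t \<mu>) - a" by simp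
  obtain V where V: "openin (weak_topology (power_topology N)) V" "\<mu> \<in> V"
    and near: "\<And>\<nu>. \<nu> \<in> V \<Longrightarrow> \<nu> \<in> K \<Longrightarrow>
      \<bar>(\<integral>q. s k q \<partial>information_map N t \<nu>) - (\<integral>q. s k q \<partial>information_map N t \<mu>)\<bar> < (\<integral>q. s k q \<partial>information_map N t \<mu>) - a"
    by (rule locally_approximable_near[OF sA pos]) (rule that)
  show ?thesis
  proof (rule that[OF V])
    fix \<nu> assume \<nu>: "\<nu> \<in> V" "\<nu> \<in> K"
    have I\<nu>: "information_map N t \<nu> \<in> prob_measures (info_space N t)" using \<nu>(2) by (intro information_map_prob insert_prob t) simp
    have "a < (\<integral>q. s k q \<partial>information_map N t \<nu>)" using near[OF \<nu>] by linarith
    also have "\<dots> \<le> (\<integral>q. G q \<partial>information_map N t \<nu>)"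
      using s(2) prob_measuresD(3)[OF I\<nu>] by (intro integral_mono Cb_integrable[OF sC I\<nu>] Cb_integrable[OF G I\<nu>]) auto
    finally show "a < (\<integral>q. G q \<partial>information_map N t \<nu>)" .
  qed
qed

lemma information_integral_near:
  assumes G: "G \<in> Cb (info_space N t)" and "\<epsilon> > 0"
  obtains V where "openin (weak_topology (power_topology N)) V" "\<mu> \<in> V"
    "\<And>\<nu>. \<nu> \<in> V \<Longrightarrow> \<nu> \<in> K \<Longrightarrow> \<bar>(\<integral>q. G q \<partial>information_map N t \<nu>) - (\<integral>q. G q \<partial>information_map N t \<mu>)\<bar> < \<epsilon>"
proof -
  obtain M where M: "\<And>q. q \<in> topspace (info_space N t) \<Longrightarrow> \<bar>G q\<bar> \<le> M" using CbE[OF G] by metis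
  have nn: "0 \<le> M + G q" "0 \<le> M - G q" if "q \<in> topspace (info_space N t)" for q using M[OF that] by auto
  have I: "information_map N t \<nu> \<in> prob_measures (info_space N t)" if "\<nu> \<in> insert \<mu> K" for \<nu>
    by (intro information_map_prob insert_prob t that)
  note shift = integral_add_const_prob[OF I G, of _ M]
  have a1: "M + (\<integral>q. G q \<partial>information_map N t \<mu>) - \<epsilon> < (\<integral>q. M + G q \<partial>information_map N t \<mu>)"
    and a2: "M - (\<integral>q. G q \<partial>information_map N t \<mu>) - \<epsilon> < (\<integral>q. M - G q \<partial>information_map N t \<mu>)"
    using shift[of \<mu>] \<open>\<epsilon> > 0\<close> by auto
  obtain V1 where V1: "openin (weak_topology (power_topology N)) V1" "\<mu> \<in> V1"
    and n1: "\<And>\<nu>. \<nu> \<in> V1 \<Longrightarrow> \<nu> \<in> K \<Longrightarrow> M + (\<integral>q. G q \<partial>information_map N t \<mu>) - \<epsilon> < (\<integral>q. M + G q \<partial>information_map N t \<nu>)"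
    by (rule information_integral_lower_near[OF Cb_add[OF Cb_const G] _ a1]) (erule nn, rule that)
  obtain V2 where V2: "openin (weak_topology (power_topology N)) V2" "\<mu> \<in> V2"
    and n2: "\<And>\<nu>. \<nu> \<in> V2 \<Longrightarrow> \<nu> \<in> K \<Longrightarrow> M - (\<integral>q. G q \<partial>information_map N t \<mu>) - \<epsilon> < (\<integral>q. M - G q \<partial>information_map N t \<nu>)"
    by (rule information_integral_lower_near[OF Cb_diff[OF Cb_const G] _ a2]) (erule nn, rule that)
  show ?thesis
  proof (rule that[of "V1 \<inter> V2"])
    show "openin (weak_topology (power_topology N)) (V1 \<inter> V2)" by (rule openin_Int[OF V1(1) V2(1)])
    show "\<mu> \<in> V1 \<inter> V2" using V1(2) V2(2) by simp
    fix \<nu> assume \<nu>: "\<nu> \<in> V1 \<inter> V2" "\<nu> \<in> K"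
    then show "\<bar>(\<integral>q. G q \<partial>information_map N t \<nu>) - (\<integral>q. G q \<partial>information_map N t \<mu>)\<bar> < \<epsilon>"
      using n1[of \<nu>] n2[of \<nu>] shift[of \<nu>] by auto
  qed
qed

end

end


section \<open>The compactness criterion\<close>

text \<open>A point \<open>y\<close> of \<open>C\<close> near \<open>x\<close> can be compared with \<open>x\<close> through a point of \<open>K\<close> that is close to both.\<close>

lemma continuous_map_real_on_closure:
  assumes C: "C \<subseteq> S closure_of K"
    and near: "\<And>x e. x \<in> C \<Longrightarrow> e > 0 \<Longrightarrow> \<exists>V. openin S V \<and> x \<in> V \<and> (\<forall>y\<in>V \<inter> K. \<bar>F y - F x\<bar> < (e::real))"
  shows "continuous_map (subtopology S C) euclideanreal F"
  unfolding continuous_map_def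
proof (intro conjI allI impI)
  fix U :: "real set" assume "openin euclidean U"
  then have U: "open U" by simp
  show "openin (subtopology S C) {x \<in> topspace (subtopology S C). F x \<in> U}"
  proof (subst openin_subopen, intro ballI)
    fix x assume x: "x \<in> {x \<in> topspace (subtopology S C). F x \<in> U}"
    then obtain e where e: "e > 0" "\<And>y. \<bar>y - F x\<bar> < e \<Longrightarrow> y \<in> U"
      using U unfolding open_dist by (auto simp: dist_real_def)
    have xC: "x \<in> C" using x by simp
    have "e / 2 > 0" using e(1) by simp
    obtain V where V: "openin S V" "x \<in> V" "\<And>y. y \<in> V \<Longrightarrow> y \<in> K \<Longrightarrow> \<bar>F y - F x\<bar> < e / 2"
      using near[OF xC \<open>e / 2 > 0\<close>] by blast
    have "F y \<in> U" if y: "y \<in> V" "y \<in> C" for y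
    proof -
      obtain V' where V': "openin S V'" "y \<in> V'" "\<And>k. k \<in> V' \<Longrightarrow> k \<in> K \<Longrightarrow> \<bar>F k - F y\<bar> < e / 2"
        using near[OF y(2) \<open>e / 2 > 0\<close>] by blast
      have "openin S (V \<inter> V')" by (rule openin_Int[OF V(1) V'(1)])
      moreover have "y \<in> S closure_of K" using y(2) C by blast
      ultimately obtain k where "k \<in> K" "k \<in> V" "k \<in> V'" using y(1) V'(2) unfolding in_closure_of by blast
      then have "\<bar>F k - F y\<bar> < e / 2" "\<bar>F k - F x\<bar> < e / 2" using V(3) V'(3) by auto
      then have "\<bar>F y - F x\<bar> < e" by linarith
      then show ?thesis by (rule e(2))
    qed
    then have "V \<inter> C \<subseteq> {x \<in> topspace (subtopology S C). F x \<in> U}"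
      using openin_subset[OF V(1)] by auto
    moreover have "openin (subtopology S C) (V \<inter> C)" using V(1) by (rule openin_subtopology_Int)
    ultimately show "\<exists>T. openin (subtopology S C) T \<and> x \<in> T \<and> T \<subseteq> {x \<in> topspace (subtopology S C). F x \<in> U}"
      using V(2) xC by (intro exI[of _ "V \<inter> C"]) auto
  qed
qed auto

lemma relatively_compact_information_imp:
  fixes K :: "(nat \<Rightarrow> 'z::polish_space) measure set"
  assumes bd: "bounded (UNIV :: 'z set)" and N: "N \<ge> 2"
    and rc: "relatively_compact_in (information_topology N) K"
  shows "relatively_compact_in (weak_topology (power_topology N)) K"
    and "t \<in> {1..N - 1} \<Longrightarrow> ((\<lambda>\<delta>. SUP \<mu>\<in>K. information_modulus N t \<mu> \<delta>) \<longlongrightarrow> 0) (at_right 0)"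
proof -
  obtain C where C: "compactin (information_topology N) C" and KC: "K \<subseteq> C"
    using rc by (auto simp: relatively_compact_in_def)
  have "compactin (weak_topology (power_topology N)) ((\<lambda>\<mu>. \<mu>) ` C)"
    by (rule image_compactin[OF C information_finer_than_weak[OF bd N]])
  then show "relatively_compact_in (weak_topology (power_topology N)) K"
    using KC by (auto simp: relatively_compact_in_def)
  assume "t \<in> {1..N - 1}"
  then have t: "t \<in> {1..<N}" using N by auto
  show "((\<lambda>\<delta>. SUP \<mu>\<in>K. information_modulus N t \<mu> \<delta>) \<longlongrightarrow> 0) (at_right 0)"
  proof (rule order_tendstoI)
    fix a :: ennreal assume "0 < a"
    obtain e :: real where e: "e > 0" "ennreal e < a"
    proof (cases a)
      case (real r)
      then have "r > 0" using \<open>0 < a\<close> by simp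
      then show ?thesis using that[of "r / 2"] real by (simp add: ennreal_lessI)
    next
      case top
      then show ?thesis using that[of 1] by simp
    qed
    obtain \<delta>0 where \<delta>0: "\<delta>0 > 0" "\<And>\<delta> \<mu>. 0 \<le> \<delta> \<Longrightarrow> \<delta> \<le> \<delta>0 \<Longrightarrow> \<mu> \<in> C \<Longrightarrow> information_modulus N t \<mu> \<delta> \<le> ennreal e"
      by (rule compactin_information_modulus[OF bd t C e(1)]) (rule that)
    have "\<forall>\<^sub>F \<delta> in at_right 0. \<delta> \<in> {0<..<\<delta>0}" by (rule eventually_at_right_real[OF \<delta>0(1)])
    then show "\<forall>\<^sub>F \<delta> in at_right 0. (SUP \<mu>\<in>K. information_modulus N t \<mu> \<delta>) < a"
    proof eventually_elim
      case (elim \<delta>)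
      have "(SUP \<mu>\<in>K. information_modulus N t \<mu> \<delta>) \<le> ennreal e"
        using \<delta>0(2)[of \<delta>] elim KC by (intro SUP_least) auto
      then show ?case using e(2) by (rule order_le_less_trans)
    qed
  qed simp
qed

text \<open>The information topology is initial, so continuity of the identity on \<open>C\<close> reduces to continuity of the functionals
\<open>\<mu> \<mapsto> \<integral>G dI\<^sub>t \<mu>\<close>, which is known along \<open>K\<close> and extends to its closure.\<close>

lemma relatively_compact_information_intro:
  fixes K :: "(nat \<Rightarrow> 'z::polish_space) measure set"
  assumes bd: "bounded (UNIV :: 'z set)" and N: "N \<ge> 2" and K: "K \<subseteq> prob_measures (power_topology N)"
    and rc: "relatively_compact_in (weak_topology (power_topology N)) K"
    and mod: "\<And>t. t \<in> {1..N - 1} \<Longrightarrow> ((\<lambda>\<delta>. SUP \<mu>\<in>K. information_modulus N t \<mu> \<delta>) \<longlongrightarrow> 0) (at_right 0)"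
  shows "relatively_compact_in (information_topology N) K"
proof -
  let ?W = "weak_topology (power_topology N) :: (nat \<Rightarrow> 'z) measure topology"
  obtain C0 where C0: "compactin ?W C0" and KC0: "K \<subseteq> C0" using rc by (auto simp: relatively_compact_in_def)
  \<comment> \<open>Intersecting with the closure preserves compactness and makes \<open>K\<close> dense in \<open>C\<close>.\<close>
  define C where "C = ?W closure_of K \<inter> C0"
  have C: "compactin ?W C" unfolding C_def by (rule closed_Int_compactin[OF closedin_closure_of C0])
  have Cp: "C \<subseteq> prob_measures (power_topology N)" using compactin_subset_topspace[OF C] by simp
  have KC: "K \<subseteq> C" using closure_of_subset[of K ?W] K KC0 by (auto simp: C_def)
  have modulus: "\<exists>\<delta>>0. \<forall>\<nu>\<in>insert \<mu> K. information_modulus N t \<nu> \<delta> \<le> ennreal e"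
    if t: "t \<in> {1..<N}" and \<mu>: "\<mu> \<in> C" and "e > 0" for t \<mu> e
  proof -
    \<comment> \<open>A limit point outside \<open>K\<close> satisfies the modulus condition too, as a one-point set is compact.\<close>
    have "compactin (information_topology N) {\<mu>}"
      using \<mu> Cp by (auto simp: topspace_information_topology[OF N])
    from compactin_information_modulus[OF bd t this \<open>e > 0\<close>]
    obtain \<delta>0 where \<delta>0: "\<delta>0 > 0" "\<And>\<delta>. 0 \<le> \<delta> \<Longrightarrow> \<delta> \<le> \<delta>0 \<Longrightarrow> information_modulus N t \<mu> \<delta> \<le> ennreal e"
      by (metis insertI1)
    have "\<forall>\<^sub>F \<delta> in at_right 0. (SUP \<mu>\<in>K. information_modulus N t \<mu> \<delta>) < ennreal e"
      using t \<open>e > 0\<close> by (intro order_tendstoD(2)[OF mod]) auto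
    moreover have "\<forall>\<^sub>F \<delta> in at_right 0. \<delta> \<in> {0<..<\<delta>0}" by (rule eventually_at_right_real[OF \<delta>0(1)])
    ultimately have "\<forall>\<^sub>F \<delta> in at_right 0. \<delta> > 0 \<and> (\<forall>\<nu>\<in>insert \<mu> K. information_modulus N t \<nu> \<delta> \<le> ennreal e)"
    proof eventually_elim
      case (elim \<delta>)
      have "information_modulus N t \<nu> \<delta> \<le> ennreal e" if "\<nu> \<in> K" for \<nu>
        using SUP_upper[OF that, of "\<lambda>\<nu>. information_modulus N t \<nu> \<delta>"] elim(1) by (meson order_le_less_trans less_imp_le)
      then show ?case using elim(2) \<delta>0(2)[of \<delta>] by auto
    qed
    then show ?thesis using eventually_happens[of _ "at_right (0::real)"] by (auto simp: trivial_limit_at_right_real)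
  qed
  have cont: "continuous_map (subtopology ?W C) (information_topology N) (\<lambda>\<mu>. \<mu>)"
    unfolding information_topology_def
  proof (rule continuous_map_into_initial_topology)
    show "(\<lambda>\<mu>. \<mu>) \<in> topspace (subtopology ?W C) \<rightarrow> prob_measures (power_topology N)" by auto
    show "{1..<N} \<noteq> {}" using N by auto
    fix t assume t: "t \<in> {1..<N}"
    then have t': "t \<le> N" by simp
    show "information_map N t \<in> prob_measures (power_topology N :: (nat \<Rightarrow> 'z) topology) \<rightarrow> topspace (weak_topology (info_space N t))"
      using t' by (auto intro!: information_map_prob)
    show "continuous_map (subtopology ?W C) (weak_topology (info_space N t)) (information_map N t)"
    proof (rule continuous_map_into_weak_topology)
      show "information_map N t \<in> topspace (subtopology ?W C) \<rightarrow> prob_measures (info_space N t)"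
        using t' by (auto intro!: information_map_prob)
      fix G :: "(nat \<Rightarrow> 'z) \<times> (nat \<Rightarrow> 'z) measure \<Rightarrow> real" assume G: "G \<in> Cb (info_space N t)"
      show "continuous_map (subtopology ?W C) euclideanreal (\<lambda>\<mu>. \<integral>q. G q \<partial>information_map N t \<mu>)"
      proof (rule continuous_map_real_on_closure)
        show "C \<subseteq> ?W closure_of K" by (simp add: C_def)
        fix \<mu> and e :: real assume \<mu>: "\<mu> \<in> C" and "e > 0"
        have \<mu>p: "\<mu> \<in> prob_measures (power_topology N)" using \<mu> Cp by blast
        obtain V where "openin ?W V" "\<mu> \<in> V"
          "\<And>\<nu>. \<nu> \<in> V \<Longrightarrow> \<nu> \<in> K \<Longrightarrow> \<bar>(\<integral>q. G q \<partial>information_map N t \<nu>) - (\<integral>q. G q \<partial>information_map N t \<mu>)\<bar> < e"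
          by (rule information_integral_near[OF bd t' K \<mu>p modulus[OF t \<mu>] G \<open>e > 0\<close>]) (assumption, rule that)
        then show "\<exists>V. openin ?W V \<and> \<mu> \<in> V \<and>
            (\<forall>\<nu>\<in>V \<inter> K. \<bar>(\<integral>q. G q \<partial>information_map N t \<nu>) - (\<integral>q. G q \<partial>information_map N t \<mu>)\<bar> < e)"
          by blast
      qed
    qed
  qed
  have "compactin (subtopology ?W C) C" using C by (simp add: compactin_subtopology)
  from image_compactin[OF this cont] show ?thesis
    using KC by (auto simp: relatively_compact_in_def)
qed

theorem theorem1p4:
  fixes K :: "(nat \<Rightarrow> 'z::polish_space) measure set" and N :: nat
  assumes "bounded (UNIV :: 'z set)"
    and "N \<ge> 2"
    and "K \<subseteq> prob_measures (power_topology N)"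
  shows "relatively_compact_in (information_topology N) K \<longleftrightarrow>
           relatively_compact_in (weak_topology (power_topology N)) K \<and>
           (\<forall>t\<in>{1..N - 1}.
              ((\<lambda>\<delta>. SUP \<mu>\<in>K. information_modulus N t \<mu> \<delta>) \<longlongrightarrow> 0) (at_right 0))"
  using relatively_compact_information_imp[OF assms(1,2), of K] relatively_compact_information_intro[OF assms]
  by blast

end
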